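(* Let $\Phi\in L^\infty(\mathbb{M}_{n,n})$ satisfy $\|H_\Phi\|\le1$ and $\|H_\Phi\|_{\mathrm e}<1$. Then $\Phi$ has a unique unitary interpolant if and only if all superoptimal singular values of $\Phi$ are equal to $1$.
   Context: $\mathbb{M}_{m,n}$ complex $m\times n$ matrices; $H_\Phi f=\mathbb{P}_-\Phi f$ is the Hankel operator from $H^2(\mathbb{C}^n)$ to $H^2_-(\mathbb{C}^n)=L^2(\mathbb{C}^n)\ominus H^2(\mathbb{C}^n)$; $\|\cdot\|_{\mathrm e}$ the essential norm. A unitary interpolant of $\Phi$ is a unitary-valued $U\in L^\infty(\mathbb{M}_{n,n})$ with $\Phi-U\in H^\infty(\mathbb{M}_{n,n})$. Superoptimal singular values: let $\Omega_0$ be the set of $F\in H^\infty(\mathbb{M}_{n,n})$ minimizing $t_0=\operatorname{ess\,sup}_\zeta\|\Phi(\zeta)-F(\zeta)\|$, and for $j\ge1$ let $\Omega_j$ be the set of $F\in\Omega_{j-1}$ minimizing $t_j=\operatorname{ess\,sup}_\zeta s_j(\Phi(\zeta)-F(\zeta))$, where $s_j(A)=\inf\{\|A-R\|:\operatorname{rank}R\le j\}$; $t_0,\dots,t_{n-1}$ are the superoptimal singular values of $\Phi$. *)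

theory Defs
  imports "HOL-Analysis.Analysis" "HOL-Probability.Essential_Supremum"
begin

text \<open>The unit circle is parametrised by \<open>\<zeta> = cis \<theta>\<close>, \<open>\<theta> \<in> [0, 2 pi]\<close>, with
  Lebesgue measure (null sets are the same as for normalised arc length).
  The size \<open>n\<close> of the matrices is the cardinality of the finite index type \<open>'n\<close>.\<close>

definition circ :: "real measure" where
  "circ = lebesgue_on {0..2*pi}"

definition opnorm :: "complex^'n^'m \<Rightarrow> real" where
  "opnorm A = onorm (\<lambda>x::complex^'n. A *v x)"

definition adjoint_mat :: "complex^'n^'m \<Rightarrow> complex^'m^'n" where
  "adjoint_mat A = (\<chi> i j. cnj (A $ j $ i))"

definition unitary_mat :: "complex^'n^'n \<Rightarrow> bool" where
  "unitary_mat A \<longleftrightarrow> A ** adjoint_mat A = mat 1 \<and> adjoint_mat A ** A = mat 1"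

text \<open>\<open>s_j(A) = inf { \<parallel>A - R\<parallel> : rank R \<le> j }\<close> (so \<open>s_0(A) = \<parallel>A\<parallel>\<close>).\<close>
definition sval :: "nat \<Rightarrow> complex^'n^'m \<Rightarrow> real" where
  "sval j A = (INF R \<in> {R::complex^'n^'m. rank R \<le> j}. opnorm (A - R))"

definition L2norm :: "(real \<Rightarrow> complex^'n) \<Rightarrow> real" where
  "L2norm f = sqrt (\<integral>\<theta>. (norm (f \<theta>))\<^sup>2 \<partial>circ)"

definition sq_int :: "(real \<Rightarrow> complex^'n) \<Rightarrow> bool" where
  "sq_int f \<longleftrightarrow> f \<in> borel_measurable circ \<and> integrable circ (\<lambda>\<theta>. (norm (f \<theta>))\<^sup>2)"

definition fcoef :: "(real \<Rightarrow> complex^'n) \<Rightarrow> int \<Rightarrow> complex^'n" where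
  "fcoef f k = (\<chi> i. (\<integral>\<theta>. f \<theta> $ i * cis (- (of_int k * \<theta>)) \<partial>circ) / complex_of_real (2*pi))"

definition mfcoef :: "(real \<Rightarrow> complex^'n^'m) \<Rightarrow> int \<Rightarrow> complex^'n^'m" where
  "mfcoef F k = (\<chi> i j. (\<integral>\<theta>. F \<theta> $ i $ j * cis (- (of_int k * \<theta>)) \<partial>circ) / complex_of_real (2*pi))"

definition H2 :: "(real \<Rightarrow> complex^'n) \<Rightarrow> bool" where
  "H2 f \<longleftrightarrow> sq_int f \<and> (\<forall>k<0. fcoef f k = 0)"

definition H2minus :: "(real \<Rightarrow> complex^'n) \<Rightarrow> bool" where
  "H2minus f \<longleftrightarrow> sq_int f \<and> (\<forall>k\<ge>0. fcoef f k = 0)"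

text \<open>Orthogonal projection \<open>P_-\<close> of \<open>L^2\<close> onto \<open>H^2_-\<close> (determined up to a.e. equality).\<close>
definition Pminus :: "(real \<Rightarrow> complex^'n) \<Rightarrow> (real \<Rightarrow> complex^'n)" where
  "Pminus g = (SOME h. sq_int h \<and> (\<forall>k. fcoef h k = (if k < 0 then fcoef g k else 0)))"

definition Linf :: "(real \<Rightarrow> complex^'n^'m) \<Rightarrow> bool" where
  "Linf F \<longleftrightarrow> F \<in> borel_measurable circ \<and> (\<exists>B. AE \<theta> in circ. opnorm (F \<theta>) \<le> B)"

definition Hinf :: "(real \<Rightarrow> complex^'n^'m) \<Rightarrow> bool" where
  "Hinf F \<longleftrightarrow> Linf F \<and> (\<forall>k<0. mfcoef F k = 0)"

definition hankel :: "(real \<Rightarrow> complex^'n^'n) \<Rightarrow> (real \<Rightarrow> complex^'n) \<Rightarrow> (real \<Rightarrow> complex^'n)" where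
  "hankel \<Phi> f = Pminus (\<lambda>\<theta>. \<Phi> \<theta> *v f \<theta>)"

definition hankel_norm_le :: "(real \<Rightarrow> complex^'n^'n) \<Rightarrow> real \<Rightarrow> bool" where
  "hankel_norm_le \<Phi> c \<longleftrightarrow> (\<forall>f. H2 f \<longrightarrow> L2norm (hankel \<Phi> f) \<le> c * L2norm f)"

text \<open>Compact (linear) operators from \<open>H^2(C^n)\<close> to \<open>H^2_-(C^n)\<close>: every bounded sequence
  has a subsequence whose image is Cauchy (hence convergent, \<open>L^2\<close> being complete).\<close>
definition cpt_operator :: "((real \<Rightarrow> complex^'n) \<Rightarrow> (real \<Rightarrow> complex^'n)) \<Rightarrow> bool" where
  "cpt_operator T \<longleftrightarrow>
     (\<forall>f. H2 f \<longrightarrow> H2minus (T f)) \<and>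
     (\<forall>f g. H2 f \<longrightarrow> H2 g \<longrightarrow> T (\<lambda>\<theta>. f \<theta> + g \<theta>) = (\<lambda>\<theta>. T f \<theta> + T g \<theta>)) \<and>
     (\<forall>(c::complex) f. H2 f \<longrightarrow> T (\<lambda>\<theta>. c *s f \<theta>) = (\<lambda>\<theta>. c *s T f \<theta>)) \<and>
     (\<forall>s::nat \<Rightarrow> real \<Rightarrow> complex^'n. (\<forall>m. H2 (s m)) \<longrightarrow> (\<exists>B::real. \<forall>m::nat. L2norm (s m) \<le> B) \<longrightarrow>
        (\<exists>r::nat \<Rightarrow> nat. strict_mono r \<and>
           (\<forall>e>0. \<exists>N. \<forall>a\<ge>N. \<forall>b\<ge>N. L2norm (\<lambda>\<theta>. T (s (r a)) \<theta> - T (s (r b)) \<theta>) < e)))"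

definition hankel_ess_norm_lt :: "(real \<Rightarrow> complex^'n^'n) \<Rightarrow> real \<Rightarrow> bool" where
  "hankel_ess_norm_lt \<Phi> c \<longleftrightarrow> (\<exists>T d. cpt_operator T \<and> d < c \<and>
      (\<forall>f. H2 f \<longrightarrow> L2norm (\<lambda>\<theta>. hankel \<Phi> f \<theta> - T f \<theta>) \<le> d * L2norm f))"

definition unitary_interpolant :: "(real \<Rightarrow> complex^'n^'n) \<Rightarrow> (real \<Rightarrow> complex^'n^'n) \<Rightarrow> bool" where
  "unitary_interpolant \<Phi> U \<longleftrightarrow> Linf U \<and> (AE \<theta> in circ. unitary_mat (U \<theta>)) \<and>
      Hinf (\<lambda>\<theta>. \<Phi> \<theta> - U \<theta>)"

definition unique_unitary_interpolant :: "(real \<Rightarrow> complex^'n^'n) \<Rightarrow> bool" where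
  "unique_unitary_interpolant \<Phi> \<longleftrightarrow> (\<exists>U. unitary_interpolant \<Phi> U) \<and>
     (\<forall>U V. unitary_interpolant \<Phi> U \<longrightarrow> unitary_interpolant \<Phi> V \<longrightarrow> (AE \<theta> in circ. U \<theta> = V \<theta>))"

definition so_err :: "(real \<Rightarrow> complex^'n^'n) \<Rightarrow> nat \<Rightarrow> (real \<Rightarrow> complex^'n^'n) \<Rightarrow> ereal" where
  "so_err \<Phi> j F = esssup circ (\<lambda>\<theta>. ereal (sval j (\<Phi> \<theta> - F \<theta>)))"

text \<open>\<open>so_dom \<Phi> j\<close> is the set over which the \<open>j\<close>-th quantity is minimised:
  \<open>H^\<infinity>\<close> for \<open>j = 0\<close> and \<open>\<Omega>_{j-1}\<close> for \<open>j \<ge> 1\<close>; \<open>so_omega \<Phi> j = \<Omega>_j\<close>.\<close>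
fun so_dom :: "(real \<Rightarrow> complex^'n^'n) \<Rightarrow> nat \<Rightarrow> (real \<Rightarrow> complex^'n^'n) set"
and so_omega :: "(real \<Rightarrow> complex^'n^'n) \<Rightarrow> nat \<Rightarrow> (real \<Rightarrow> complex^'n^'n) set" where
  "so_dom \<Phi> 0 = {F. Hinf F}"
| "so_dom \<Phi> (Suc j) = so_omega \<Phi> j"
| "so_omega \<Phi> j = {F \<in> so_dom \<Phi> j. \<forall>G \<in> so_dom \<Phi> j. so_err \<Phi> j F \<le> so_err \<Phi> j G}"

definition superopt_sv :: "(real \<Rightarrow> complex^'n^'n) \<Rightarrow> nat \<Rightarrow> ereal" where
  "superopt_sv \<Phi> j = (INF F \<in> so_dom \<Phi> j. so_err \<Phi> j F)"

end

theory Submission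
  imports Defs
begin

text \<open>Let \<open>H\<close> be the Hankel operator of \<open>\<Phi>\<close> and \<open>E = {f \<in> H\<^sup>2. \<parallel>H f\<parallel> = \<parallel>f\<parallel>}\<close>. The essential norm
  condition makes \<open>\<parallel>f\<parallel>\<^sup>2 - \<parallel>H f\<parallel>\<^sup>2\<close> coercive on the orthogonal complement of the
  finite-dimensional space \<open>E\<close>. Every contractive \<open>G \<in> \<Phi> + H\<^sup>\<infinity>\<close> satisfies \<open>G f = H f\<close> and \<open>G\<^sup>* G f = f\<close>
  for \<open>f \<in> E\<close>. If the values \<open>f(0)\<close>, \<open>f \<in> E\<close>, fill \<open>\<complex>\<^sup>n\<close>, then so do the values \<open>f(\<zeta>)\<close> at almost every
  \<open>\<zeta>\<close>, hence \<open>G\<close> is unitary and unique.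

  If they do not fill \<open>\<complex>\<^sup>n\<close>, there is a nonzero projection-valued \<open>P\<close> with \<open>P f = 0\<close> for all \<open>f \<in> E\<close>, and
  coercivity gives \<open>\<parallel>H f\<parallel> \<le> \<parallel>(1 - \<epsilon> P) f\<parallel>\<close> on \<open>H\<^sup>2\<close>. A weighted form of Nehari's theorem then yields
  \<open>G \<in> \<Phi> + H\<^sup>\<infinity>\<close> with \<open>|G x| \<le> |(1 - \<epsilon> P) x|\<close> pointwise, so that the last superoptimal singular
  value is below 1.

  Conversely, let \<open>C\<close> be the compact convex set of all \<open>c\<close> for which the Hankel matrix extended by
  the entry \<open>c\<close> is still contractive. At an extreme point of \<open>C\<close> the extended
  operator has so many maximising vectors that its contractive interpolant is unitary. Hence, if
  \<open>\<Phi>\<close> has only one unitary interpolant, \<open>C\<close> is a single point and this interpolant is the only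
  contractive one.\<close>

section \<open>Matrices and the Hilbert space \<open>L\<^sup>2\<close>\<close>

text \<open>The obstacle in the converse is that \<open>H\<close> may have no maximising vectors at
  all: if its norm is below 1, \<open>E\<close> is trivial and gives no hold on interpolants.
  Prescribing one more Fourier coefficient of the interpolant repairs this. The contractive
  \<open>G\<close> for which the zeroth coefficient of \<open>\<Phi> - G\<close> is
  \<open>- c\<close> correspond, through division by \<zeta>, to the contractive interpolants of
  \<open>stepS \<Phi> c\<close>. Pushing \<open>c\<close> to an extreme point creates maximising
  vectors, but one cannot tell whether on the domain or on the range side; hence the two
  alternatives in \<open>full\<close>. The passage from the origin to almost every point of the
  circle avoids inner-outer factorisation: the reproducing kernels at 0 of a shift-invariant space
  have a constant Gram matrix. Nehari's theorem is proved by adding one block row at a time, because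
  the same extension by \<open>c\<close> is needed for the extreme points anyway; the weight is
  harmless there because multiplication by it commutes with the shift. Finite dimension of
  \<open>E\<close> enters as compactness of its unit ball.\<close>

lemma norm_smult_vec: "norm (c *s (x::complex^'n)) = cmod c * norm x"
  by (simp add: norm_vec_def L2_set_def norm_mult power_mult_distrib
      flip: sum_distrib_left) (simp add: real_sqrt_mult)

lemma mat_mult_vec: "mat c *v (x::complex^'n) = c *s x"
  by (simp add: vec_eq_iff matrix_vector_mult_def mat_def if_distrib[of "\<lambda>u. u * _"] cong: if_cong)

lemma inner_vec_complex: "x \<bullet> y = Re (\<Sum>i\<in>UNIV. x $ i * cnj (y $ i))" for x y :: "complex^'n"
  by (simp add: inner_vec_def inner_complex_def)

lemma inner_matrix_adjoint:
  "(A *v x) \<bullet> y = x \<bullet> (adjoint_mat A *v y)" for A :: "complex^'n^'m"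
proof -
  have "(\<Sum>i\<in>UNIV. (A *v x) $ i * cnj (y $ i)) = (\<Sum>i\<in>UNIV. \<Sum>j\<in>UNIV. A $ i $ j * x $ j * cnj (y $ i))"
    by (simp add: matrix_vector_mult_def sum_distrib_right)
  also have "\<dots> = (\<Sum>j\<in>UNIV. \<Sum>i\<in>UNIV. A $ i $ j * x $ j * cnj (y $ i))"
    by (rule sum.swap)
  also have "\<dots> = (\<Sum>j\<in>UNIV. x $ j * cnj ((adjoint_mat A *v y) $ j))"
    by (simp add: matrix_vector_mult_def adjoint_mat_def sum_distrib_left mult_ac)
  finally show ?thesis
    by (simp add: inner_vec_complex)
qed

lemma matrix_vector_mult_scaleR: "A *v (r *\<^sub>R x) = r *\<^sub>R (A *v x)" for A :: "complex^'n^'m"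
  by (simp add: vec_eq_iff matrix_vector_mult_def scaleR_sum_right)

lemma scaleR_matrix_vector_mult: "(r *\<^sub>R A) *v x = r *\<^sub>R (A *v x)" for A :: "complex^'n^'m"
  by (simp add: vec_eq_iff matrix_vector_mult_def scaleR_sum_right)

lemma scaleR_as_smult: "r *\<^sub>R x = complex_of_real r *s x" for x :: "complex^'n"
  by (simp add: vec_eq_iff) (simp add: scaleR_conv_of_real)

lemma bounded_bilinear_matrix_vector:
  "bounded_bilinear (\<lambda>(A::complex^'n^'m) x. A *v x)"
  unfolding bilinear_conv_bounded_bilinear[symmetric] bilinear_def
  by (auto intro!: linearI simp: matrix_vector_right_distrib matrix_vector_mult_add_rdistrib
      matrix_vector_mult_scaleR scaleR_matrix_vector_mult)

lemma bounded_bilinear_smult: "bounded_bilinear (\<lambda>(c::complex) (x::complex^'n). c *s x)"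
  unfolding bilinear_conv_bounded_bilinear[symmetric] bilinear_def
  by (auto intro!: linearI simp: vec_eq_iff algebra_simps)

lemma bounded_linear_matrix_vector: "bounded_linear (\<lambda>x. A *v x)" for A :: "complex^'n^'m"
  using bounded_bilinear_matrix_vector by (rule bounded_bilinear.bounded_linear_right)

lemma opnorm_mult_le: "norm (A *v x) \<le> opnorm A * norm x" for A :: "complex^'n^'m"
  unfolding opnorm_def by (rule onorm[OF bounded_linear_matrix_vector])

lemma opnorm_le: "(\<And>x. norm (A *v x) \<le> b * norm x) \<Longrightarrow> opnorm A \<le> b" for A :: "complex^'n^'m"
  unfolding opnorm_def by (rule onorm_le)

lemma opnorm_nonneg: "0 \<le> opnorm A" for A :: "complex^'n^'m"
  unfolding opnorm_def by (rule onorm_pos_le[OF bounded_linear_matrix_vector])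

section \<open>The circle measure, measurability and essentially bounded matrix functions\<close>

lemma space_circ [simp]: "space circ = {0..2*pi}"
  by (simp add: circ_def)

lemma emeasure_circ_space: "emeasure circ {0..2*pi} = ennreal (2*pi)"
  by (simp add: circ_def emeasure_restrict_space)

lemma finite_measure_circ: "finite_measure circ"
  by (rule finite_measureI) (simp add: emeasure_circ_space)

interpretation circ: finite_measure circ
  by (rule finite_measure_circ)

lemma borel_measurable_circ: "f \<in> borel_measurable borel \<Longrightarrow> f \<in> borel_measurable circ"
  unfolding circ_def
  by (intro measurable_restrict_space1 measurable_completion) simp

lemma measurable_vec_lambda:
  fixes f :: "'i::finite \<Rightarrow> 'a \<Rightarrow> 'b::euclidean_space"
  assumes "\<And>i. f i \<in> borel_measurable M"
  shows "(\<lambda>x. \<chi> i. f i x) \<in> borel_measurable M"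
proof (subst borel_measurable_euclidean_space, safe)
  fix b :: "'b^'i" assume "b \<in> Basis"
  have "(\<lambda>x. (\<chi> i. f i x) \<bullet> b) = (\<lambda>x. \<Sum>i\<in>UNIV. f i x \<bullet> b $ i)"
    by (simp add: inner_vec_def)
  then show "(\<lambda>x. (\<chi> i. f i x) \<bullet> b) \<in> borel_measurable M"
    using assms by simp
qed

lemma measurable_vec_nth:
  fixes f :: "'a \<Rightarrow> 'b::euclidean_space^'i"
  assumes "f \<in> borel_measurable M"
  shows "(\<lambda>x. f x $ i) \<in> borel_measurable M"
proof (rule measurable_compose[OF assms])
  show "(\<lambda>y. y $ i) \<in> borel_measurable (borel :: ('b^'i) measure)"
    by (intro borel_measurable_continuous_onI continuous_intros)
qed

lemma measurable_matrix_vector: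
  fixes A :: "'a \<Rightarrow> complex^'n^'m"
  assumes "A \<in> borel_measurable M" "f \<in> borel_measurable M"
  shows "(\<lambda>x. A x *v f x) \<in> borel_measurable M"
  by (rule borel_measurable_continuous_Pair[OF assms])
    (rule bounded_bilinear.continuous_on[OF bounded_bilinear_matrix_vector]; intro continuous_intros)

lemma measurable_matrix_matrix:
  fixes A :: "'a \<Rightarrow> complex^'n^'m" and B :: "'a \<Rightarrow> complex^'k^'n"
  assumes "A \<in> borel_measurable M" "B \<in> borel_measurable M"
  shows "(\<lambda>x. A x ** B x) \<in> borel_measurable M"
  unfolding matrix_matrix_mult_def
  by (intro measurable_vec_lambda borel_measurable_sum borel_measurable_times measurable_vec_nth assms)

lemma measurable_adjoint:
  fixes A :: "'a \<Rightarrow> complex^'n^'m"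
  assumes "A \<in> borel_measurable M"
  shows "(\<lambda>x. adjoint_mat (A x)) \<in> borel_measurable M"
  unfolding adjoint_mat_def
  by (intro measurable_vec_lambda measurable_compose[OF _ borel_measurable_continuous_onI[OF continuous_on_cnj]]
    measurable_vec_nth assms continuous_intros)

lemma measurable_mat:
  "c \<in> borel_measurable M \<Longrightarrow> (\<lambda>x. mat (c x) :: complex^'n^'n) \<in> borel_measurable M"
  unfolding mat_def by (intro measurable_vec_lambda) (simp split: if_split)

lemma LinfI:
  "F \<in> borel_measurable circ \<Longrightarrow> AE \<theta> in circ. \<forall>x. norm (F \<theta> *v x) \<le> B * norm x \<Longrightarrow> Linf F"
  unfolding Linf_def by (auto intro!: exI[of _ B] elim!: eventually_mono intro: opnorm_le)

lemma LinfE: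
  assumes "Linf F"
  obtains B where "B \<ge> 0" "AE \<theta> in circ. \<forall>x. norm (F \<theta> *v x) \<le> B * norm x"
proof -
  from assms obtain B where B: "AE \<theta> in circ. opnorm (F \<theta>) \<le> B" by (auto simp: Linf_def)
  have "AE \<theta> in circ. \<forall>x. norm (F \<theta> *v x) \<le> max B 0 * norm x"
    using B
  proof eventually_elim
    case (elim \<theta>)
    show ?case
    proof
      fix x
      have "norm (F \<theta> *v x) \<le> opnorm (F \<theta>) * norm x" by (rule opnorm_mult_le)
      also have "\<dots> \<le> max B 0 * norm x" using elim by (intro mult_right_mono) auto
      finally show "norm (F \<theta> *v x) \<le> max B 0 * norm x" .
    qed
  qed
  then show thesis
    by (intro that[of "max B 0"]) simp_all
qed

lemma Linf_measurable: "Linf F \<Longrightarrow> F \<in> borel_measurable circ"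
  by (simp add: Linf_def)

lemma Linf_const: "Linf (\<lambda>_. A)"
  by (auto simp: Linf_def)

lemma Linf_add:
  assumes "Linf F" "Linf G" shows "Linf (\<lambda>\<theta>. F \<theta> + G \<theta>)"
proof -
  obtain A where A: "A \<ge> 0" "AE \<theta> in circ. \<forall>x. norm (F \<theta> *v x) \<le> A * norm x"
    using assms(1) by (rule LinfE)
  obtain B where B: "B \<ge> 0" "AE \<theta> in circ. \<forall>x. norm (G \<theta> *v x) \<le> B * norm x"
    using assms(2) by (rule LinfE)
  show ?thesis
  proof (rule LinfI)
    show "AE \<theta> in circ. \<forall>x. norm ((F \<theta> + G \<theta>) *v x) \<le> (A + B) * norm x"
      using A(2) B(2)
    proof eventually_elim
      case (elim \<theta>)
      show ?case
        using elim by (auto simp: matrix_vector_mult_add_rdistrib distrib_right intro!: norm_triangle_le add_mono)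
    qed
  qed (intro borel_measurable_add Linf_measurable assms)
qed

lemma Linf_mult:
  assumes "Linf F" "Linf G" shows "Linf (\<lambda>\<theta>. F \<theta> ** G \<theta>)"
proof -
  obtain A where A: "A \<ge> 0" "AE \<theta> in circ. \<forall>x. norm (F \<theta> *v x) \<le> A * norm x"
    using assms(1) by (rule LinfE)
  obtain B where B: "B \<ge> 0" "AE \<theta> in circ. \<forall>x. norm (G \<theta> *v x) \<le> B * norm x"
    using assms(2) by (rule LinfE)
  show ?thesis
  proof (rule LinfI)
    show "AE \<theta> in circ. \<forall>x. norm ((F \<theta> ** G \<theta>) *v x) \<le> (A * B) * norm x"
      using A(2) B(2)
    proof eventually_elim
      case (elim \<theta>)
      show ?case
      proof
        fix x
        have "norm (F \<theta> *v (G \<theta> *v x)) \<le> A * norm (G \<theta> *v x)" using elim by blast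
        also have "\<dots> \<le> A * (B * norm x)" using elim A(1) by (intro mult_left_mono) auto
        finally show "norm ((F \<theta> ** G \<theta>) *v x) \<le> (A * B) * norm x"
          by (simp add: matrix_vector_mul_assoc mult.assoc)
      qed
    qed
  qed (use assms in \<open>auto simp: Linf_measurable intro: measurable_matrix_matrix\<close>)
qed

lemma Linf_mat:
  assumes "c \<in> borel_measurable circ" "\<And>\<theta>. cmod (c \<theta>) \<le> B"
  shows "Linf (\<lambda>\<theta>. mat (c \<theta>) :: complex^'n^'n)"
  by (rule LinfI[where B=B]) (use assms in \<open>auto simp: measurable_mat mat_mult_vec norm_smult_vec intro!: AE_I2 mult_right_mono\<close>)

lemma mat_mult_eq_smult: "mat c ** A = (\<chi> i. c *s A $ i)" for A :: "complex^'n^'m"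
  by (simp add: vec_eq_iff matrix_matrix_mult_def mat_def if_distrib[of "\<lambda>u. u * _"] cong: if_cong)

lemma uminus_as_mat: "- A = mat (-1) ** A" for A :: "complex^'n^'m"
  by (simp add: vec_eq_iff mat_mult_eq_smult)

lemma Linf_diff:
  assumes "Linf F" "Linf G" shows "Linf (\<lambda>\<theta>. F \<theta> - G \<theta>)"
  using Linf_add[OF assms(1) Linf_mult[OF Linf_const[of "mat (-1)"] assms(2)]]
  by (simp flip: uminus_as_mat)

lemma norm_adjoint_mult_le:
  fixes A :: "complex^'n^'m"
  assumes "\<forall>x. norm (A *v x) \<le> B * norm x"
  shows "norm (adjoint_mat A *v y) \<le> B * norm y"
proof -
  let ?z = "adjoint_mat A *v y"
  have "norm ?z * norm ?z = (A *v ?z) \<bullet> y"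
    by (simp add: inner_matrix_adjoint flip: power2_eq_square power2_norm_eq_inner)
  also have "\<dots> \<le> norm (A *v ?z) * norm y" by (rule norm_cauchy_schwarz)
  also have "\<dots> \<le> B * norm ?z * norm y" using assms by (intro mult_right_mono) auto
  finally have "norm ?z * norm ?z \<le> norm ?z * (B * norm y)" by (simp add: mult_ac)
  \<comment> \<open>\<open>B\<close> is not assumed to be nonnegative. A unit vector shows that it
    is, which is all that is needed when \<open>?z\<close> vanishes.\<close>
  moreover have "0 \<le> B"
    using assms[rule_format, of "axis undefined 1"] norm_ge_zero[of "A *v axis undefined 1"]
    by (simp add: norm_axis_1 del: norm_ge_zero)
  ultimately show ?thesis
    by (cases "norm ?z = 0") auto
qed

lemma Linf_adjoint:
  assumes "Linf F" shows "Linf (\<lambda>\<theta>. adjoint_mat (F \<theta>))"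
proof -
  obtain B where B: "B \<ge> 0" "AE \<theta> in circ. \<forall>x. norm (F \<theta> *v x) \<le> B * norm x"
    using assms by (rule LinfE)
  show ?thesis
    by (rule LinfI[where B=B])
      (use B(2) in \<open>auto intro: measurable_adjoint Linf_measurable assms norm_adjoint_mult_le elim!: eventually_mono\<close>)
qed

section \<open>Square integrable functions and the real Hilbert space of their classes\<close>

lemma sq_intI: "f \<in> borel_measurable circ \<Longrightarrow> integrable circ (\<lambda>\<theta>. (norm (f \<theta>))\<^sup>2) \<Longrightarrow> sq_int f"
  by (simp add: sq_int_def)

lemma sq_int_AE_bound:
  assumes f: "sq_int f" and g: "g \<in> borel_measurable circ"
    and "AE \<theta> in circ. norm (g \<theta>) \<le> B * norm (f \<theta>)"
  shows "sq_int g"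
proof (rule sq_intI[OF g])
  have "integrable circ (\<lambda>\<theta>. B\<^sup>2 * (norm (f \<theta>))\<^sup>2)"
    using f by (simp add: sq_int_def)
  then show "integrable circ (\<lambda>\<theta>. (norm (g \<theta>))\<^sup>2)"
  proof (rule Bochner_Integration.integrable_bound)
    show "AE \<theta> in circ. norm ((norm (g \<theta>))\<^sup>2) \<le> norm (B\<^sup>2 * (norm (f \<theta>))\<^sup>2)"
      using assms(3)
      by eventually_elim (simp add: power_mono flip: power_mult_distrib)
  qed (use g in measurable)
qed

lemma sq_int_add:
  assumes "sq_int f" "sq_int g" shows "sq_int (\<lambda>\<theta>. f \<theta> + g \<theta>)"
proof (rule sq_intI)
  have [measurable]: "f \<in> borel_measurable circ" "g \<in> borel_measurable circ"
    using assms by (auto simp: sq_int_def)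
  show "(\<lambda>\<theta>. f \<theta> + g \<theta>) \<in> borel_measurable circ" by measurable
  have "integrable circ (\<lambda>\<theta>. 2 * (norm (f \<theta>))\<^sup>2 + 2 * (norm (g \<theta>))\<^sup>2)"
    using assms by (auto simp: sq_int_def)
  then show "integrable circ (\<lambda>\<theta>. (norm (f \<theta> + g \<theta>))\<^sup>2)"
  proof (rule Bochner_Integration.integrable_bound)
    have "(norm (x + y))\<^sup>2 \<le> 2 * (norm x)\<^sup>2 + 2 * (norm y)\<^sup>2" for x y :: "complex^'a"
    proof -
      have "(norm (x + y))\<^sup>2 \<le> (norm x + norm y)\<^sup>2" by (intro power_mono norm_triangle_ineq) auto
      also have "\<dots> \<le> 2 * (norm x)\<^sup>2 + 2 * (norm y)\<^sup>2"
        using zero_le_power2[of "norm x - norm y"] by (simp add: power2_eq_square algebra_simps)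
      finally show ?thesis .
    qed
    then show "AE \<theta> in circ. norm ((norm (f \<theta> + g \<theta>))\<^sup>2) \<le> norm (2 * (norm (f \<theta>))\<^sup>2 + 2 * (norm (g \<theta>))\<^sup>2)"
      by (auto intro!: AE_I2 order_trans[OF _ abs_ge_self])
  qed measurable
qed

lemma sq_int_matrix:
  assumes "Linf A" "sq_int f" shows "sq_int (\<lambda>\<theta>. A \<theta> *v f \<theta>)"
proof -
  obtain B where B: "B \<ge> 0" "AE \<theta> in circ. \<forall>x. norm (A \<theta> *v x) \<le> B * norm x"
    using assms(1) by (rule LinfE)
  show ?thesis
  proof (rule sq_int_AE_bound[OF assms(2)])
    show "AE \<theta> in circ. norm (A \<theta> *v f \<theta>) \<le> B * norm (f \<theta>)"
      using B(2) by eventually_elim auto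
  qed (use assms in \<open>auto simp: sq_int_def intro: measurable_matrix_vector Linf_measurable\<close>)
qed

lemma sq_int_scaleR: "sq_int f \<Longrightarrow> sq_int (\<lambda>\<theta>. r *\<^sub>R f \<theta>)"
  by (rule sq_int_AE_bound[where B="\<bar>r\<bar>"]) (auto simp: sq_int_def)

lemma sq_int_uminus: "sq_int f \<Longrightarrow> sq_int (\<lambda>\<theta>. - f \<theta>)"
  using sq_int_scaleR[of f "-1"] by simp

lemma sq_int_diff: "sq_int f \<Longrightarrow> sq_int g \<Longrightarrow> sq_int (\<lambda>\<theta>. f \<theta> - g \<theta>)"
  using sq_int_add[OF _ sq_int_uminus] by simp

lemma sq_int_const: "sq_int (\<lambda>_. c)"
  by (simp add: sq_int_def)

lemma integrable_inner:
  assumes "sq_int f" "sq_int g" shows "integrable circ (\<lambda>\<theta>. f \<theta> \<bullet> g \<theta>)"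
proof -
  have [measurable]: "f \<in> borel_measurable circ" "g \<in> borel_measurable circ"
    using assms by (auto simp: sq_int_def)
  have "integrable circ (\<lambda>\<theta>. (norm (f \<theta>))\<^sup>2 + (norm (g \<theta>))\<^sup>2)"
    using assms by (auto simp: sq_int_def)
  then show ?thesis
  proof (rule Bochner_Integration.integrable_bound)
    have "\<bar>x \<bullet> y\<bar> \<le> (norm x)\<^sup>2 + (norm y)\<^sup>2" for x y :: "complex^'a"
    proof -
      have "\<bar>x \<bullet> y\<bar> \<le> norm x * norm y" by (rule Cauchy_Schwarz_ineq2)
      also have "\<dots> \<le> (norm x)\<^sup>2 + (norm y)\<^sup>2"
        using zero_le_power2[of "norm x - norm y"] zero_le_power2[of "norm x"] zero_le_power2[of "norm y"]
        unfolding power2_diff by linarith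
      finally show ?thesis .
    qed
    then show "AE \<theta> in circ. norm (f \<theta> \<bullet> g \<theta>) \<le> norm ((norm (f \<theta>))\<^sup>2 + (norm (g \<theta>))\<^sup>2)"
      by (auto intro!: AE_I2)
  qed measurable
qed

text \<open>Instead of equivalence classes modulo null sets the type contains one chosen representative
  of each class.\<close>

typedef (overloaded) ('n::finite) L2 =
  "{f::real \<Rightarrow> complex^'n. \<exists>g. sq_int g \<and> f = (SOME h. sq_int h \<and> (AE \<theta> in circ. h \<theta> = g \<theta>))}"
  by (rule exI[of _ "SOME h. sq_int h \<and> (AE \<theta> in circ. h \<theta> = 0)"]) (auto intro!: exI[of _ "\<lambda>_. 0"] simp: sq_int_const)

definition mk :: "(real \<Rightarrow> complex^'n) \<Rightarrow> 'n L2" where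
  "mk g = Abs_L2 (SOME h. sq_int h \<and> (AE \<theta> in circ. h \<theta> = g \<theta>))"

abbreviation rep :: "'n L2 \<Rightarrow> real \<Rightarrow> complex^'n" where "rep \<equiv> Rep_L2"

lemma some_sq_int:
  assumes "sq_int g"
  shows "sq_int (SOME h. sq_int h \<and> (AE \<theta> in circ. h \<theta> = g \<theta>))"
    "AE \<theta> in circ. (SOME h. sq_int h \<and> (AE \<theta> in circ. h \<theta> = g \<theta>)) \<theta> = g \<theta>"
  using someI[of "\<lambda>h. sq_int h \<and> (AE \<theta> in circ. h \<theta> = g \<theta>)" g] assms by auto

lemma sq_int_rep: "sq_int (rep a)"
  using Rep_L2[of a] some_sq_int by auto

lemma rep_mk: "sq_int g \<Longrightarrow> AE \<theta> in circ. rep (mk g) \<theta> = g \<theta>"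
  unfolding mk_def by (subst Abs_L2_inverse) (auto simp: some_sq_int(2))

text \<open>Functions that agree almost everywhere define the same predicate under
  \<open>SOME\<close>, hence literally the same representative. This is how almost everywhere
  equality becomes equality.\<close>

lemma mk_cong:
  assumes "AE \<theta> in circ. f \<theta> = g \<theta>" shows "mk f = mk g"
proof -
  have "(AE \<theta> in circ. h \<theta> = f \<theta>) = (AE \<theta> in circ. h \<theta> = g \<theta>)" for h
    using assms by (auto elim!: eventually_elim2)
  then show ?thesis by (simp add: mk_def)
qed

lemma mk_rep: "mk (rep a) = a"
proof -
  obtain g where g: "sq_int g" "rep a = (SOME h. sq_int h \<and> (AE \<theta> in circ. h \<theta> = g \<theta>))"
    using Rep_L2[of a] by auto
  have "mk (rep a) = mk g" using some_sq_int(2)[OF g(1)] g(2) by (intro mk_cong) simp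
  also have "\<dots> = a" by (simp add: mk_def g(2)[symmetric] Rep_L2_inverse)
  finally show ?thesis .
qed

lemma L2_eqI: "AE \<theta> in circ. rep a \<theta> = rep b \<theta> \<Longrightarrow> a = b"
  using mk_cong[of "rep a" "rep b"] by (simp add: mk_rep)

instantiation L2 :: (finite) real_vector
begin

definition zero_L2 :: "'a L2" where "0 = mk (\<lambda>_. 0)"
definition plus_L2 :: "'a L2 \<Rightarrow> 'a L2 \<Rightarrow> 'a L2" where "a + b = mk (\<lambda>\<theta>. rep a \<theta> + rep b \<theta>)"
definition minus_L2 :: "'a L2 \<Rightarrow> 'a L2 \<Rightarrow> 'a L2" where "a - b = mk (\<lambda>\<theta>. rep a \<theta> - rep b \<theta>)"
definition uminus_L2 :: "'a L2 \<Rightarrow> 'a L2" where "- a = mk (\<lambda>\<theta>. - rep a \<theta>)"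
definition scaleR_L2 :: "real \<Rightarrow> 'a L2 \<Rightarrow> 'a L2" where "r *\<^sub>R a = mk (\<lambda>\<theta>. r *\<^sub>R rep a \<theta>)"
lemma rep_zero: "AE \<theta> in circ. rep (0::'a L2) \<theta> = 0"
  unfolding zero_L2_def by (intro rep_mk sq_int_const)

lemma rep_add: "AE \<theta> in circ. rep (a + b :: 'a L2) \<theta> = rep a \<theta> + rep b \<theta>"
  unfolding plus_L2_def by (intro rep_mk sq_int_add sq_int_rep)

lemma rep_diff: "AE \<theta> in circ. rep (a - b :: 'a L2) \<theta> = rep a \<theta> - rep b \<theta>"
  unfolding minus_L2_def by (intro rep_mk sq_int_diff sq_int_rep)

lemma rep_uminus: "AE \<theta> in circ. rep (- a :: 'a L2) \<theta> = - rep a \<theta>"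
  unfolding uminus_L2_def by (intro rep_mk sq_int_uminus sq_int_rep)

lemma rep_scaleR: "AE \<theta> in circ. rep (r *\<^sub>R a :: 'a L2) \<theta> = r *\<^sub>R rep a \<theta>"
  unfolding scaleR_L2_def by (intro rep_mk sq_int_scaleR sq_int_rep)

instance
proof
  fix a b c :: "'a L2" and r s :: real
  show "a + b + c = a + (b + c)"
    by (rule L2_eqI) (use rep_add[of a b] rep_add[of "a + b" c] rep_add[of b c] rep_add[of a "b + c"] in \<open>eventually_elim, simp add: add.assoc\<close>)
  show "a + b = b + a"
    by (rule L2_eqI) (use rep_add[of a b] rep_add[of b a] in \<open>eventually_elim, simp\<close>)
  show "0 + a = a"
    by (rule L2_eqI) (use rep_add[of 0 a] rep_zero in \<open>eventually_elim, simp\<close>)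
  show "- a + a = 0"
    by (rule L2_eqI) (use rep_add[of "- a" a] rep_zero rep_uminus[of a] in \<open>eventually_elim, simp\<close>)
  show "a - b = a + - b"
    by (rule L2_eqI) (use rep_add[of a "- b"] rep_diff[of a b] rep_uminus[of b] in \<open>eventually_elim, simp\<close>)
  show "r *\<^sub>R (a + b) = r *\<^sub>R a + r *\<^sub>R b"
    by (rule L2_eqI) (use rep_add[of a b] rep_scaleR[of r "a + b"] rep_scaleR[of r a] rep_scaleR[of r b]
      rep_add[of "r *\<^sub>R a" "r *\<^sub>R b"] in \<open>eventually_elim, simp add: scaleR_add_right\<close>)
  show "(r + s) *\<^sub>R a = r *\<^sub>R a + s *\<^sub>R a"
    by (rule L2_eqI) (use rep_scaleR[of "r + s" a] rep_scaleR[of r a] rep_scaleR[of s a] rep_add[of "r *\<^sub>R a" "s *\<^sub>R a"] in \<open>eventually_elim, simp add: scaleR_add_left\<close>)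
  show "r *\<^sub>R s *\<^sub>R a = (r * s) *\<^sub>R a"
    by (rule L2_eqI) (use rep_scaleR[of "r * s" a] rep_scaleR[of s a] rep_scaleR[of r "s *\<^sub>R a"] in \<open>eventually_elim, simp\<close>)
  show "1 *\<^sub>R a = a"
    by (rule L2_eqI) (use rep_scaleR[of 1 a] in \<open>eventually_elim, simp\<close>)
qed

end

text \<open>Introduced ahead of the type class instances because the norm has to be defined from it.
  The factor \<open>1 / (2*pi)\<close> gives constant functions the norm of their value.\<close>

definition ip :: "'n::finite L2 \<Rightarrow> 'n L2 \<Rightarrow> real" where
  "ip a b = (\<integral>\<theta>. rep a \<theta> \<bullet> rep b \<theta> \<partial>circ) / (2*pi)"

lemma ip_laws:
  fixes a b c :: "'n::finite L2"
  shows ip_commute: "ip a b = ip b a"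
    and ip_add_left: "ip (a + b) c = ip a c + ip b c"
    and ip_scaleR_left: "ip (r *\<^sub>R a) b = r * ip a b"
    and ip_nonneg: "0 \<le> ip a a"
    and ip_eq_zero_iff: "ip a a = 0 \<longleftrightarrow> a = 0"
proof -
  show "ip a b = ip b a" by (simp add: ip_def inner_commute)
  show "ip (a + b) c = ip a c + ip b c"
  proof -
    have "(\<integral>\<theta>. rep (a + b) \<theta> \<bullet> rep c \<theta> \<partial>circ) = (\<integral>\<theta>. rep a \<theta> \<bullet> rep c \<theta> + rep b \<theta> \<bullet> rep c \<theta> \<partial>circ)"
      by (intro integral_cong_AE borel_measurable_integrable integrable_inner sq_int_rep
          Bochner_Integration.integrable_add, use rep_add[of a b] in \<open>eventually_elim, simp add: inner_add_left\<close>)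
    then show ?thesis
      by (simp add: ip_def integrable_inner sq_int_rep add_divide_distrib)
  qed
  show "ip (r *\<^sub>R a) b = r * ip a b"
  proof -
    have "(\<integral>\<theta>. rep (r *\<^sub>R a) \<theta> \<bullet> rep b \<theta> \<partial>circ) = (\<integral>\<theta>. r * (rep a \<theta> \<bullet> rep b \<theta>) \<partial>circ)"
      by (intro integral_cong_AE borel_measurable_integrable integrable_inner sq_int_rep integrable_mult_right,
          use rep_scaleR[of r a] in \<open>eventually_elim, simp\<close>)
    then show ?thesis
      by (simp add: ip_def)
  qed
  show "0 \<le> ip a a" by (simp add: ip_def)
  show "ip a a = 0 \<longleftrightarrow> a = 0"
  proof
    assume "ip a a = 0"
    then have "AE \<theta> in circ. rep a \<theta> \<bullet> rep a \<theta> = 0"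
      by (subst integral_nonneg_eq_0_iff_AE[symmetric]) (auto simp: ip_def integrable_inner sq_int_rep)
    with rep_zero have "AE \<theta> in circ. rep a \<theta> = rep (0::'n L2) \<theta>"
      by eventually_elim simp
    then show "a = 0" by (rule L2_eqI)
  next
    assume "a = 0"
    have "(\<integral>\<theta>. rep (0::'n L2) \<theta> \<bullet> rep (0::'n L2) \<theta> \<partial>circ) = (\<integral>\<theta>. 0 \<partial>circ)"
      by (intro integral_cong_AE borel_measurable_integrable integrable_inner sq_int_rep integrable_zero,
          use rep_zero in \<open>eventually_elim, simp\<close>)
    then show "ip a a = 0" using \<open>a = 0\<close> by (simp add: ip_def)
  qed
qed

lemma ip_add_right: "ip c (a + b) = ip c a + ip c b"
  by (metis ip_commute ip_add_left)

lemma ip_scaleR_right: "ip b (r *\<^sub>R a) = r * ip b a"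
  by (metis ip_commute ip_scaleR_left)

lemma ip_triangle: "sqrt (ip (a + b) (a + b)) \<le> sqrt (ip a a) + sqrt (ip b b)"
proof -
  have "ip a b \<le> sqrt (ip a a) * sqrt (ip b b)"
  proof (cases "ip b b = 0")
    case True
    then have "b = 0 *\<^sub>R b" by (simp add: ip_eq_zero_iff)
    then have "ip a b = 0" by (metis ip_commute ip_scaleR_left mult_zero_left)
    then show ?thesis by (simp add: ip_nonneg)
  next
    case False
    then have pos: "ip b b > 0" using ip_nonneg[of b] by linarith
    \<comment> \<open>Minimiser of the quadratic polynomial
      \<open>ip (a + t *\<^sub>R b) (a + t *\<^sub>R b)\<close> in \<open>t\<close>; that its
      minimum is nonnegative is the Cauchy-Schwarz inequality.\<close>
    define t where "t = - ip a b / ip b b"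
    have "0 \<le> ip (a + t *\<^sub>R b) (a + t *\<^sub>R b)" by (rule ip_nonneg)
    also have "\<dots> = ip a a + 2 * t * ip a b + t\<^sup>2 * ip b b"
      by (simp add: ip_add_left ip_scaleR_left ip_add_right ip_scaleR_right
          ip_commute[of b a] power2_eq_square algebra_simps)
    also have "\<dots> = ip a a - (ip a b)\<^sup>2 / ip b b"
      using pos by (simp add: t_def field_simps power2_eq_square)
    finally have "(ip a b)\<^sup>2 \<le> ip a a * ip b b" using pos by (simp add: field_simps)
    then show ?thesis by (simp add: real_le_rsqrt flip: real_sqrt_mult)
  qed
  then have "ip (a + b) (a + b) \<le> (sqrt (ip a a) + sqrt (ip b b))\<^sup>2"
    by (simp add: ip_add_left ip_add_right ip_commute[of b a] power2_sum ip_nonneg)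
  then show ?thesis by (simp add: real_le_lsqrt ip_nonneg)
qed

instantiation L2 :: (finite) real_normed_vector
begin

definition norm_L2 :: "'a L2 \<Rightarrow> real" where "norm a = sqrt (ip a a)"
definition dist_L2 :: "'a L2 \<Rightarrow> 'a L2 \<Rightarrow> real" where "dist_L2 a b = norm (a - b)"
definition sgn_L2_def: "sgn a = a /\<^sub>R norm a" for a :: "'a L2"
definition uniformity_L2_def: "(uniformity :: ('a L2 \<times> 'a L2) filter) = (INF e\<in>{0 <..}. principal {(x, y). dist x (y::'a L2) < e})"
definition open_L2_def: "open U \<longleftrightarrow> (\<forall>x\<in>U. \<forall>\<^sub>F (x', y) in uniformity. x' = x \<longrightarrow> y \<in> U)"
  for U :: "'a L2 set"

instance
proof
  fix a b :: "'a L2" and r :: real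
  show "norm (r *\<^sub>R a) = \<bar>r\<bar> * norm a"
    by (simp add: norm_L2_def ip_scaleR_left ip_scaleR_right real_sqrt_mult flip: mult.assoc)
qed (simp_all add: dist_L2_def sgn_L2_def uniformity_L2_def open_L2_def norm_L2_def ip_eq_zero_iff ip_triangle)

end

instantiation L2 :: (finite) real_inner
begin

definition inner_L2_ip: "a \<bullet> b = ip a b" for a b :: "'a L2"

instance
  by standard (simp_all add: inner_L2_ip ip_add_left ip_scaleR_left ip_nonneg ip_eq_zero_iff norm_L2_def, rule ip_commute)

end

lemma inner_L2_def: "a \<bullet> b = (\<integral>\<theta>. rep a \<theta> \<bullet> rep b \<theta> \<partial>circ) / (2*pi)" for a b :: "'n::finite L2"
  by (simp add: inner_L2_ip ip_def)

lemma inner_mk: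
  assumes "sq_int f" "sq_int g"
  shows "mk f \<bullet> mk g = (\<integral>\<theta>. f \<theta> \<bullet> g \<theta> \<partial>circ) / (2*pi)"
proof -
  have "(\<integral>\<theta>. rep (mk f) \<theta> \<bullet> rep (mk g) \<theta> \<partial>circ) = (\<integral>\<theta>. f \<theta> \<bullet> g \<theta> \<partial>circ)"
    by (intro integral_cong_AE borel_measurable_integrable integrable_inner sq_int_rep assms,
        use rep_mk[OF assms(1)] rep_mk[OF assms(2)] in \<open>eventually_elim, simp\<close>)
  then show ?thesis by (simp add: inner_L2_def)
qed

lemma norm_mk: "sq_int f \<Longrightarrow> (norm (mk f))\<^sup>2 = (\<integral>\<theta>. (norm (f \<theta>))\<^sup>2 \<partial>circ) / (2*pi)"
  by (simp add: power2_norm_eq_inner inner_mk)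

lemma norm_rep: "(norm a)\<^sup>2 = (\<integral>\<theta>. (norm (rep a \<theta>))\<^sup>2 \<partial>circ) / (2*pi)"
  by (simp add: power2_norm_eq_inner inner_L2_def)

lemma L2norm_eq: "sq_int f \<Longrightarrow> L2norm f = sqrt (2*pi) * norm (mk f)"
  unfolding L2norm_def
  by (rule real_sqrt_unique[symmetric, THEN sym])
    (auto simp: power_mult_distrib norm_mk)

lemma mk_add:
  assumes "sq_int f" "sq_int g" shows "mk (\<lambda>\<theta>. f \<theta> + g \<theta>) = mk f + mk g"
  by (rule L2_eqI) (use rep_mk[OF assms(1)] rep_mk[OF assms(2)] rep_add[of "mk f" "mk g"]
      rep_mk[OF sq_int_add[OF assms]] in \<open>eventually_elim, simp\<close>)

lemma mk_diff:
  assumes "sq_int f" "sq_int g" shows "mk (\<lambda>\<theta>. f \<theta> - g \<theta>) = mk f - mk g"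
  by (rule L2_eqI) (use rep_mk[OF assms(1)] rep_mk[OF assms(2)] rep_diff[of "mk f" "mk g"]
      rep_mk[OF sq_int_diff[OF assms]] in \<open>eventually_elim, simp\<close>)

section \<open>Completeness and uniqueness of Fourier coefficients\<close>

text \<open>The arithmetic-geometric mean inequality with weight \<open>t\<close> replaces
  Cauchy-Schwarz: integrate \<open>norm x \<le> (t + (norm x)\<^sup>2 / t) / 2\<close> and use that
  \<open>t\<close> dominates the norm of the class.\<close>

lemma circ_integral_norm_le:
  assumes "sq_int h" "t > 0" "norm (mk h) \<le> t"
  shows "integrable circ (\<lambda>\<theta>. norm (h \<theta>))" "(\<integral>\<theta>. norm (h \<theta>) \<partial>circ) \<le> 2 * pi * t"
proof -
  have i2: "integrable circ (\<lambda>\<theta>. (norm (h \<theta>))\<^sup>2)" and [measurable]: "h \<in> borel_measurable circ"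
    using assms(1) by (auto simp: sq_int_def)
  have i: "integrable circ (\<lambda>\<theta>. (t + (norm (h \<theta>))\<^sup>2 / t) / 2)"
    using i2 by auto
  have bd: "norm x \<le> (t + (norm x)\<^sup>2 / t) / 2" for x :: "complex^'a"
    using zero_le_power2[of "norm x - t"] assms(2)
    by (simp add: field_simps power2_eq_square)
  show int: "integrable circ (\<lambda>\<theta>. norm (h \<theta>))"
    by (rule Bochner_Integration.integrable_bound[OF i]) (use assms(2) bd in \<open>auto intro!: AE_I2 simp: abs_of_nonneg\<close>)
  have "(\<integral>\<theta>. norm (h \<theta>) \<partial>circ) \<le> (\<integral>\<theta>. (t + (norm (h \<theta>))\<^sup>2 / t) / 2 \<partial>circ)"
    by (intro integral_mono int i bd)
  also have "\<dots> = (2*pi*t + (\<integral>\<theta>. (norm (h \<theta>))\<^sup>2 \<partial>circ) / t) / 2"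
    using i2 by (simp add: measure_def emeasure_circ_space)
  also have "(\<integral>\<theta>. (norm (h \<theta>))\<^sup>2 \<partial>circ) = 2 * pi * (norm (mk h))\<^sup>2"
    by (simp add: norm_mk assms)
  also have "2 * pi * (norm (mk h))\<^sup>2 / t \<le> 2 * pi * t\<^sup>2 / t"
    using assms by (intro divide_right_mono mult_left_mono power_mono) auto
  finally show "(\<integral>\<theta>. norm (h \<theta>) \<partial>circ) \<le> 2 * pi * t"
    using assms(2) by (simp add: power2_eq_square)
qed

text \<open>Geometric decay makes the increments summable in the integral norm, so the
  representatives converge almost everywhere. Fatou's lemma shows that the pointwise limit is also
  the limit in norm.\<close>

lemma L2_fast_Cauchy_limit:
  fixes s :: "nat \<Rightarrow> 'n::finite L2"
  assumes fast: "\<And>m n. m \<le> n \<Longrightarrow> norm (s n - s m) \<le> (1/2)^m"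
  shows "\<exists>l. s \<longlonglongrightarrow> l"
proof -
  define u where "u n = rep (s n)" for n
  have sq: "sq_int (u n)" for n by (simp add: u_def sq_int_rep)
  have [measurable]: "u n \<in> borel_measurable circ" for n using sq by (auto simp: sq_int_def)
  have mku: "mk (\<lambda>\<theta>. u n \<theta> - u m \<theta>) = s n - s m" for n m
    by (simp add: mk_diff sq, simp add: u_def mk_rep)
  have sqd: "sq_int (\<lambda>\<theta>. u n \<theta> - u m \<theta>)" for n m by (intro sq_int_diff sq)
  have int: "integrable circ (\<lambda>\<theta>. norm (u (Suc n) \<theta> - u n \<theta>))"
    "(\<integral>\<theta>. norm (u (Suc n) \<theta> - u n \<theta>) \<partial>circ) \<le> 2 * pi * (1/2)^n" for n
    using circ_integral_norm_le[OF sqd, of "(1/2)^n" "Suc n" n] fast[of n "Suc n"] by (simp_all add: mku)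
  have "(\<integral>\<^sup>+\<theta>. (\<Sum>n. ennreal (norm (u (Suc n) \<theta> - u n \<theta>))) \<partial>circ)
    = (\<Sum>n. \<integral>\<^sup>+\<theta>. ennreal (norm (u (Suc n) \<theta> - u n \<theta>)) \<partial>circ)"
    by (rule nn_integral_suminf) measurable
  also have "\<dots> = (\<Sum>n. ennreal (\<integral>\<theta>. norm (u (Suc n) \<theta> - u n \<theta>) \<partial>circ))"
    by (intro suminf_cong nn_integral_eq_integral int) auto
  also have "\<dots> \<le> (\<Sum>n. ennreal (2 * pi * (1/2)^n))"
    by (intro suminf_le ennreal_leI int) auto
  also have "\<dots> = ennreal (\<Sum>n. 2 * pi * (1/2)^n)"
    by (intro suminf_ennreal2 summable_mult summable_geometric) auto
  finally have "(\<integral>\<^sup>+\<theta>. (\<Sum>n. ennreal (norm (u (Suc n) \<theta> - u n \<theta>))) \<partial>circ) \<noteq> \<infinity>"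
    by (auto simp: top_unique)
  then have "AE \<theta> in circ. (\<Sum>n. ennreal (norm (u (Suc n) \<theta> - u n \<theta>))) \<noteq> \<infinity>"
    by (intro nn_integral_PInf_AE) measurable
  then have conv: "AE \<theta> in circ. convergent (\<lambda>n. u n \<theta>)"
  proof eventually_elim
    case (elim \<theta>)
    then have "summable (\<lambda>n. norm (u (Suc n) \<theta> - u n \<theta>))"
      by (intro summable_suminf_not_top) auto
    then have "summable (\<lambda>n. u (Suc n) \<theta> - u n \<theta>)" by (rule summable_norm_cancel)
    then have "convergent (\<lambda>n. \<Sum>i<n. u (Suc i) \<theta> - u i \<theta>)" by (simp add: summable_iff_convergent)
    then have "convergent (\<lambda>n. u n \<theta> - u 0 \<theta>)" using sum_lessThan_telescope[of "\<lambda>n. u n \<theta>"] by simp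
    then have "convergent (\<lambda>n. (u n \<theta> - u 0 \<theta>) + u 0 \<theta>)" by (intro convergent_add convergent_const)
    then show ?case by simp
  qed
  define f where "f \<theta> = lim (\<lambda>n. u n \<theta>)" for \<theta>
  have fm[measurable]: "f \<in> borel_measurable circ"
    unfolding f_def by (rule borel_measurable_lim_metric) measurable
  have lim: "AE \<theta> in circ. (\<lambda>n. u n \<theta>) \<longlonglongrightarrow> f \<theta>"
    using conv by eventually_elim (simp add: f_def convergent_LIMSEQ_iff)
  have bound: "(\<integral>\<^sup>+\<theta>. ennreal ((norm (f \<theta> - u m \<theta>))\<^sup>2) \<partial>circ) \<le> ennreal (2 * pi * ((1/2)^m)\<^sup>2)" for m
  proof -
    have "(\<integral>\<^sup>+\<theta>. ennreal ((norm (f \<theta> - u m \<theta>))\<^sup>2) \<partial>circ)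
      = (\<integral>\<^sup>+\<theta>. liminf (\<lambda>n. ennreal ((norm (u n \<theta> - u m \<theta>))\<^sup>2)) \<partial>circ)"
    proof (rule nn_integral_cong_AE, use lim in eventually_elim)
      case (elim \<theta>)
      have "(\<lambda>n. ennreal ((norm (u n \<theta> - u m \<theta>))\<^sup>2)) \<longlonglongrightarrow> ennreal ((norm (f \<theta> - u m \<theta>))\<^sup>2)"
        by (intro tendsto_intros elim)
      then show ?case by (intro lim_imp_Liminf[symmetric]) auto
    qed
    also have "\<dots> \<le> liminf (\<lambda>n. \<integral>\<^sup>+\<theta>. ennreal ((norm (u n \<theta> - u m \<theta>))\<^sup>2) \<partial>circ)"
      by (rule nn_integral_liminf) measurable
    also have "\<dots> \<le> ennreal (2 * pi * ((1/2)^m)\<^sup>2)"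
    proof (rule Liminf_le)
      show "\<forall>\<^sub>F n in sequentially. (\<integral>\<^sup>+\<theta>. ennreal ((norm (u n \<theta> - u m \<theta>))\<^sup>2) \<partial>circ) \<le> ennreal (2 * pi * ((1/2)^m)\<^sup>2)"
        using eventually_ge_at_top[of m]
      proof eventually_elim
        case (elim n)
        have "(\<integral>\<^sup>+\<theta>. ennreal ((norm (u n \<theta> - u m \<theta>))\<^sup>2) \<partial>circ) = ennreal (\<integral>\<theta>. (norm (u n \<theta> - u m \<theta>))\<^sup>2 \<partial>circ)"
          using sqd[of n m] by (intro nn_integral_eq_integral) (auto simp: sq_int_def)
        also have "(\<integral>\<theta>. (norm (u n \<theta> - u m \<theta>))\<^sup>2 \<partial>circ) = 2 * pi * (norm (s n - s m))\<^sup>2"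
          using norm_mk[OF sqd[of n m]] by (simp add: mku)
        also have "\<dots> \<le> 2 * pi * ((1/2)^m)\<^sup>2"
          by (intro mult_left_mono power_mono fast elim) auto
        finally show ?case by (simp add: ennreal_leI)
      qed
    qed simp
    finally show ?thesis .
  qed
  have sqf: "sq_int (\<lambda>\<theta>. f \<theta> - u m \<theta>)" for m
  proof (rule sq_intI)
    show "integrable circ (\<lambda>\<theta>. (norm (f \<theta> - u m \<theta>))\<^sup>2)"
      using bound[of m] by (intro integrableI_nonneg) (auto simp: top_unique less_top le_less_trans)
  qed measurable
  then have sqf': "sq_int f" using sq_int_add[OF sqf sq, of 0 0] by simp
  have "norm (s m - mk f) \<le> (1/2)^m" for m
  proof -
    have e: "mk (\<lambda>\<theta>. f \<theta> - u m \<theta>) = mk f - s m"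
      by (simp add: mk_diff sq sqf', simp add: u_def mk_rep)
    have "ennreal (\<integral>\<theta>. (norm (f \<theta> - u m \<theta>))\<^sup>2 \<partial>circ) \<le> ennreal (2 * pi * ((1/2)^m)\<^sup>2)"
      using bound[of m] sqf[of m] by (subst nn_integral_eq_integral[symmetric]) (auto simp: sq_int_def)
    then have "(\<integral>\<theta>. (norm (f \<theta> - u m \<theta>))\<^sup>2 \<partial>circ) \<le> 2 * pi * ((1/2)^m)\<^sup>2"
      by (subst (asm) ennreal_le_iff) auto
    then have "(norm (mk f - s m))\<^sup>2 \<le> ((1/2)^m)\<^sup>2"
      using norm_mk[OF sqf[of m]] by (simp add: e divide_le_eq mult.commute)
    then have "norm (mk f - s m) \<le> (1/2)^m"
      by (rule power2_le_imp_le) simp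
    then show ?thesis by (simp add: norm_minus_commute)
  qed
  then have "(\<lambda>m. s m - mk f) \<longlonglongrightarrow> 0"
    by (intro Lim_null_comparison[OF _ LIMSEQ_power_zero[of "1/2::real"]]) auto
  then show ?thesis using LIM_zero_cancel by blast
qed

instance L2 :: (finite) banach
proof
  fix s :: "nat \<Rightarrow> 'a L2" assume C: "Cauchy s"
  have "\<forall>n. \<exists>M. \<forall>i\<ge>M. \<forall>j\<ge>M. norm (s i - s j) < (1/2)^n"
    using C unfolding Cauchy_iff by (metis zero_less_power half_gt_zero_iff zero_less_one)
  then obtain M where M: "\<And>n i j. i \<ge> M n \<Longrightarrow> j \<ge> M n \<Longrightarrow> norm (s i - s j) < (1/2)^n" by metis
  \<comment> \<open>The sum dominates \<open>M n\<close>, and the extra \<open>n\<close> makes the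
    index sequence strictly increasing.\<close>
  define r where "r n = (\<Sum>i\<le>n. M i) + n" for n
  have r: "M n \<le> r n" for n unfolding r_def by (simp add: member_le_sum trans_le_add1)
  have sm: "strict_mono r" by (rule strict_monoI_Suc) (simp add: r_def)
  have "norm ((s \<circ> r) n - (s \<circ> r) m) \<le> (1/2)^m" if "m \<le> n" for m n
    using that r[of m] strict_mono_less_eq[OF sm, of m n] by (intro less_imp_le) (auto intro!: M)
  then obtain l where "(s \<circ> r) \<longlonglongrightarrow> l" using L2_fast_Cauchy_limit[of "s \<circ> r"] by blast
  then have "s \<longlonglongrightarrow> l"
    using C sm by (meson Cauchy_converges_subseq)
  then show "convergent s" by (rule convergentI)
qed

section \<open>Trigonometric polynomials as test functions; uniqueness of Fourier
  coefficients\<close>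

inductive trigpoly :: "(real \<Rightarrow> complex) \<Rightarrow> bool" where
  monom: "trigpoly (\<lambda>\<theta>. c * cis (of_int k * \<theta>))"
| add: "trigpoly f \<Longrightarrow> trigpoly g \<Longrightarrow> trigpoly (\<lambda>\<theta>. f \<theta> + g \<theta>)"

lemma trigpoly_const: "trigpoly (\<lambda>_. c)"
  using trigpoly.monom[of c 0] by simp

lemma trigpoly_mult_monom: "trigpoly f \<Longrightarrow> trigpoly (\<lambda>\<theta>. (c * cis (of_int k * \<theta>)) * f \<theta>)"
proof (induction rule: trigpoly.induct)
  case (monom d l)
  have "(\<lambda>\<theta>. c * cis (of_int k * \<theta>) * (d * cis (of_int l * \<theta>))) = (\<lambda>\<theta>. (c * d) * cis (of_int (k + l) * \<theta>))"
    by (simp add: fun_eq_iff distrib_right flip: cis_mult)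
  then show ?case using trigpoly.monom[of "c * d" "k + l"] by simp
next
  case (add f g)
  show ?case using trigpoly.add[OF add.IH] by (simp add: distrib_left)
qed

lemma trigpoly_mult: "trigpoly f \<Longrightarrow> trigpoly g \<Longrightarrow> trigpoly (\<lambda>\<theta>. f \<theta> * g \<theta>)"
proof (induction rule: trigpoly.induct)
  case (monom c k)
  then show ?case by (rule trigpoly_mult_monom)
next
  case (add f h)
  then show ?case using trigpoly.add[of "\<lambda>\<theta>. f \<theta> * g \<theta>"] by (simp add: distrib_right)
qed

lemma trigpoly_cnj: "trigpoly f \<Longrightarrow> trigpoly (\<lambda>\<theta>. cnj (f \<theta>))"
proof (induction rule: trigpoly.induct)
  case (monom c k)
  then show ?case using trigpoly.monom[of "cnj c" "- k"] by (simp add: cis_cnj)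
qed (simp add: trigpoly.add)

lemma trigpoly_continuous: "trigpoly f \<Longrightarrow> continuous_on UNIV f"
  by (induction rule: trigpoly.induct) (auto intro!: continuous_intros)

lemma trigpoly_bounded: "trigpoly f \<Longrightarrow> \<exists>B. \<forall>\<theta>. cmod (f \<theta>) \<le> B"
proof (induction rule: trigpoly.induct)
  case (monom c k)
  then show ?case by (intro exI[of _ "cmod c"]) (simp add: norm_mult)
next
  case (add f g)
  then obtain A B where "\<forall>\<theta>. cmod (f \<theta>) \<le> A" "\<forall>\<theta>. cmod (g \<theta>) \<le> B" by auto
  then show ?case by (intro exI[of _ "A + B"]) (auto intro!: norm_triangle_le add_mono)
qed

lemma trigpoly_measurable: "trigpoly f \<Longrightarrow> f \<in> borel_measurable circ"
  by (intro borel_measurable_circ borel_measurable_continuous_onI trigpoly_continuous)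

text \<open>On the circle, cosine and sine are combinations of \<zeta> and its inverse, so every
  real-linear functional restricts to a trigonometric polynomial. This makes the real
  Stone-Weierstrass theorem on the sphere available for trigonometric test functions.\<close>

lemma real_polynomial_trigpoly:
  fixes p :: "complex \<Rightarrow> real"
  assumes "real_polynomial_function p"
  shows "trigpoly (\<lambda>\<theta>. complex_of_real (p (cis \<theta>)))"
  using assms
proof (induction rule: real_polynomial_function.induct)
  case (linear f)
  have fz: "f z = Re z * f 1 + Im z * f \<i>" for z
  proof -
    have "z = Re z *\<^sub>R 1 + Im z *\<^sub>R \<i>" by (simp add: complex_eq_iff)
    then have "f z = f (Re z *\<^sub>R 1 + Im z *\<^sub>R \<i>)" by metis
    then show ?thesis
      using linear by (simp add: bounded_linear.linear linear_add linear_scale)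
  qed
  have "(\<lambda>\<theta>. complex_of_real (f (cis \<theta>))) =
    (\<lambda>\<theta>. (of_real (f 1) / 2 - \<i> * of_real (f \<i>) / 2) * cis (of_int 1 * \<theta>) +
      (of_real (f 1) / 2 + \<i> * of_real (f \<i>) / 2) * cis (of_int (-1) * \<theta>))"
    by (auto simp: fun_eq_iff complex_eq_iff fz[of "cis _"])
  then show ?case by (simp only:) (intro trigpoly.intros)
next
  case (const c)
  then show ?case by (rule trigpoly_const)
next
  case (add f g)
  then show ?case using trigpoly.add by force
next
  case (mult f g)
  then show ?case using trigpoly_mult by force
qed

text \<open>Real polynomials approximating \<open>h\<close> uniformly on the circle are
  trigonometric there, so their squares are admissible weights. Dominated convergence passes the
  sign on to the square of \<open>h\<close>.\<close>

lemma integral_continuous_nonneg: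
  fixes \<psi> :: "real \<Rightarrow> real" and h :: "complex \<Rightarrow> real"
  assumes int: "integrable circ \<psi>"
    and pos: "\<And>\<phi>. trigpoly \<phi> \<Longrightarrow> 0 \<le> (\<integral>\<theta>. (cmod (\<phi> \<theta>))\<^sup>2 * \<psi> \<theta> \<partial>circ)"
    and h: "continuous_on UNIV h"
  shows "0 \<le> (\<integral>\<theta>. (h (cis \<theta>))\<^sup>2 * \<psi> \<theta> \<partial>circ)"
proof -
  have [measurable]: "\<psi> \<in> borel_measurable circ" using int by auto
  have cm[measurable]: "(\<lambda>\<theta>. g (cis \<theta>)) \<in> borel_measurable circ" if "continuous_on UNIV g" for g :: "complex \<Rightarrow> real"
    by (intro borel_measurable_circ borel_measurable_continuous_onI continuous_on_compose2[OF that] continuous_intros) auto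
  note hm[measurable] = cm[OF h]
  have cS: "compact (sphere (0::complex) 1)" by simp
  have hS: "continuous_on (sphere 0 1) h" using h continuous_on_subset by blast
  have "\<forall>n. \<exists>p. real_polynomial_function p \<and> (\<forall>x\<in>sphere 0 1. \<bar>h x - p x\<bar> < 1 / real (Suc n))"
    using Stone_Weierstrass_real_polynomial_function[OF cS hS] by (metis of_nat_0_less_iff zero_less_Suc zero_less_divide_1_iff)
  then obtain p where p: "\<And>n. real_polynomial_function (p n)"
    and ph: "\<And>n x. x \<in> sphere 0 1 \<Longrightarrow> \<bar>h x - p n x\<bar> < 1 / real (Suc n)" by metis
  have pm[measurable]: "(\<lambda>\<theta>. p n (cis \<theta>)) \<in> borel_measurable circ" for n
    using p[of n] by (intro cm) (metis continuous_on_polymonial_function real_polynomial_function_eq)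
  obtain B where B: "\<And>x. x \<in> sphere 0 1 \<Longrightarrow> \<bar>h x\<bar> \<le> B"
    using compact_imp_bounded[OF compact_continuous_image[OF hS cS]] unfolding bounded_iff by (metis imageI real_norm_def)
  have "(\<lambda>n. \<integral>\<theta>. (p n (cis \<theta>))\<^sup>2 * \<psi> \<theta> \<partial>circ) \<longlonglongrightarrow> (\<integral>\<theta>. (h (cis \<theta>))\<^sup>2 * \<psi> \<theta> \<partial>circ)"
  proof (rule integral_dominated_convergence[where w="\<lambda>\<theta>. (B + 1)\<^sup>2 * \<bar>\<psi> \<theta>\<bar>"])
    show "AE \<theta> in circ. (\<lambda>n. (p n (cis \<theta>))\<^sup>2 * \<psi> \<theta>) \<longlonglongrightarrow> (h (cis \<theta>))\<^sup>2 * \<psi> \<theta>"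
    proof (intro AE_I2 tendsto_intros)
      fix \<theta>
      have "(\<lambda>n. h (cis \<theta>) - p n (cis \<theta>)) \<longlonglongrightarrow> 0"
      proof (rule Lim_null_comparison)
        show "\<forall>\<^sub>F n in sequentially. norm (h (cis \<theta>) - p n (cis \<theta>)) \<le> 1 / real (Suc n)"
          using ph[of "cis \<theta>"] by (auto intro!: always_eventually less_imp_le)
      qed (rule LIMSEQ_Suc[OF lim_1_over_n])
      from tendsto_diff[OF tendsto_const[of "h (cis \<theta>)"] this]
      show "(\<lambda>n. p n (cis \<theta>)) \<longlonglongrightarrow> h (cis \<theta>)" by simp
    qed
    fix n
    show "AE \<theta> in circ. norm ((p n (cis \<theta>))\<^sup>2 * \<psi> \<theta>) \<le> (B + 1)\<^sup>2 * \<bar>\<psi> \<theta>\<bar>"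
    proof (intro AE_I2)
      fix \<theta>
      have "1 / real (Suc n) \<le> 1" by simp
      then have "\<bar>p n (cis \<theta>)\<bar> \<le> B + 1"
        using ph[of "cis \<theta>" n] B[of "cis \<theta>"] unfolding mem_sphere_0 norm_cis by linarith
      then have "(p n (cis \<theta>))\<^sup>2 \<le> (B + 1)\<^sup>2" by (metis abs_ge_zero power2_abs power_mono)
      then show "norm ((p n (cis \<theta>))\<^sup>2 * \<psi> \<theta>) \<le> (B + 1)\<^sup>2 * \<bar>\<psi> \<theta>\<bar>"
        by (simp add: abs_mult mult_right_mono)
    qed
  qed (use int in \<open>auto intro!: integrable_mult_right integrable_abs\<close>)
  moreover have "0 \<le> (\<integral>\<theta>. (p n (cis \<theta>))\<^sup>2 * \<psi> \<theta> \<partial>circ)" for n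
    using pos[OF real_polynomial_trigpoly[OF p[of n]]] by simp
  ultimately show ?thesis by (intro LIMSEQ_le_const) auto
qed

text \<open>\<open>cis\<close> glues 0 to \<open>2*pi\<close> and is injective otherwise, so a set
  avoiding both endpoints can be recovered from its image.\<close>

lemma cis_mem_image_iff:
  assumes "K \<subseteq> {0<..<2*pi}" "\<theta> \<in> {0..2*pi}"
  shows "cis \<theta> \<in> cis ` K \<longleftrightarrow> \<theta> \<in> K"
proof
  assume "cis \<theta> \<in> cis ` K"
  then obtain k where k: "k \<in> K" "cis \<theta> = cis k" by auto
  then have "k \<in> {0<..<2*pi}" using assms by auto
  then have ak: "Arg2pi (cis k) = k" by (intro Arg2pi_unique[of 1]) (auto simp: cis_conv_exp)
  show "\<theta> \<in> K"
  proof (cases "\<theta> < 2*pi")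
    case True
    then have "Arg2pi (cis \<theta>) = \<theta>" using assms(2) by (intro Arg2pi_unique[of 1]) (auto simp: cis_conv_exp)
    then show ?thesis using ak k by metis
  next
    case False
    then have "\<theta> = 2*pi" using assms(2) by auto
    then have "cis k = 1" using k by simp
    then have "k = 0" using ak by (simp add: Arg2pi_of_real[of 1, simplified])
    then show ?thesis using \<open>k \<in> {0<..<2*pi}\<close> by simp
  qed
qed auto

lemma integral_compact_nonneg:
  fixes \<psi> :: "real \<Rightarrow> real"
  assumes int: "integrable circ \<psi>"
    and pos: "\<And>\<phi>. trigpoly \<phi> \<Longrightarrow> 0 \<le> (\<integral>\<theta>. (cmod (\<phi> \<theta>))\<^sup>2 * \<psi> \<theta> \<partial>circ)"
    and K: "compact K" "K \<subseteq> {0<..<2*pi}"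
  shows "0 \<le> (\<integral>\<theta>. indicator K \<theta> * \<psi> \<theta> \<partial>circ)"
proof (cases "K = {}")
  case False
  have [measurable]: "\<psi> \<in> borel_measurable circ" using int by auto
  define C where "C = cis ` K"
  have C: "closed C" "C \<noteq> {}"
    using False K(1) by (auto simp: C_def intro!: compact_imp_closed compact_continuous_image continuous_intros)
  \<comment> \<open>Cut-off functions equal to 1 on \<open>C\<close>. Since \<open>C\<close> is
    closed, off \<open>C\<close> they vanish for large \<open>m\<close>, so they tend to its
    indicator.\<close>
  define h where "h m z = max 0 (1 - real m * infdist z C)" for m z
  have h: "continuous_on UNIV (h m)" for m unfolding h_def by (intro continuous_intros)
  have [measurable]: "(\<lambda>\<theta>. h m (cis \<theta>)) \<in> borel_measurable circ" for m
    by (intro borel_measurable_circ borel_measurable_continuous_onI continuous_on_compose2[OF h] continuous_intros) auto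
  have [measurable]: "(indicator K :: real \<Rightarrow> real) \<in> borel_measurable circ"
    using K(1) by (intro borel_measurable_circ borel_measurable_indicator borel_closed compact_imp_closed)
  have "(\<lambda>m. \<integral>\<theta>. (h m (cis \<theta>))\<^sup>2 * \<psi> \<theta> \<partial>circ) \<longlonglongrightarrow> (\<integral>\<theta>. indicator K \<theta> * \<psi> \<theta> \<partial>circ)"
  proof (rule integral_dominated_convergence[where w="\<lambda>\<theta>. \<bar>\<psi> \<theta>\<bar>"])
    show "AE \<theta> in circ. (\<lambda>m. (h m (cis \<theta>))\<^sup>2 * \<psi> \<theta>) \<longlonglongrightarrow> indicator K \<theta> * \<psi> \<theta>"
    proof (intro AE_I2 tendsto_intros)
      fix \<theta> assume "\<theta> \<in> space circ"
      then have th: "cis \<theta> \<in> C \<longleftrightarrow> \<theta> \<in> K" unfolding C_def by (intro cis_mem_image_iff K) simp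
      show "(\<lambda>m. (h m (cis \<theta>))\<^sup>2) \<longlonglongrightarrow> indicator K \<theta>"
      proof (cases "\<theta> \<in> K")
        case True
        then show ?thesis using th by (simp add: h_def)
      next
        case False
        then have "infdist (cis \<theta>) C > 0" using th C by (simp add: infdist_pos_not_in_closed)
        then obtain N where N: "real N * infdist (cis \<theta>) C > 1"
          using reals_Archimedean3 by blast
        have "\<forall>\<^sub>F m in sequentially. (h m (cis \<theta>))\<^sup>2 = 0"
          using eventually_ge_at_top[of N]
        proof eventually_elim
          case (elim m)
          then have "real N * infdist (cis \<theta>) C \<le> real m * infdist (cis \<theta>) C"
            by (intro mult_right_mono) (auto simp: infdist_nonneg)
          then show ?case using N by (simp add: h_def)
        qed
        then show ?thesis using False by (simp add: tendsto_eventually)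
      qed
    qed
    fix m
    have "0 \<le> h m z" "h m z \<le> 1" for z by (auto simp: h_def infdist_nonneg)
    then have "(h m z)\<^sup>2 \<le> 1" for z by (simp add: power_le_one)
    then show "AE \<theta> in circ. norm ((h m (cis \<theta>))\<^sup>2 * \<psi> \<theta>) \<le> \<bar>\<psi> \<theta>\<bar>"
      by (intro AE_I2) (simp add: abs_mult mult_left_le_one_le)
  qed (use int in \<open>auto\<close>)
  moreover have "0 \<le> (\<integral>\<theta>. (h m (cis \<theta>))\<^sup>2 * \<psi> \<theta> \<partial>circ)" for m
    by (rule integral_continuous_nonneg[OF int pos h])
  ultimately show ?thesis by (intro LIMSEQ_le_const) auto
qed simp

text \<open>Inner regularity exhausts the set where \<open>\<psi>\<close> is negative by compact
  sets, up to small measure. Over such a set the integral is nonnegative by testing and nonpositive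
  by sign, so the set is null. This device turns norm inequalities that survive multiplication by
  scalar functions into pointwise ones.\<close>

lemma AE_nonneg_of_trigpoly:
  fixes \<psi> :: "real \<Rightarrow> real"
  assumes int: "integrable circ \<psi>"
    and pos: "\<And>\<phi>. trigpoly \<phi> \<Longrightarrow> 0 \<le> (\<integral>\<theta>. (cmod (\<phi> \<theta>))\<^sup>2 * \<psi> \<theta> \<partial>circ)"
  shows "AE \<theta> in circ. 0 \<le> \<psi> \<theta>"
proof -
  have [measurable]: "\<psi> \<in> borel_measurable circ" using int by auto
  \<comment> \<open>The endpoints are left out because \<open>cis\<close> identifies them; they
    return at the end as a null set.\<close>
  define N where "N = {\<theta> \<in> {0..2*pi}. \<psi> \<theta> < 0} - {0, 2*pi}"
  have Nc: "{\<theta> \<in> space circ. \<psi> \<theta> < 0} \<in> sets circ" by measurable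
  then have "{\<theta> \<in> {0..2*pi}. \<psi> \<theta> < 0} \<in> sets lebesgue"
    using sets_restrict_space_iff[of "{0..2*pi}" lebesgue] by (simp add: circ_def)
  then have N: "N \<in> sets lebesgue" unfolding N_def by auto
  have Ns: "N \<subseteq> {0<..<2*pi}" by (auto simp: N_def)
  have "emeasure lebesgue N \<le> ennreal e" if e: "e > 0" for e
  proof -
    obtain T where T: "closed T" "T \<subseteq> N" "N - T \<in> lmeasurable" "emeasure lebesgue (N - T) < ennreal e"
      using sets_lebesgue_inner_closed[OF N e] by blast
    have Tc: "compact T"
      using T(1,2) Ns by (metis bounded_closed_interval bounded_subset compact_eq_bounded_closed greaterThanLessThan_subseteq_atLeastAtMost_iff order_refl subset_trans cbox_interval)
    have [measurable]: "(indicator T :: real \<Rightarrow> real) \<in> borel_measurable circ"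
      using T(1) by (intro borel_measurable_circ borel_measurable_indicator) auto
    have Tneg: "indicator T \<theta> * \<psi> \<theta> \<le> 0" for \<theta>
      using T(2) by (auto simp: N_def indicator_def)
    have intT: "integrable circ (\<lambda>\<theta>. indicator T \<theta> * \<psi> \<theta>)"
      by (rule Bochner_Integration.integrable_bound[OF int]) (measurable, simp add: indicator_def)
    have "(\<integral>\<theta>. indicator T \<theta> * \<psi> \<theta> \<partial>circ) = 0"
      using integral_compact_nonneg[OF int pos Tc] T(2) Ns Bochner_Integration.integral_nonneg[of circ "\<lambda>\<theta>. - (indicator T \<theta> * \<psi> \<theta>)"] Tneg
      by force
    then have "AE \<theta> in circ. - (indicator T \<theta> * \<psi> \<theta>) = 0"
      using intT Tneg by (subst integral_nonneg_eq_0_iff_AE[symmetric]) auto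
    then have "AE \<theta> in circ. \<theta> \<notin> T"
      by eventually_elim (use T(2) in \<open>auto simp: N_def indicator_def split: if_splits\<close>)
    then have "T \<in> null_sets circ"
      using T(2) Ns T(1) by (intro AE_iff_null_sets[THEN iffD2]) (auto simp: circ_def sets_restrict_space N_def intro!: image_eqI[of _ _ T])
    moreover have "T \<subseteq> {0..2*pi}" using T(2) by (auto simp: N_def)
    ultimately have "emeasure lebesgue T = 0"
      using emeasure_restrict_space[of "{0..2*pi}" lebesgue T] by (simp add: circ_def null_sets_def)
    moreover have "emeasure lebesgue N \<le> emeasure lebesgue T + emeasure lebesgue (N - T)"
      using T(1,2,3) emeasure_subadditive[of T lebesgue "N - T"] by (simp add: Un_absorb1 fmeasurableD)
    ultimately show ?thesis using T(4) by (auto simp: le_less_trans less_imp_le)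
  qed
  then have "emeasure lebesgue N = 0"
    by (metis ennreal_le_epsilon add.left_neutral le_zero_eq)
  then have "N \<in> null_sets lebesgue" using N by auto
  then have "AE \<theta> in lebesgue. \<theta> \<notin> N" by (rule AE_not_in)
  moreover have "AE \<theta> in lebesgue. \<theta> \<notin> {0, 2*pi}"
    by (intro AE_not_in) (auto intro!: null_sets_completionI finite_imp_null_set_lborel)
  ultimately have "AE \<theta> in lebesgue. \<theta> \<in> {0..2*pi} \<longrightarrow> 0 \<le> \<psi> \<theta>"
    by eventually_elim (auto simp: N_def)
  then show ?thesis unfolding circ_def by (subst AE_restrict_space_iff) auto
qed

lemma integral_trigpoly_zero:
  fixes f :: "real \<Rightarrow> complex"
  assumes int: "integrable circ f" and z: "\<And>k::int. (\<integral>\<theta>. f \<theta> * cis (of_int k * \<theta>) \<partial>circ) = 0"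
    and "trigpoly \<phi>"
  shows "integrable circ (\<lambda>\<theta>. f \<theta> * \<phi> \<theta>)" "(\<integral>\<theta>. f \<theta> * \<phi> \<theta> \<partial>circ) = 0"
proof -
  have bd: "integrable circ (\<lambda>\<theta>. f \<theta> * \<phi> \<theta>)" if "trigpoly \<phi>" for \<phi>
  proof -
    obtain B where B: "\<And>\<theta>. cmod (\<phi> \<theta>) \<le> B" using trigpoly_bounded[OF \<open>trigpoly \<phi>\<close>] by blast
    have [measurable]: "\<phi> \<in> borel_measurable circ" "f \<in> borel_measurable circ"
      using trigpoly_measurable that int by auto
    show ?thesis
    proof (rule Bochner_Integration.integrable_bound[OF integrable_mult_right[of B, OF integrable_norm[OF int]]])
      show "AE \<theta> in circ. norm (f \<theta> * \<phi> \<theta>) \<le> norm (B * norm (f \<theta>))"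
      proof (intro AE_I2)
        fix \<theta>
        have "norm (f \<theta> * \<phi> \<theta>) \<le> B * norm (f \<theta>)"
          using mult_right_mono[OF B norm_ge_zero, of \<theta> "f \<theta>"] by (simp add: norm_mult mult.commute)
        then show "norm (f \<theta> * \<phi> \<theta>) \<le> norm (B * norm (f \<theta>))" by simp
      qed
    qed measurable
  qed
  from \<open>trigpoly \<phi>\<close> show "integrable circ (\<lambda>\<theta>. f \<theta> * \<phi> \<theta>)" by (rule bd)
  from \<open>trigpoly \<phi>\<close> show "(\<integral>\<theta>. f \<theta> * \<phi> \<theta> \<partial>circ) = 0"
  proof (induction rule: trigpoly.induct)
    case (monom c k)
    have "(\<lambda>\<theta>. f \<theta> * (c * cis (of_int k * \<theta>))) = (\<lambda>\<theta>. c * (f \<theta> * cis (of_int k * \<theta>)))"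
      by (simp add: fun_eq_iff mult_ac)
    then show ?case using z by simp
  next
    case (add p q)
    then show ?case by (simp add: distrib_left bd)
  qed
qed

text \<open>For constant \<open>c\<close> the function \<open>Re (c * f \<theta>)\<close> integrates
  to 0 against every squared modulus of a trigonometric polynomial, hence is nonnegative almost
  everywhere. The values 1, -1, \<i> and -\<i> of \<open>c\<close> leave only 0.\<close>

lemma fourier_uniqueness:
  fixes f :: "real \<Rightarrow> complex"
  assumes int: "integrable circ f" and z: "\<And>k::int. (\<integral>\<theta>. f \<theta> * cis (of_int k * \<theta>) \<partial>circ) = 0"
  shows "AE \<theta> in circ. f \<theta> = 0"
proof -
  have *: "AE \<theta> in circ. 0 \<le> Re (c * f \<theta>)" for c
  proof (rule AE_nonneg_of_trigpoly)
    have ic: "integrable circ (\<lambda>\<theta>. c * f \<theta>)" using int by simp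
    then show "integrable circ (\<lambda>\<theta>. Re (c * f \<theta>))" by (rule integrable_Re)
    fix \<phi> assume t: "trigpoly \<phi>"
    have t2: "trigpoly (\<lambda>\<theta>. c * (\<phi> \<theta> * cnj (\<phi> \<theta>)))"
      by (intro trigpoly_mult trigpoly_const t trigpoly_cnj)
    have "(\<integral>\<theta>. (cmod (\<phi> \<theta>))\<^sup>2 * Re (c * f \<theta>) \<partial>circ) = (\<integral>\<theta>. Re (f \<theta> * (c * (\<phi> \<theta> * cnj (\<phi> \<theta>)))) \<partial>circ)"
      by (intro Bochner_Integration.integral_cong) (auto simp: complex_norm_square[symmetric] algebra_simps)
    also have "\<dots> = 0"
      using integral_trigpoly_zero[OF int z t2] by (subst integral_Re) auto
    finally show "0 \<le> (\<integral>\<theta>. (cmod (\<phi> \<theta>))\<^sup>2 * Re (c * f \<theta>) \<partial>circ)" by simp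
  qed
  show ?thesis
    using *[of 1] *[of "-1"] *[of \<i>] *[of "-\<i>"]
    by eventually_elim (auto simp: complex_eq_iff)
qed

section \<open>Multiplication operators, Fourier coefficients and Hankel operators\<close>

text \<open>\<open>mm A\<close> is multiplication by the matrix function \<open>A\<close>. The type \<open>L2\<close> only has a real inner
  product; its complex structure is given by the multiplications \<open>cs c\<close> by complex scalars. \<open>sh k\<close> is
  multiplication by \<open>\<zeta>\<^sup>k\<close>, \<open>cst v\<close> a constant function and \<open>cf\<close> denotes Fourier coefficients.\<close>

definition mm :: "(real \<Rightarrow> complex^'n^'n) \<Rightarrow> 'n::finite L2 \<Rightarrow> 'n L2" where
  "mm A a = mk (\<lambda>\<theta>. A \<theta> *v rep a \<theta>)"

lemma rep_mm: "Linf A \<Longrightarrow> AE \<theta> in circ. rep (mm A a) \<theta> = A \<theta> *v rep a \<theta>"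
  unfolding mm_def by (intro rep_mk sq_int_matrix sq_int_rep)

lemma mm_mk:
  assumes "sq_int f" shows "mm A (mk f) = mk (\<lambda>\<theta>. A \<theta> *v f \<theta>)"
  unfolding mm_def by (rule mk_cong) (use rep_mk[OF assms] in \<open>eventually_elim, simp\<close>)

lemma mm_cong:
  assumes "AE \<theta> in circ. A \<theta> = B \<theta>" shows "mm A a = mm B a"
  unfolding mm_def by (rule mk_cong) (use assms in \<open>eventually_elim, simp\<close>)

lemma mm_add:
  assumes A: "Linf A" shows "mm A (a + b) = mm A a + mm A b"
  by (rule L2_eqI, use rep_mm[OF A, of a] rep_mm[OF A, of b] rep_mm[OF A, of "a + b"] rep_add[of a b]
      rep_add[of "mm A a" "mm A b"] in \<open>eventually_elim, simp add: matrix_vector_right_distrib\<close>)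

lemma mm_scaleR:
  assumes A: "Linf A" shows "mm A (r *\<^sub>R a) = r *\<^sub>R mm A a"
  by (rule L2_eqI, use rep_mm[OF A, of a] rep_mm[OF A, of "r *\<^sub>R a"] rep_scaleR[of r a]
      rep_scaleR[of r "mm A a"] in \<open>eventually_elim, simp add: matrix_vector_mult_scaleR\<close>)

lemma linear_mm: "Linf A \<Longrightarrow> linear (mm A)"
  by (intro linearI mm_add mm_scaleR)

lemma mm_diff: "Linf A \<Longrightarrow> mm A (a - b) = mm A a - mm A b"
  by (rule linear_diff[OF linear_mm])

lemma mm_zero: "Linf A \<Longrightarrow> mm A 0 = 0"
  by (rule linear_0[OF linear_mm])

lemma mm_mult:
  assumes A: "Linf A" and B: "Linf B" shows "mm A (mm B a) = mm (\<lambda>\<theta>. A \<theta> ** B \<theta>) a"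
  by (rule L2_eqI, use rep_mm[OF A, of "mm B a"] rep_mm[OF B, of a] rep_mm[OF Linf_mult[OF A B], of a]
      in \<open>eventually_elim, simp add: matrix_vector_mul_assoc\<close>)

lemma mm_add_left:
  assumes A: "Linf A" and B: "Linf B" shows "mm (\<lambda>\<theta>. A \<theta> + B \<theta>) a = mm A a + mm B a"
  by (rule L2_eqI, use rep_mm[OF A, of a] rep_mm[OF B, of a] rep_mm[OF Linf_add[OF A B], of a] rep_add[of "mm A a" "mm B a"]
      in \<open>eventually_elim, simp add: matrix_vector_mult_add_rdistrib\<close>)

lemma mm_diff_left:
  assumes A: "Linf A" and B: "Linf B" shows "mm (\<lambda>\<theta>. A \<theta> - B \<theta>) a = mm A a - mm B a"
  by (rule L2_eqI, use rep_mm[OF A, of a] rep_mm[OF B, of a] rep_mm[OF Linf_diff[OF A B], of a] rep_diff[of "mm A a" "mm B a"]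
      in \<open>eventually_elim, simp add: matrix_vector_mult_diff_rdistrib\<close>)

lemma mm_id [simp]: "mm (\<lambda>_. mat 1) a = a"
  by (simp add: mm_def mk_rep)

lemma inner_mm: "Linf A \<Longrightarrow> mm A a \<bullet> b = a \<bullet> mm (\<lambda>\<theta>. adjoint_mat (A \<theta>)) b"
proof -
  assume A: "Linf A"
  note A' = Linf_adjoint[OF A]
  have "(\<integral>\<theta>. rep (mm A a) \<theta> \<bullet> rep b \<theta> \<partial>circ) = (\<integral>\<theta>. rep a \<theta> \<bullet> rep (mm (\<lambda>\<theta>. adjoint_mat (A \<theta>)) b) \<theta> \<partial>circ)"
    by (intro integral_cong_AE borel_measurable_integrable integrable_inner sq_int_rep,
        use rep_mm[OF A, of a] rep_mm[OF A', of b] in \<open>eventually_elim, simp add: inner_matrix_adjoint\<close>)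
  then show ?thesis by (simp add: inner_L2_def)
qed

lemma norm_le_of_AE:
  fixes a :: "'n::finite L2" and b :: "'m::finite L2"
  assumes "AE \<theta> in circ. norm (rep a \<theta>) \<le> B * norm (rep b \<theta>)" "B \<ge> 0"
  shows "norm a \<le> B * norm b"
proof -
  have sq: "integrable circ (\<lambda>\<theta>. (norm (rep c \<theta>))\<^sup>2)" for c :: "'n L2"
    using sq_int_rep[of c] by (simp add: sq_int_def)
  have sq': "integrable circ (\<lambda>\<theta>. (norm (rep c \<theta>))\<^sup>2)" for c :: "'m L2"
    using sq_int_rep[of c] by (simp add: sq_int_def)
  have "(\<integral>\<theta>. (norm (rep a \<theta>))\<^sup>2 \<partial>circ) \<le> (\<integral>\<theta>. B\<^sup>2 * (norm (rep b \<theta>))\<^sup>2 \<partial>circ)"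
    by (intro integral_mono_AE sq integrable_mult_right sq', use assms(1) in eventually_elim)
      (auto simp: power_mono simp flip: power_mult_distrib)
  then have "(norm a)\<^sup>2 \<le> (B * norm b)\<^sup>2"
    unfolding power_mult_distrib norm_rep by (simp add: divide_right_mono)
  then show ?thesis using assms(2) by (intro power2_le_imp_le[of "norm a"]) auto
qed

lemma mm_bound:
  assumes "Linf A" "AE \<theta> in circ. \<forall>x. norm (A \<theta> *v x) \<le> B * norm x" "B \<ge> 0"
  shows "norm (mm A a) \<le> B * norm a"
  by (rule norm_le_of_AE[OF _ assms(3)])
    (use rep_mm[OF assms(1), of a] assms(2) in \<open>eventually_elim, simp\<close>)

lemma bounded_linear_mm:
  assumes "Linf A" shows "bounded_linear (mm A)"
proof -
  obtain B where B: "B \<ge> 0" "AE \<theta> in circ. \<forall>x. norm (A \<theta> *v x) \<le> B * norm x"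
    using assms by (rule LinfE)
  show ?thesis
    using mm_bound[OF assms B(2,1)]
    by (intro bounded_linear_intro[of _ B]) (auto simp: mm_add mm_scaleR assms mult.commute)
qed

lemma mat_mult_commute: "mat c ** A = A ** mat c" for A :: "complex^'n^'n"
  by (simp add: vec_eq_iff matrix_matrix_mult_def mat_def if_distrib[of "\<lambda>u. u * _"] if_distrib[of "(*) _"]
      mult.commute cong: if_cong)

lemma mat_mat_mult: "mat c ** mat d = (mat (c * d) :: complex^'n^'n)"
  by (simp add: vec_eq_iff matrix_matrix_mult_def mat_def if_distrib[of "\<lambda>u. u * _"] if_distrib[of "(*) _"] cong: if_cong)

lemma adjoint_mat_mat: "adjoint_mat (mat c) = (mat (cnj c) :: complex^'n^'n)"
  by (simp add: adjoint_mat_def mat_def vec_eq_iff)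

definition cs :: "complex \<Rightarrow> 'n::finite L2 \<Rightarrow> 'n L2" where
  "cs c = mm (\<lambda>_. mat c)"

definition sh :: "int \<Rightarrow> 'n::finite L2 \<Rightarrow> 'n L2" where
  "sh k = mm (\<lambda>\<theta>. mat (cis (of_int k * \<theta>)))"

lemma Linf_cis: "Linf (\<lambda>\<theta>. mat (cis (of_int k * \<theta>)) :: complex^'n^'n)"
  by (rule Linf_mat[where B=1]) (auto intro!: borel_measurable_circ borel_measurable_continuous_onI continuous_intros)

lemma linear_cs: "linear (cs c)" by (simp add: cs_def linear_mm Linf_const)
lemma linear_sh: "linear (sh k)" by (simp add: sh_def linear_mm Linf_cis)
lemmas cs_diff = linear_diff[OF linear_cs]
lemmas sh_add = linear_add[OF linear_sh] and sh_diff = linear_diff[OF linear_sh]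
  and sh_scaleR = linear_scale[OF linear_sh] and sh_zero = linear_0[OF linear_sh]

lemma cs_mm: "Linf A \<Longrightarrow> cs c (mm A a) = mm A (cs c a)"
  by (simp add: cs_def mm_mult Linf_const mat_mult_commute)

lemma sh_mm: "Linf A \<Longrightarrow> sh k (mm A a) = mm A (sh k a)"
  by (simp add: sh_def mm_mult Linf_cis mat_mult_commute)

lemma cs_sh: "cs c (sh k a) = sh k (cs c a)"
  unfolding sh_def by (intro cs_mm Linf_cis)

lemma cs_cs: "cs c (cs d a) = cs (c * d) a"
  by (simp add: cs_def mm_mult Linf_const mat_mat_mult)

lemma cs_1 [simp]: "cs 1 a = a"
  by (simp add: cs_def)

lemma sh_sh: "sh k (sh l a) = sh (k + l) a"
  by (simp add: sh_def mm_mult Linf_cis mat_mat_mult cis_mult distrib_right)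

lemma sh_0 [simp]: "sh 0 a = a"
  by (simp add: sh_def)

lemma inner_cs: "cs c a \<bullet> b = a \<bullet> cs (cnj c) b"
  by (simp add: cs_def inner_mm Linf_const adjoint_mat_mat)

lemma inner_sh: "sh k a \<bullet> b = a \<bullet> sh (- k) b"
  by (simp add: sh_def inner_mm Linf_cis adjoint_mat_mat cis_cnj)

lemma norm_sh [simp]: "norm (sh k a) = norm a"
  by (simp add: norm_eq_sqrt_inner inner_sh sh_sh)

lemma norm_cs: "norm (cs c a) = cmod c * norm a" for a :: "'n::finite L2"
proof -
  have *: "norm (cs c a) \<le> cmod c * norm a" for c and a :: "'n L2"
    unfolding cs_def by (rule mm_bound) (auto simp: Linf_const mat_mult_vec norm_smult_vec)
  show ?thesis
  proof (cases "c = 0")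
    case True
    then show ?thesis using *[of 0 a] by simp
  next
    case False
    have "norm a \<le> cmod (inverse c) * norm (cs c a)"
      using *[of "inverse c" "cs c a"] False by (simp add: cs_cs)
    then have "cmod c * norm a \<le> cmod c * (cmod (inverse c) * norm (cs c a))" by (intro mult_left_mono) auto
    also have "\<dots> = norm (cs c a)" using False by (simp add: norm_inverse)
    finally show ?thesis using *[of c a] by simp
  qed
qed

section \<open>Constants, Fourier coefficients and Fourier series\<close>

definition cst :: "complex^'n \<Rightarrow> 'n::finite L2" where
  "cst v = mk (\<lambda>_. v)"

definition cf :: "'n::finite L2 \<Rightarrow> int \<Rightarrow> complex^'n" where
  "cf a k = fcoef (rep a) k"

lemma sh_cst: "sh k (cst v) = mk (\<lambda>\<theta>. cis (of_int k * \<theta>) *s v)"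
  by (simp add: sh_def cst_def mm_mk sq_int_const mat_mult_vec)

lemma cs_cst: "cs c (cst v) = cst (c *s v)"
  by (simp add: cs_def cst_def mm_mk sq_int_const mat_mult_vec)

lemma mm_const_cst: "mm (\<lambda>_. A) (cst v) = cst (A *v v)"
  by (simp add: cst_def mm_mk sq_int_const)

lemma sq_int_component:
  assumes "sq_int f" "c \<in> borel_measurable circ" "\<And>\<theta>. cmod (c \<theta>) \<le> 1"
  shows "integrable circ (\<lambda>\<theta>. f \<theta> $ i * c \<theta>)"
proof -
  have m[measurable]: "(\<lambda>\<theta>. f \<theta> $ i) \<in> borel_measurable circ" "c \<in> borel_measurable circ"
    using assms by (auto simp: sq_int_def intro: measurable_vec_nth)
  have "norm (mk f) \<le> norm (mk f) + 1" by simp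
  then have "integrable circ (\<lambda>\<theta>. norm (f \<theta>))"
    by (intro circ_integral_norm_le(1)[OF assms(1), of "norm (mk f) + 1"]) (auto simp: add_nonneg_pos)
  then show ?thesis
  proof (rule Bochner_Integration.integrable_bound)
    have "cmod (f \<theta> $ i) * cmod (c \<theta>) \<le> norm (f \<theta>) * 1" for \<theta>
      by (intro mult_mono assms(3) Finite_Cartesian_Product.norm_nth_le) auto
    then show "AE \<theta> in circ. norm (f \<theta> $ i * c \<theta>) \<le> norm (norm (f \<theta>))"
      by (auto simp: norm_mult)
  qed measurable
qed

lemma integrable_fcoef: "sq_int f \<Longrightarrow> integrable circ (\<lambda>\<theta>. f \<theta> $ i * cis (of_int k * \<theta>))"
  by (rule sq_int_component) (auto intro!: borel_measurable_circ borel_measurable_continuous_onI continuous_intros)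

text \<open>Reduces statements about coefficients to the adjoint rules for \<open>sh\<close>,
  \<open>cs\<close> and \<open>mm\<close>. The real inner product is enough, because
  \<open>v\<close> runs over all complex vectors.\<close>

lemma fcoef_inner:
  assumes "sq_int f" shows "fcoef f k \<bullet> v = mk f \<bullet> sh k (cst v)"
proof -
  have i: "integrable circ (\<lambda>\<theta>. f \<theta> $ i * cis (- (of_int k * \<theta>)))" for i
    using integrable_fcoef[OF assms, of i "- k"] by simp
  have sqc: "sq_int (\<lambda>\<theta>. cis (of_int k * \<theta>) *s v)"
    using sq_int_matrix[OF Linf_cis sq_int_const, of k v] by (simp add: mat_mult_vec)
  have "mk f \<bullet> sh k (cst v) = (\<integral>\<theta>. f \<theta> \<bullet> (cis (of_int k * \<theta>) *s v) \<partial>circ) / (2*pi)"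
    unfolding sh_cst by (rule inner_mk[OF assms sqc])
  also have "(\<integral>\<theta>. f \<theta> \<bullet> (cis (of_int k * \<theta>) *s v) \<partial>circ)
    = (\<integral>\<theta>. Re (\<Sum>i\<in>UNIV. (f \<theta> $ i * cis (- (of_int k * \<theta>))) * cnj (v $ i)) \<partial>circ)"
    by (intro Bochner_Integration.integral_cong refl) (simp add: inner_vec_complex cis_cnj mult_ac)
  also have "\<dots> = Re (\<integral>\<theta>. (\<Sum>i\<in>UNIV. (f \<theta> $ i * cis (- (of_int k * \<theta>))) * cnj (v $ i)) \<partial>circ)"
    by (intro integral_Re Bochner_Integration.integrable_sum integrable_mult_left i)
  also have "(\<integral>\<theta>. (\<Sum>i\<in>UNIV. (f \<theta> $ i * cis (- (of_int k * \<theta>))) * cnj (v $ i)) \<partial>circ)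
    = (\<Sum>i\<in>UNIV. (\<integral>\<theta>. f \<theta> $ i * cis (- (of_int k * \<theta>)) \<partial>circ) * cnj (v $ i))"
    by (subst Bochner_Integration.integral_sum) (auto intro!: integrable_mult_left i)
  finally show ?thesis
    by (simp add: inner_vec_complex fcoef_def sum_divide_distrib)
qed

lemma cf_inner: "cf a k \<bullet> v = a \<bullet> sh k (cst v)"
  unfolding cf_def by (subst fcoef_inner) (simp_all add: sq_int_rep mk_rep)

lemma cf_mk: "sq_int f \<Longrightarrow> cf (mk f) k = fcoef f k"
  by (subst vector_eq_ldot[symmetric]) (simp add: cf_inner fcoef_inner inner_commute[of _ "cf _ _"] inner_commute[of _ "fcoef _ _"])

lemma cf_eqI: "(\<And>v. cf a k \<bullet> v = w \<bullet> v) \<Longrightarrow> cf a k = w"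
  by (metis vector_eq_rdot)

lemma linear_cf: "linear (\<lambda>a. cf a k)"
  by (rule linearI) (rule cf_eqI, simp add: cf_inner inner_add_left)+

lemmas cf_add = linear_add[OF linear_cf] and cf_diff = linear_diff[OF linear_cf]
  and cf_scaleR = linear_scale[OF linear_cf] and cf_zero = linear_0[OF linear_cf]
  and cf_sum = linear_sum[OF linear_cf]

lemma cf_cs: "cf (cs c a) k = c *s cf a k"
proof (rule cf_eqI)
  fix v
  have "cf (cs c a) k \<bullet> v = cf a k \<bullet> (cnj c *s v)"
    by (simp add: cf_inner inner_cs cs_sh cs_cst)
  also have "\<dots> = (c *s cf a k) \<bullet> v"
    by (simp add: inner_vec_complex mult_ac)
  finally show "cf (cs c a) k \<bullet> v = (c *s cf a k) \<bullet> v" .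
qed

lemma cf_sh: "cf (sh j a) k = cf a (k - j)"
  by (rule cf_eqI) (simp add: cf_inner inner_sh sh_sh)

lemma cst_inner: "cst v \<bullet> cst w = v \<bullet> w"
  by (simp add: cst_def inner_mk sq_int_const measure_def emeasure_circ_space)

lemma norm_cst [simp]: "norm (cst v) = norm v"
  by (simp add: norm_eq_sqrt_inner cst_inner)

lemma norm_cf_le: "norm (cf a k) \<le> norm a"
proof -
  have "norm (cf a k) * norm (cf a k) = a \<bullet> sh k (cst (cf a k))"
    by (simp flip: cf_inner power2_eq_square power2_norm_eq_inner)
  also have "\<dots> \<le> norm a * norm (sh k (cst (cf a k)))" by (rule norm_cauchy_schwarz)
  finally have "norm (cf a k) * norm (cf a k) \<le> norm a * norm (cf a k)" by simp
  then show ?thesis by (cases "cf a k = 0") auto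
qed

lemma bounded_linear_cf: "bounded_linear (\<lambda>a. cf a k)"
  by (rule bounded_linear_intro[of _ 1]) (auto simp: cf_add cf_scaleR norm_cf_le)

lemma integral_cis_nonzero:
  fixes k :: int assumes "k \<noteq> 0"
  shows "(\<integral>\<theta>. cis (of_int k * \<theta>) \<partial>circ) = 0"
proof -
  have ft: "((\<lambda>\<theta>. cis (of_int k * \<theta>) / (\<i> * complex_of_int k)) has_vector_derivative cis (of_int k * \<theta>)) (at \<theta> within {0..2*pi})" for \<theta>
  proof -
    have "((\<lambda>z. exp (\<i> * of_int k * z) / (\<i> * of_int k)) has_field_derivative exp (\<i> * of_int k * of_real \<theta>)) (at (of_real \<theta>))"
      by (rule derivative_eq_intros refl | use assms in simp)+
    from has_vector_derivative_real_field[OF this, of "{0..2*pi}"] show ?thesis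
      by (simp add: cis_conv_exp mult_ac)
  qed
  have "((\<lambda>\<theta>. cis (of_int k * \<theta>)) has_integral
     (cis (of_int k * (2*pi)) / (\<i> * of_int k) - cis (of_int k * 0) / (\<i> * of_int k))) {0..2*pi}"
    by (rule fundamental_theorem_of_calculus) (auto intro: ft)
  moreover have "cis (of_int k * (2*pi)) = 1"
    using cis_multiple_2pi[of "of_int k"] by (simp add: mult_ac)
  ultimately have 0: "integral {0..2*pi} (\<lambda>\<theta>. cis (of_int k * \<theta>)) = 0"
    by (auto simp: integral_unique)
  have "integrable circ (\<lambda>\<theta>. cis (of_int k * \<theta>))"
    unfolding circ_def
    by (intro continuous_imp_integrable_real continuous_intros)
  then have "(\<integral>\<theta>. cis (of_int k * \<theta>) \<partial>circ) = integral {0..2*pi} (\<lambda>\<theta>. cis (of_int k * \<theta>))"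
    unfolding circ_def by (intro lebesgue_integral_eq_integral) auto
  then show ?thesis using 0 by simp
qed

lemma cf_cst: "cf (cst v) k = (if k = 0 then v else 0)"
proof -
  have "(\<integral>\<theta>. v $ i * cis (- (of_int k * \<theta>)) \<partial>circ) = (if k = 0 then of_real (2*pi) * v $ i else 0)" for i
    using integral_cis_nonzero[of "- k"] by (simp add: measure_def emeasure_circ_space scaleR_conv_of_real)
  then show ?thesis
    by (simp add: cst_def cf_mk sq_int_const fcoef_def vec_eq_iff)
qed

lemma cf_sh_cst: "cf (sh j (cst v)) k = (if k = j then v else 0)"
  by (simp add: cf_sh cf_cst)

lemma L2_zeroI: assumes "\<And>k. cf a k = 0" shows "a = 0"
proof -
  have "AE \<theta> in circ. rep a \<theta> $ i = 0" for i
  proof (rule fourier_uniqueness)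
    show "integrable circ (\<lambda>\<theta>. rep a \<theta> $ i)" using integrable_fcoef[OF sq_int_rep, of a i 0] by simp
    fix k :: int
    have "fcoef (rep a) (- k) $ i = 0" using assms[of "- k"] by (simp add: cf_def)
    then show "(\<integral>\<theta>. rep a \<theta> $ i * cis (of_int k * \<theta>) \<partial>circ) = 0"
      by (simp add: fcoef_def)
  qed
  then have "AE \<theta> in circ. \<forall>i. rep a \<theta> $ i = 0" by (subst AE_all_countable) auto
  then have "AE \<theta> in circ. rep a \<theta> = rep 0 \<theta>"
    using rep_zero by eventually_elim (simp add: vec_eq_iff)
  then show ?thesis by (rule L2_eqI)
qed

lemma L2_coef_eqI: "(\<And>k. cf a k = cf b k) \<Longrightarrow> a = b"
  using L2_zeroI[of "a - b"] by (simp add: cf_diff)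

definition psum :: "(int \<Rightarrow> complex^'n) \<Rightarrow> nat \<Rightarrow> 'n::finite L2" where
  "psum c N = (\<Sum>k\<in>{- int N..int N}. sh k (cst (c k)))"

lemma cf_psum: "cf (psum c N) j = (if \<bar>j\<bar> \<le> int N then c j else 0)"
proof -
  have "cf (psum c N) j = (\<Sum>k\<in>{- int N..int N}. if k = j then c j else 0)"
    unfolding psum_def cf_sum by (intro sum.cong) (auto simp: cf_sh_cst)
  then show ?thesis by (auto simp: abs_le_iff)
qed

lemma inner_psum: "a \<bullet> psum c N = (\<Sum>k\<in>{- int N..int N}. cf a k \<bullet> c k)"
  by (simp add: psum_def inner_sum_right cf_inner)

lemma norm_psum: "(norm (psum c N))\<^sup>2 = (\<Sum>k\<in>{- int N..int N}. (norm (c k))\<^sup>2)"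
  unfolding power2_norm_eq_inner inner_psum by (intro sum.cong) (auto simp: cf_psum)

lemma bessel: "(\<Sum>k\<in>{- int N..int N}. (norm (cf a k))\<^sup>2) \<le> (norm a)\<^sup>2"
proof -
  have "0 \<le> (norm (a - psum (cf a) N))\<^sup>2" by simp
  also have "\<dots> = (norm a)\<^sup>2 - 2 * (a \<bullet> psum (cf a) N) + (norm (psum (cf a) N))\<^sup>2"
    by (simp add: power2_norm_eq_inner inner_diff inner_commute)
  also have "\<dots> = (norm a)\<^sup>2 - (\<Sum>k\<in>{- int N..int N}. (norm (cf a k))\<^sup>2)"
    by (simp add: inner_psum norm_psum flip: power2_norm_eq_inner)
  finally show ?thesis by simp
qed

lemma riesz_fischer:
  assumes B: "\<And>N. (\<Sum>k\<in>{- int N..int N}. (norm (c k))\<^sup>2) \<le> B"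
  obtains a where "psum c \<longlonglongrightarrow> a" "\<And>k. cf a k = c k"
proof -
  define T where "T N = (\<Sum>k\<in>{- int N..int N}. (norm (c k))\<^sup>2)" for N
  have mono: "mono T" unfolding T_def by (intro monoI sum_mono2) auto
  have "convergent T" using mono B
    by (intro Bseq_mono_convergent BseqI'[of _ B]) (auto simp: T_def mono_def sum_nonneg)
  then have CT: "Cauchy T" by (rule convergent_Cauchy)
  have diff: "(norm (psum c n - psum c m))\<^sup>2 = T n - T m" if "m \<le> n" for m n
  proof -
    have "psum c n \<bullet> psum c m = T m"
      unfolding inner_psum T_def using that by (intro sum.cong) (auto simp: cf_psum power2_norm_eq_inner)
    moreover have "psum c n \<bullet> psum c n = T n" "psum c m \<bullet> psum c m = T m"
      by (simp_all add: norm_psum T_def flip: power2_norm_eq_inner)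
    ultimately show ?thesis
      by (simp add: power2_norm_eq_inner inner_diff inner_commute)
  qed
  have "Cauchy (psum c)"
    unfolding Cauchy_iff
  proof (intro allI impI)
    fix e :: real assume "e > 0"
    then have "e\<^sup>2 > 0" by simp
    then obtain M where M: "\<And>m n. m \<ge> M \<Longrightarrow> n \<ge> M \<Longrightarrow> \<bar>T m - T n\<bar> < e\<^sup>2"
      using CT unfolding Cauchy_iff real_norm_def by blast
    have "norm (psum c m - psum c n) < e" if "m \<ge> M" "n \<ge> M" for m n
    proof -
      have "(norm (psum c m - psum c n))\<^sup>2 = \<bar>T m - T n\<bar>"
      proof (cases "m \<le> n")
        case True
        then show ?thesis using diff[OF True] monoD[OF mono True] by (simp add: norm_minus_commute)
      next
        case False
        then show ?thesis using diff[of n m] monoD[OF mono, of n m] by simp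
      qed
      then have "(norm (psum c m - psum c n))\<^sup>2 < e\<^sup>2" using M[OF that] by simp
      then show ?thesis using \<open>e > 0\<close> by (intro power2_less_imp_less[of _ e]) auto
    qed
    then show "\<exists>M. \<forall>m\<ge>M. \<forall>n\<ge>M. norm (psum c m - psum c n) < e" by blast
  qed
  then obtain a where a: "psum c \<longlonglongrightarrow> a" using Cauchy_convergent convergent_def by blast
  have "cf a k = c k" for k
  proof -
    have "(\<lambda>N. cf (psum c N) k) \<longlonglongrightarrow> cf a k"
      by (rule bounded_linear.tendsto[OF bounded_linear_cf a])
    moreover have "(\<lambda>N. cf (psum c N) k) \<longlonglongrightarrow> c k"
    proof (rule tendsto_eventually)
      show "\<forall>\<^sub>F N in sequentially. cf (psum c N) k = c k"
        using eventually_ge_at_top[of "nat \<bar>k\<bar>"] by eventually_elim (simp add: cf_psum)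
    qed
    ultimately show ?thesis by (rule LIMSEQ_unique)
  qed
  with a that show thesis by blast
qed

text \<open>Bessel's inequality and completeness give the partial sums a limit with the same
  coefficients; uniqueness identifies the limit.\<close>

lemma fourier_series: "psum (cf a) \<longlonglongrightarrow> a"
proof -
  obtain b where b: "psum (cf a) \<longlonglongrightarrow> b" "\<And>k. cf b k = cf a k"
    by (rule riesz_fischer[OF bessel[where a=a]]; rule that; assumption)
  from b(2) have "b = a" by (rule L2_coef_eqI)
  with b(1) show ?thesis by simp
qed

lemma inner_zero_coefs:
  assumes "\<And>k. cf a k \<bullet> cf b k = 0" shows "a \<bullet> b = 0"
proof -
  have "(\<lambda>N. a \<bullet> psum (cf b) N) \<longlonglongrightarrow> a \<bullet> b" by (intro tendsto_intros fourier_series)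
  moreover have "a \<bullet> psum (cf b) N = 0" for N by (simp add: inner_psum assms)
  ultimately show ?thesis by (simp add: LIMSEQ_const_iff)
qed

lemma norm_le_coefs:
  assumes "\<And>N. (\<Sum>k\<in>{- int N..int N}. (norm (cf a k))\<^sup>2) \<le> B"
  shows "(norm a)\<^sup>2 \<le> B"
proof -
  have "(\<lambda>N. (norm (psum (cf a) N))\<^sup>2) \<longlonglongrightarrow> (norm a)\<^sup>2" by (intro tendsto_intros fourier_series)
  then show ?thesis
    using assms by (intro LIMSEQ_le_const2) (auto simp: norm_psum)
qed

section \<open>The projection onto negative frequencies and the Hardy space\<close>

definition Pm :: "'n::finite L2 \<Rightarrow> 'n L2" where
  "Pm a = (SOME b. \<forall>k. cf b k = (if k < 0 then cf a k else 0))"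

text \<open>Existence behind the \<open>SOME\<close> comes from \<open>riesz_fischer\<close>. In
  contrast to \<open>Pminus\<close>, the choice is unique here, because an element of
  \<open>L2\<close> is determined by its coefficients.\<close>

lemma cf_Pm: "cf (Pm a) k = (if k < 0 then cf a k else 0)"
proof -
  have *: "(\<Sum>k\<in>{- int N..int N}. (norm (if k < 0 then cf a k else 0))\<^sup>2) \<le> (norm a)\<^sup>2" for N
    by (rule order_trans[OF sum_mono bessel]) auto
  obtain b where "psum (\<lambda>k. if k < 0 then cf a k else 0) \<longlonglongrightarrow> b"
    "\<And>k. cf b k = (if k < 0 then cf a k else 0)"
    by (rule riesz_fischer[OF *]; rule that; assumption)
  then have "\<exists>b. \<forall>k. cf b k = (if k < 0 then cf a k else 0)" by blast
  from someI_ex[OF this] show ?thesis unfolding Pm_def by auto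
qed

lemma linear_Pm: "linear Pm"
  by (rule linearI; rule L2_coef_eqI) (simp_all add: cf_Pm cf_add cf_scaleR)

lemmas Pm_add = linear_add[OF linear_Pm] and Pm_diff = linear_diff[OF linear_Pm]
  and Pm_scaleR = linear_scale[OF linear_Pm]

lemma Pm_cs: "Pm (cs c a) = cs c (Pm a)"
  by (rule L2_coef_eqI) (simp add: cf_Pm cf_cs)

lemma Pm_pythagoras: "(norm a)\<^sup>2 = (norm (Pm a))\<^sup>2 + (norm (a - Pm a))\<^sup>2"
proof -
  have "Pm a \<bullet> (a - Pm a) = 0"
    by (rule inner_zero_coefs) (simp add: cf_Pm cf_diff)
  then show ?thesis
    by (simp add: power2_norm_eq_inner inner_diff inner_commute)
qed

lemma norm_Pm_le: "norm (Pm a) \<le> norm a"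
  using Pm_pythagoras[of a] by (intro power2_le_imp_le[of "norm (Pm a)"]) auto

lemma bounded_linear_Pm: "bounded_linear Pm"
  by (rule bounded_linear_intro[of _ 1]) (auto simp: Pm_add Pm_scaleR norm_Pm_le)

text \<open>Multiplication by \<zeta> pushes the coefficient of index -1 out of the negative
  frequencies and merely moves the others. For Hankel operators this removes or adds one block
  row.\<close>

lemma norm_Pm_split: "(norm (Pm a))\<^sup>2 = (norm (cf a (-1)))\<^sup>2 + (norm (Pm (sh 1 a)))\<^sup>2"
proof -
  let ?u = "sh (-1) (cst (cf a (-1)))" and ?v = "sh (-1) (Pm (sh 1 a))"
  have e: "Pm a = ?u + ?v"
  proof (rule L2_coef_eqI)
    fix k :: int
    have "k < -1 \<or> k = -1 \<or> k \<ge> 0" by linarith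
    then show "cf (Pm a) k = cf (?u + ?v) k"
      by (elim disjE) (auto simp: cf_Pm cf_add cf_sh cf_cst)
  qed
  have "?u \<bullet> ?v = 0"
    by (rule inner_zero_coefs) (auto simp: cf_Pm cf_sh cf_cst)
  then have "(norm (?u + ?v))\<^sup>2 = (norm ?u)\<^sup>2 + (norm ?v)\<^sup>2"
    unfolding power2_norm_eq_inner by (simp add: inner_add inner_commute)
  then show ?thesis unfolding e by simp
qed

definition H2X :: "'n::finite L2 set" where
  "H2X = {a. \<forall>k<0. cf a k = 0}"

lemma Pm_eq_0_iff: "Pm a = 0 \<longleftrightarrow> a \<in> H2X"
proof
  assume "Pm a = 0"
  then have "cf (Pm a) k = 0" for k by (simp add: cf_zero)
  then have "cf a k = 0" if "k < 0" for k using that unfolding cf_Pm by metis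
  then show "a \<in> H2X" by (simp add: H2X_def)
next
  assume "a \<in> H2X"
  then show "Pm a = 0" by (intro L2_zeroI) (simp add: cf_Pm H2X_def)
qed

lemma subspace_H2X: "subspace H2X"
  by (auto simp: subspace_def H2X_def cf_add cf_scaleR cf_zero)

lemma closed_H2X: "closed (H2X :: 'a::finite L2 set)"
proof -
  have "H2X = Pm -` {0 :: 'a L2}" by (auto simp: Pm_eq_0_iff)
  moreover have "closed (Pm -` {0 :: 'a L2})"
    by (intro closed_vimage linear_continuous_on bounded_linear_Pm closed_singleton)
  ultimately show ?thesis by simp
qed

lemmas H2X_add = subspace_add[OF subspace_H2X] and H2X_diff = subspace_diff[OF subspace_H2X]
  and H2X_scaleR = subspace_mul[OF subspace_H2X] and H2X_zero = subspace_0[OF subspace_H2X]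
  and H2X_sum = subspace_sum[OF subspace_H2X]

lemma H2X_cs: "a \<in> H2X \<Longrightarrow> cs c a \<in> H2X"
  by (simp add: H2X_def cf_cs)

lemma H2X_sh: "a \<in> H2X \<Longrightarrow> k \<ge> 0 \<Longrightarrow> sh k a \<in> H2X"
  by (simp add: H2X_def cf_sh)

lemma H2X_cst: "cst v \<in> H2X"
  by (simp add: H2X_def cf_cst)

lemma H2X_sh_back:
  assumes "a \<in> H2X" "cf a 0 = 0" shows "sh (-1) a \<in> H2X"
proof -
  have "cf a (k + 1) = 0" if "k < 0" for k
    using assms that by (cases "k + 1 = 0") (auto simp: H2X_def)
  then show ?thesis by (simp add: H2X_def cf_sh)
qed

lemma H2_rep: "a \<in> H2X \<Longrightarrow> H2 (rep a)"
  by (simp add: H2X_def H2_def sq_int_rep flip: cf_def)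

lemma mfcoef_mult:
  assumes F: "Linf F" shows "mfcoef F k *v x = cf (mm F (cst x)) k"
proof -
  have sq: "sq_int (\<lambda>\<theta>. F \<theta> *v y)" for y by (intro sq_int_matrix F sq_int_const)
  have i: "integrable circ (\<lambda>\<theta>. F \<theta> $ i $ j * cis (- (of_int k * \<theta>)))" for i j
    using integrable_fcoef[OF sq, of "axis j 1" i "- k"] by (simp add: matrix_vector_mult_def axis_def if_distrib[of "(*) _"] cong: if_cong)
  have "cf (mm F (cst x)) k = fcoef (\<lambda>\<theta>. F \<theta> *v x) k"
    by (simp add: cst_def mm_mk sq_int_const cf_mk sq)
  moreover have "fcoef (\<lambda>\<theta>. F \<theta> *v x) k $ i = (mfcoef F k *v x) $ i" for i
  proof -
    have "(\<integral>\<theta>. (F \<theta> *v x) $ i * cis (- (of_int k * \<theta>)) \<partial>circ)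
      = (\<integral>\<theta>. (\<Sum>j\<in>UNIV. (F \<theta> $ i $ j * cis (- (of_int k * \<theta>))) * x $ j) \<partial>circ)"
      by (intro Bochner_Integration.integral_cong) (auto simp: matrix_vector_mult_def sum_distrib_left mult_ac)
    also have "\<dots> = (\<Sum>j\<in>UNIV. (\<integral>\<theta>. F \<theta> $ i $ j * cis (- (of_int k * \<theta>)) \<partial>circ) * x $ j)"
      by (subst Bochner_Integration.integral_sum) (auto intro!: integrable_mult_left i)
    finally show ?thesis
      by (simp add: fcoef_def mfcoef_def matrix_vector_mult_def sum_divide_distrib)
  qed
  ultimately show ?thesis by (simp add: vec_eq_iff)
qed

text \<open>Applied to a constant vector, the matrix coefficients become coefficients of an element
  of \<open>L2\<close>, so analyticity of a matrix function can be tested on constants.\<close>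

lemma Hinf_iff: "Hinf F \<longleftrightarrow> Linf F \<and> (\<forall>x. mm F (cst x) \<in> H2X)"
  unfolding Hinf_def H2X_def
  by (auto simp: matrix_eq mfcoef_mult)

text \<open>\<open>mm F\<close> commutes with shifts, which carries the claim from constants to the
  partial sums of the Fourier series; \<open>H2X\<close> is closed.\<close>

lemma Hinf_mm:
  assumes F: "Hinf F" and a: "a \<in> H2X" shows "mm F a \<in> H2X"
proof -
  have L: "Linf F" using F by (simp add: Hinf_def)
  have t: "mm F (sh k (cst (cf a k))) \<in> H2X" for k
  proof (cases "k \<ge> 0")
    case True
    then show ?thesis using F by (simp add: L Hinf_iff H2X_sh flip: sh_mm)
  next
    case False
    then have "sh k (cst (cf a k)) = 0" using a by (intro L2_zeroI) (simp add: H2X_def cf_sh_cst)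
    then show ?thesis by (simp add: mm_zero L H2X_zero)
  qed
  have "mm F (psum (cf a) N) \<in> H2X" for N
    unfolding psum_def linear_sum[OF linear_mm[OF L]] by (intro H2X_sum t)
  moreover have "(\<lambda>N. mm F (psum (cf a) N)) \<longlonglongrightarrow> mm F a"
    by (rule bounded_linear.tendsto[OF bounded_linear_mm[OF L] fourier_series])
  ultimately show ?thesis by (rule closed_sequentially[OF closed_H2X])
qed

section \<open>Hankel operators on \<open>L2\<close>\<close>

definition Hk :: "(real \<Rightarrow> complex^'n^'n) \<Rightarrow> 'n::finite L2 \<Rightarrow> 'n L2" where
  "Hk \<Psi> a = Pm (mm \<Psi> a)"

lemma bounded_linear_Hk: "Linf \<Psi> \<Longrightarrow> bounded_linear (Hk \<Psi>)"
  unfolding Hk_def by (intro bounded_linear_compose[OF bounded_linear_Pm] bounded_linear_mm)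

lemma Hk_cong:
  assumes "Linf \<Phi>" "Linf G" "Hinf (\<lambda>\<theta>. \<Phi> \<theta> - G \<theta>)" "a \<in> H2X"
  shows "Hk \<Phi> a = Hk G a"
proof -
  have "Pm (mm \<Phi> a - mm G a) = 0"
    using Hinf_mm[OF assms(3,4)] assms by (simp add: mm_diff_left Pm_eq_0_iff)
  then show ?thesis by (simp add: Hk_def Pm_diff)
qed

lemma Hk_cs: "Linf \<Psi> \<Longrightarrow> Hk \<Psi> (cs c a) = cs c (Hk \<Psi> a)"
  by (simp add: Hk_def Pm_cs flip: cs_mm)

text \<open>\<open>Pminus\<close> selects some function with the prescribed coefficients, so
  \<open>hankel\<close> is meaningful only up to null sets. After \<open>mk\<close> the coefficients
  determine the result.\<close>

lemma hankel_mk: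
  assumes "Linf \<Phi>" "sq_int f"
  shows "sq_int (hankel \<Phi> f)" "mk (hankel \<Phi> f) = Hk \<Phi> (mk f)"
proof -
  let ?g = "\<lambda>\<theta>. \<Phi> \<theta> *v f \<theta>"
  have g: "sq_int ?g" by (intro sq_int_matrix assms)
  have "\<exists>h. sq_int h \<and> (\<forall>k. fcoef h k = (if k < 0 then fcoef ?g k else 0))"
    using cf_Pm[of "mk ?g"] by (intro exI[of _ "rep (Pm (mk ?g))"]) (simp add: sq_int_rep cf_mk g cf_def[of "Pm _"])
  from someI_ex[OF this] have h: "sq_int (hankel \<Phi> f)"
    "\<And>k. fcoef (hankel \<Phi> f) k = (if k < 0 then fcoef ?g k else 0)"
    unfolding hankel_def Pminus_def by blast+
  then show "sq_int (hankel \<Phi> f)" "mk (hankel \<Phi> f) = Hk \<Phi> (mk f)"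
    by (auto intro!: L2_coef_eqI simp: cf_mk Hk_def cf_Pm mm_mk assms g)
qed

definition contr :: "(real \<Rightarrow> complex^'n^'n) \<Rightarrow> bool" where
  "contr \<Psi> \<longleftrightarrow> (\<forall>a\<in>H2X. norm (Hk \<Psi> a) \<le> norm a)"

lemma contr_of_hankel:
  assumes "Linf \<Phi>" "hankel_norm_le \<Phi> 1" shows "contr \<Phi>"
  unfolding contr_def
proof
  fix a :: "'a L2" assume a: "a \<in> H2X"
  have "L2norm (hankel \<Phi> (rep a)) \<le> L2norm (rep a)"
    using assms(2) H2_rep[OF a] by (simp add: hankel_norm_le_def)
  then show "norm (Hk \<Phi> a) \<le> norm a"
    by (simp add: L2norm_eq hankel_mk assms(1) sq_int_rep mk_rep)
qed

text \<open>The consequence of \<open>\<parallel>H\<parallel>\<^sub>e < 1\<close> that is inherited by finite-rank extensions of \<open>H\<close>.\<close>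

definition ess_coercive :: "(real \<Rightarrow> complex^'n^'n) \<Rightarrow> real \<Rightarrow> bool" where
  "ess_coercive \<Psi> \<delta> \<longleftrightarrow> (\<forall>s B. (\<forall>m. s m \<in> H2X \<and> norm (s m) \<le> B) \<longrightarrow>
     (\<exists>r::nat \<Rightarrow> nat. strict_mono r \<and> (\<forall>e>0. \<exists>N. \<forall>a\<ge>N. \<forall>b\<ge>N.
        \<delta> * (norm (s (r a) - s (r b)))\<^sup>2
          \<le> (norm (s (r a) - s (r b)))\<^sup>2 - (norm (Hk \<Psi> (s (r a) - s (r b))))\<^sup>2 + e)))"

text \<open>Let a compact \<open>T\<close> approximate the Hankel operator up to
  \<open>d < 1\<close>. Along a subsequence with Cauchy images under \<open>T\<close>, differences
  \<open>h\<close> satisfy \<open>norm (Hk \<Phi> h) \<le> D * norm h\<close> up to a small error.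
  Squaring yields the constant \<open>1 - D\<^sup>2\<close>.\<close>

lemma ess_coercive_of_hankel:
  fixes \<Phi> :: "real \<Rightarrow> complex^'n^'n"
  assumes L: "Linf \<Phi>" and ess: "hankel_ess_norm_lt \<Phi> 1"
  obtains \<delta> where "\<delta> > 0" "ess_coercive \<Phi> \<delta>"
proof -
  obtain T d where T: "cpt_operator T" and d: "d < 1"
    and Td: "\<And>f. H2 f \<Longrightarrow> L2norm (\<lambda>\<theta>. hankel \<Phi> f \<theta> - T f \<theta>) \<le> d * L2norm f"
    using ess unfolding hankel_ess_norm_lt_def by blast
  \<comment> \<open>\<open>d\<close> may be negative, whereas squaring the estimate needs a
    nonnegative constant.\<close>
  define D where "D = max d 0"
  have D: "0 \<le> D" "D < 1" "d \<le> D" using d by (auto simp: D_def)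
  have sqT: "sq_int (T f)" if "H2 f" for f
    using T that unfolding cpt_operator_def H2minus_def by blast
  have bound: "norm (Hk \<Phi> (mk f)) \<le> D * norm (mk f) + norm (mk (T f))" if f: "H2 f" for f
  proof -
    have sqf: "sq_int f" using f by (simp add: H2_def)
    note h = hankel_mk[OF L sqf]
    have "sqrt (2*pi) * norm (mk (hankel \<Phi> f) - mk (T f)) \<le> d * (sqrt (2*pi) * norm (mk f))"
      using Td[OF f] by (simp add: L2norm_eq sq_int_diff h sqT f sqf mk_diff)
    then have "sqrt (2*pi) * norm (mk (hankel \<Phi> f) - mk (T f)) \<le> sqrt (2*pi) * (d * norm (mk f))"
      by (simp add: mult_ac)
    then have "norm (mk (hankel \<Phi> f) - mk (T f)) \<le> d * norm (mk f)"
      by (simp add: mult_le_cancel_left_pos)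
    also have "\<dots> \<le> D * norm (mk f)" using D by (intro mult_right_mono) auto
    finally show ?thesis
      using norm_triangle_sub[of "mk (hankel \<Phi> f)" "mk (T f)"] by (simp add: h)
  qed
  have "ess_coercive \<Phi> (1 - D\<^sup>2)"
    unfolding ess_coercive_def
  proof (intro allI impI)
    fix s :: "nat \<Rightarrow> 'n L2" and B assume s: "\<forall>m. s m \<in> H2X \<and> norm (s m) \<le> B"
    have B: "B \<ge> 0" using s norm_ge_zero order_trans by blast
    have "\<forall>m. H2 (rep (s m))" using s H2_rep by blast
    moreover have "\<exists>B. \<forall>m. L2norm (rep (s m)) \<le> B"
      using s by (intro exI[of _ "sqrt (2*pi) * B"]) (simp add: L2norm_eq sq_int_rep mk_rep)
    moreover have "\<forall>s::nat \<Rightarrow> real \<Rightarrow> complex^'n. (\<forall>m. H2 (s m)) \<longrightarrow> (\<exists>B::real. \<forall>m::nat. L2norm (s m) \<le> B) \<longrightarrow>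
        (\<exists>r::nat \<Rightarrow> nat. strict_mono r \<and>
           (\<forall>e>0. \<exists>N. \<forall>a\<ge>N. \<forall>b\<ge>N. L2norm (\<lambda>\<theta>. T (s (r a)) \<theta> - T (s (r b)) \<theta>) < e))"
      using T unfolding cpt_operator_def by (elim conjE)
    ultimately have "\<exists>r::nat \<Rightarrow> nat. strict_mono r \<and>
           (\<forall>e>0. \<exists>N. \<forall>a\<ge>N. \<forall>b\<ge>N. L2norm (\<lambda>\<theta>. T (rep (s (r a))) \<theta> - T (rep (s (r b))) \<theta>) < e)"
      by (elim allE[of _ "\<lambda>m. rep (s m)"] impE) assumption+
    then obtain r :: "nat \<Rightarrow> nat" where r: "strict_mono r"
      and rT: "\<And>e. e > 0 \<Longrightarrow> \<exists>N. \<forall>a\<ge>N. \<forall>b\<ge>N. L2norm (\<lambda>\<theta>. T (rep (s (r a))) \<theta> - T (rep (s (r b))) \<theta>) < e"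
      by (elim exE conjE) simp
    show "\<exists>r::nat \<Rightarrow> nat. strict_mono r \<and> (\<forall>e>0. \<exists>N. \<forall>a\<ge>N. \<forall>b\<ge>N.
        (1 - D\<^sup>2) * (norm (s (r a) - s (r b)))\<^sup>2
          \<le> (norm (s (r a) - s (r b)))\<^sup>2 - (norm (Hk \<Phi> (s (r a) - s (r b))))\<^sup>2 + e)"
    proof (intro exI[of _ r] conjI r allI impI)
      fix e :: real assume e: "e > 0"
      \<comment> \<open>Makes all terms with \<open>\<epsilon>\<close> in the square of
        \<open>D * norm h + \<epsilon>\<close> sum to at most \<open>e\<close>, given
        \<open>norm h \<le> 2 * B\<close> and \<open>D < 1\<close>. The minimum with 1 absorbs the
        quadratic term.\<close>
      define \<epsilon> where "\<epsilon> = min 1 (e / (4 * B + 1))"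
      have "\<epsilon> \<le> e / (4 * B + 1)" by (simp add: \<epsilon>_def)
      then have "\<epsilon> * (4 * B + 1) \<le> e" using B by (simp add: pos_le_divide_eq)
      moreover have "\<epsilon> > 0" "\<epsilon> \<le> 1" using e B by (auto simp: \<epsilon>_def)
      ultimately have \<epsilon>: "\<epsilon> > 0" "\<epsilon> \<le> 1" "\<epsilon> * (4 * B + 1) \<le> e" by auto
      obtain N where N: "\<And>a b. a \<ge> N \<Longrightarrow> b \<ge> N \<Longrightarrow>
          L2norm (\<lambda>\<theta>. T (rep (s (r a))) \<theta> - T (rep (s (r b))) \<theta>) < sqrt (2*pi) * \<epsilon>"
        using rT[of "sqrt (2*pi) * \<epsilon>"] \<epsilon> by auto
      show "\<exists>N. \<forall>a\<ge>N. \<forall>b\<ge>N. (1 - D\<^sup>2) * (norm (s (r a) - s (r b)))\<^sup>2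
          \<le> (norm (s (r a) - s (r b)))\<^sup>2 - (norm (Hk \<Phi> (s (r a) - s (r b))))\<^sup>2 + e"
      proof (intro exI[of _ N] allI impI)
        fix a b assume ab: "a \<ge> N" "b \<ge> N"
        define x y where "x = rep (s (r a))" and "y = rep (s (r b))"
        define h where "h = s (r a) - s (r b)"
        have H: "H2 x" "H2 y" using s H2_rep by (auto simp: x_def y_def)
        then have sq: "sq_int x" "sq_int y" by (auto simp: H2_def)
        \<comment> \<open>\<open>cpt_operator\<close> grants additivity and homogeneity only, so the
          difference is treated as \<open>x\<close> plus -1 times \<open>y\<close>.\<close>
        have Hy: "H2 (\<lambda>\<theta>. (-1) *s y \<theta>)"
        proof -
          have "(\<lambda>\<theta>. (-1) *s y \<theta>) = (\<lambda>\<theta>. - y \<theta>)" by (simp add: vec_eq_iff fun_eq_iff)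
          moreover have "fcoef (\<lambda>\<theta>. - y \<theta>) k = - fcoef y k" for k
            by (simp add: fcoef_def vec_eq_iff)
          ultimately show ?thesis using H(2) by (simp add: H2_def sq_int_uminus)
        qed
        have fe: "(\<lambda>\<theta>. x \<theta> + (-1) *s y \<theta>) = (\<lambda>\<theta>. x \<theta> - y \<theta>)" by (simp add: vec_eq_iff fun_eq_iff)
        have mkh: "mk (\<lambda>\<theta>. x \<theta> - y \<theta>) = h" by (simp add: mk_diff sq, simp add: h_def x_def y_def mk_rep)
        have Hh: "H2 (\<lambda>\<theta>. x \<theta> - y \<theta>)"
          using s by (simp add: H2_def sq_int_diff sq flip: cf_mk) (simp add: mkh h_def cf_diff H2X_def)
        have lin: "T (\<lambda>\<theta>. f \<theta> + g \<theta>) = (\<lambda>\<theta>. T f \<theta> + T g \<theta>)" "T (\<lambda>\<theta>. c *s f \<theta>) = (\<lambda>\<theta>. c *s T f \<theta>)"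
          if "H2 f" "H2 g" for f g c
          using T that unfolding cpt_operator_def by blast+
        have "T (\<lambda>\<theta>. x \<theta> - y \<theta>) = (\<lambda>\<theta>. T x \<theta> - T y \<theta>)"
          using lin(1)[OF H(1) Hy] lin(2)[OF H(2,2), of "-1"] by (simp add: fe)
        then have "norm (mk (T (\<lambda>\<theta>. x \<theta> - y \<theta>))) < \<epsilon>"
          using N[OF ab] by (simp add: x_def[symmetric] y_def[symmetric] L2norm_eq sq_int_diff sqT H mult_less_cancel_left_pos)
        then have b: "norm (Hk \<Phi> h) \<le> D * norm h + \<epsilon>"
          using bound[OF Hh] by (simp add: mkh)
        have nh: "norm h \<le> 2 * B"
          using s norm_triangle_ineq4[of "s (r a)" "s (r b)"] unfolding h_def by (smt (verit))
        have "(norm (Hk \<Phi> h))\<^sup>2 \<le> (D * norm h + \<epsilon>)\<^sup>2" by (intro power_mono b) simp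
        also have "\<dots> = D\<^sup>2 * (norm h)\<^sup>2 + \<epsilon> * (2 * D * norm h + \<epsilon>)"
          by (simp add: power2_eq_square algebra_simps)
        also have "\<epsilon> * (2 * D * norm h + \<epsilon>) \<le> \<epsilon> * (4 * B + 1)"
        proof (intro mult_left_mono add_mono)
          have "D * norm h \<le> 1 * (2 * B)" using D nh B by (intro mult_mono) auto
          then show "2 * D * norm h \<le> 4 * B" by simp
        qed (use \<epsilon> in auto)
        also have "\<dots> \<le> e" by (rule \<epsilon>)
        finally show "(1 - D\<^sup>2) * (norm (s (r a) - s (r b)))\<^sup>2
          \<le> (norm (s (r a) - s (r b)))\<^sup>2 - (norm (Hk \<Phi> (s (r a) - s (r b))))\<^sup>2 + e"
          unfolding h_def by (simp add: algebra_simps)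
      qed
    qed
  qed
  moreover have "1 - D\<^sup>2 > 0" using D by (simp add: power_less_one_iff abs_square_less_1)
  ultimately show thesis using that by blast
qed

section \<open>The weighted Nehari theorem\<close>

text \<open>The discriminant of a nonnegative quadratic polynomial. It is stated with bare numbers
  because the forms it serves may be degenerate, so that \<open>c = 0\<close> has to be
  allowed.\<close>

lemma semi_inner_cauchy:
  assumes q: "\<And>s::real. 0 \<le> e + 2 * s * b + s\<^sup>2 * c" and c: "0 \<le> c" and e: "0 \<le> e"
  shows "\<bar>b\<bar> \<le> sqrt e * sqrt c"
proof (cases "c = 0")
  case True
  have "b = 0"
  proof (rule ccontr)
    assume "b \<noteq> 0"
    \<comment> \<open>At this \<open>s\<close> the polynomial, linear for \<open>c = 0\<close>, has
      the value -1.\<close>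
    then show False using q[of "- (e + 1) / (2 * b)"] True by (simp add: field_simps)
  qed
  then show ?thesis by (simp add: c e)
next
  case False
  then have "c > 0" using c by simp
  then have "0 \<le> e - b\<^sup>2 / c" using q[of "- b / c"] by (simp add: field_simps power2_eq_square)
  then have "b\<^sup>2 \<le> e * c" using \<open>c > 0\<close> by (simp add: field_simps)
  then show ?thesis by (metis real_sqrt_abs real_sqrt_le_iff real_sqrt_mult)
qed

text \<open>In a completion of \<open>(V, q)\<close> the map \<open>T\<close> would be \<open>L\<close> composed with the orthogonal projection
  onto \<open>Y\<close>; minimising sequences replace the projection.\<close>

lemma contractive_extension:
  fixes q :: "'n::finite L2 \<Rightarrow> 'n L2 \<Rightarrow> real" and L :: "'n L2 \<Rightarrow> complex^'n"
  assumes qs: "\<And>f g. q f g = q g f"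
    and qa: "\<And>f g h. q (f + g) h = q f h + q g h"
    and qr: "\<And>r f g. q (r *\<^sub>R f) g = r * q f g"
    and qc: "\<And>c f g. q (cs c f) g = q f (cs (cnj c) g)"
    and V: "subspace V" "\<And>c f. f \<in> V \<Longrightarrow> cs c f \<in> V"
    and Y: "subspace Y" "\<And>c f. f \<in> Y \<Longrightarrow> cs c f \<in> Y" "Y \<subseteq> V"
    and pos: "\<And>f. f \<in> V \<Longrightarrow> 0 \<le> q f f"
    and L: "linear L" "\<And>c f. L (cs c f) = c *s L f"
    and bd: "\<And>y. y \<in> Y \<Longrightarrow> (norm (L y))\<^sup>2 \<le> q y y"
  obtains T where "\<And>f g. f \<in> V \<Longrightarrow> g \<in> V \<Longrightarrow> T (f + g) = T f + T g"
    and "\<And>c f. f \<in> V \<Longrightarrow> T (cs c f) = c *s T f"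
    and "\<And>y. y \<in> Y \<Longrightarrow> T y = L y"
    and "\<And>f. f \<in> V \<Longrightarrow> (norm (T f))\<^sup>2 \<le> q f f"
proof -
  have qar: "q h (f + g) = q h f + q h g" for f g h by (metis qa qs)
  have qrr: "q g (r *\<^sub>R f) = r * q g f" for r f g by (metis qr qs)
  have qm: "q (f - g) h = q f h - q g h" for f g h
    using qa[of f "(-1) *\<^sub>R g" h] qr[of "-1" g h] by simp
  have qmr: "q h (f - g) = q h f - q h g" for f g h by (metis qm qs)
  have YV: "y \<in> V" if "y \<in> Y" for y using that Y by blast
  have Lb: "norm (L y) \<le> sqrt (q y y)" if "y \<in> Y" for y
    using bd[OF that] by (simp add: real_le_rsqrt)
  \<comment> \<open>\<open>t\<close> is a limit of \<open>L\<close> along elements of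
    \<open>Y\<close> that are asymptotically \<open>q\<close>-orthogonal projections of
    \<open>f\<close>. The form \<open>q\<close> may be degenerate and \<open>Y\<close> incomplete,
    so only the images under \<open>L\<close> are asked to converge.\<close>
  define rel where "rel f t \<longleftrightarrow> (\<exists>y \<eta>. (\<forall>k. y k \<in> Y) \<and> \<eta> \<longlonglongrightarrow> 0 \<and>
      (\<forall>k::nat. \<forall>z\<in>Y. \<bar>q (f - y k) z\<bar> \<le> \<eta> k * sqrt (q z z)) \<and> (\<lambda>k. L (y k)) \<longlonglongrightarrow> t)" for f t
  \<comment> \<open>Two near projections of the same \<open>f\<close> differ by an element of
    \<open>Y\<close> that is nearly orthogonal to itself, hence small for \<open>q\<close>, and
    \<open>L\<close> is contractive on \<open>Y\<close>. This one estimate yields both existence and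
    uniqueness of the limit.\<close>
  have key: "norm (L (y - y')) \<le> \<eta> + \<eta>'"
    if "y \<in> Y" "y' \<in> Y" "\<forall>z\<in>Y. \<bar>q (f - y) z\<bar> \<le> \<eta> * sqrt (q z z)" "\<forall>z\<in>Y. \<bar>q (f - y') z\<bar> \<le> \<eta>' * sqrt (q z z)"
      "0 \<le> \<eta> + \<eta>'" for f y y' \<eta> \<eta>'
  proof -
    let ?d = "y - y'"
    have d: "?d \<in> Y" using that Y(1) by (simp add: subspace_diff)
    have p: "0 \<le> q ?d ?d" by (intro pos YV d)
    have "q ?d ?d = q (f - y') ?d - q (f - y) ?d" by (simp add: qm)
    also have "\<dots> \<le> \<eta>' * sqrt (q ?d ?d) + \<eta> * sqrt (q ?d ?d)"
      using that(3,4) d by (smt (verit))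
    finally have "sqrt (q ?d ?d) * sqrt (q ?d ?d) \<le> (\<eta> + \<eta>') * sqrt (q ?d ?d)"
      using p by (simp add: algebra_simps)
    then have "sqrt (q ?d ?d) \<le> \<eta> + \<eta>'"
      using that(5) real_sqrt_ge_zero[OF p] by (metis mult_right_le_imp_le order_le_less)
    then show ?thesis using Lb[OF d] by simp
  qed
  have ex: "\<exists>t. rel f t" if f: "f \<in> V" for f
  proof -
    define \<iota> where "\<iota> = (INF y\<in>Y. q (f - y) (f - y))"
    have bdd: "bdd_below ((\<lambda>y. q (f - y) (f - y)) ` Y)"
      by (rule bdd_belowI[of _ 0]) (auto intro!: pos subspace_diff[OF V(1)] f dest: YV)
    have ne: "(\<lambda>y. q (f - y) (f - y)) ` Y \<noteq> {}" using subspace_0[OF Y(1)] by blast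
    have "\<exists>y\<in>Y. q (f - y) (f - y) < \<iota> + (1 / real (Suc k))\<^sup>2" for k
      using cInf_lessD[OF ne, of "\<iota> + (1 / real (Suc k))\<^sup>2"] unfolding \<iota>_def by auto
    then obtain y where y: "\<And>k. y k \<in> Y" "\<And>k. q (f - y k) (f - y k) < \<iota> + (1 / real (Suc k))\<^sup>2" by metis
    \<comment> \<open>Being within \<open>(1 / real (Suc k))\<^sup>2\<close> of the infimum bounds
      the first variation in every direction \<open>z\<close>. The tolerance is squared so that the
      orthogonality defect is its root.\<close>
    have or: "\<bar>q (f - y k) z\<bar> \<le> 1 / real (Suc k) * sqrt (q z z)" if z: "z \<in> Y" for k z
    proof -
      have "0 \<le> (1 / real (Suc k))\<^sup>2 + 2 * s * q (f - y k) z + s\<^sup>2 * q z z" for s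
      proof -
        have "y k - s *\<^sub>R z \<in> Y" using y z Y(1) by (simp add: subspace_diff subspace_mul)
        then have "\<iota> \<le> q (f - (y k - s *\<^sub>R z)) (f - (y k - s *\<^sub>R z))"
          unfolding \<iota>_def by (intro cINF_lower bdd)
        also have "f - (y k - s *\<^sub>R z) = (f - y k) + s *\<^sub>R z" by simp
        also have "q ((f - y k) + s *\<^sub>R z) ((f - y k) + s *\<^sub>R z)
          = q (f - y k) (f - y k) + 2 * s * q (f - y k) z + s\<^sup>2 * q z z"
          unfolding qa qar qr qrr qs[of z "f - y k"] by (simp add: power2_eq_square distrib_left)
        finally show ?thesis using y(2)[of k] by simp
      qed
      from semi_inner_cauchy[OF this] pos[OF YV[OF z]] show ?thesis by (simp del: of_nat_Suc)
    qed
    have "Cauchy (\<lambda>k. L (y k))"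
    proof (rule metric_CauchyI)
      fix e :: real assume e: "e > 0"
      then obtain N where N: "1 / real (Suc N) < e / 2" using nat_approx_posE[of "e/2"] by auto
      have "dist (L (y m)) (L (y n)) < e" if "m \<ge> N" "n \<ge> N" for m n
      proof -
        have "norm (L (y m - y n)) \<le> 1 / real (Suc m) + 1 / real (Suc n)"
          by (rule key[of _ _ f]) (use y or in \<open>auto simp del: of_nat_Suc\<close>)
        also have "\<dots> \<le> 1 / real (Suc N) + 1 / real (Suc N)"
          using that by (intro add_mono divide_left_mono) auto
        finally show ?thesis using N by (simp add: dist_norm linear_diff[OF L(1)])
      qed
      then show "\<exists>M. \<forall>m\<ge>M. \<forall>n\<ge>M. dist (L (y m)) (L (y n)) < e" by blast
    qed
    then obtain t where t: "(\<lambda>k. L (y k)) \<longlonglongrightarrow> t" using Cauchy_convergent convergent_def by blast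
    have "(\<lambda>k. 1 / real (Suc k)) \<longlonglongrightarrow> 0" by (rule LIMSEQ_Suc[OF lim_1_over_n])
    with t y or have "rel f t" unfolding rel_def by (intro exI[of _ y] exI[of _ "\<lambda>k. 1 / real (Suc k)"]) auto
    then show ?thesis ..
  qed
  have uniq: "t = t'" if "rel f t" "rel f t'" for f t t'
  proof -
    obtain y \<eta> where y: "\<forall>k. y k \<in> Y" "\<eta> \<longlonglongrightarrow> 0" "\<forall>k. \<forall>z\<in>Y. \<bar>q (f - y k) z\<bar> \<le> \<eta> k * sqrt (q z z)"
        "(\<lambda>k. L (y k)) \<longlonglongrightarrow> t" using \<open>rel f t\<close> unfolding rel_def by blast
    obtain y' \<eta>' where y': "\<forall>k. y' k \<in> Y" "\<eta>' \<longlonglongrightarrow> 0" "\<forall>k. \<forall>z\<in>Y. \<bar>q (f - y' k) z\<bar> \<le> \<eta>' k * sqrt (q z z)"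
        "(\<lambda>k. L (y' k)) \<longlonglongrightarrow> t'" using \<open>rel f t'\<close> unfolding rel_def by blast
    have b: "norm (L (y k) - L (y' k)) \<le> \<bar>\<eta> k\<bar> + \<bar>\<eta>' k\<bar>" for k
    proof -
      have m: "r * sqrt (q z z) \<le> \<bar>r\<bar> * sqrt (q z z)" if "z \<in> Y" for r z
        by (intro mult_right_mono abs_ge_self real_sqrt_ge_zero pos YV that)
      have "\<forall>z\<in>Y. \<bar>q (f - y k) z\<bar> \<le> \<bar>\<eta> k\<bar> * sqrt (q z z)"
        using y(3) order_trans[OF _ m] by blast
      moreover have "\<forall>z\<in>Y. \<bar>q (f - y' k) z\<bar> \<le> \<bar>\<eta>' k\<bar> * sqrt (q z z)"
        using y'(3) order_trans[OF _ m] by blast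
      ultimately show ?thesis
        using key[of "y k" "y' k" f "\<bar>\<eta> k\<bar>" "\<bar>\<eta>' k\<bar>"] y(1) y'(1) by (simp add: linear_diff[OF L(1)])
    qed
    have l: "(\<lambda>k. \<bar>\<eta> k\<bar> + \<bar>\<eta>' k\<bar>) \<longlonglongrightarrow> 0"
      using tendsto_add[OF tendsto_rabs[OF y(2)] tendsto_rabs[OF y'(2)]] by simp
    have "(\<lambda>k. L (y k) - L (y' k)) \<longlonglongrightarrow> 0"
      by (rule Lim_null_comparison[OF _ l]) (simp add: b)
    moreover have "(\<lambda>k. L (y k) - L (y' k)) \<longlonglongrightarrow> t - t'" by (intro tendsto_diff y(4) y'(4))
    ultimately have "t - t' = 0" by (rule LIMSEQ_unique[symmetric])
    then show ?thesis by simp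
  qed
  have radd: "rel (f + g) (t + u)" if "rel f t" "rel g u" for f g t u
  proof -
    obtain y \<eta> where y: "\<forall>k. y k \<in> Y" "\<eta> \<longlonglongrightarrow> 0" "\<forall>k. \<forall>z\<in>Y. \<bar>q (f - y k) z\<bar> \<le> \<eta> k * sqrt (q z z)"
        "(\<lambda>k. L (y k)) \<longlonglongrightarrow> t" using \<open>rel f t\<close> unfolding rel_def by blast
    obtain y' \<eta>' where y': "\<forall>k. y' k \<in> Y" "\<eta>' \<longlonglongrightarrow> 0" "\<forall>k. \<forall>z\<in>Y. \<bar>q (g - y' k) z\<bar> \<le> \<eta>' k * sqrt (q z z)"
        "(\<lambda>k. L (y' k)) \<longlonglongrightarrow> u" using \<open>rel g u\<close> unfolding rel_def by blast
    have "\<bar>q (f + g - (y k + y' k)) z\<bar> \<le> (\<eta> k + \<eta>' k) * sqrt (q z z)" if "z \<in> Y" for k z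
    proof -
      have e: "q (f + g - (y k + y' k)) z = q (f - y k) z + q (g - y' k) z"
        by (simp add: qa qm)
      have "\<bar>q (f - y k) z\<bar> \<le> \<eta> k * sqrt (q z z)" "\<bar>q (g - y' k) z\<bar> \<le> \<eta>' k * sqrt (q z z)"
        using y(3) y'(3) that by auto
      then show ?thesis unfolding e by (simp add: distrib_right abs_le_iff)
    qed
    moreover have "(\<lambda>k. \<eta> k + \<eta>' k) \<longlonglongrightarrow> 0" using tendsto_add[OF y(2) y'(2)] by simp
    moreover have "(\<lambda>k. L (y k + y' k)) \<longlonglongrightarrow> t + u"
      using tendsto_add[OF y(4) y'(4)] by (simp add: linear_add[OF L(1)])
    ultimately show ?thesis unfolding rel_def
      using y(1) y'(1) Y(1) by (intro exI[of _ "\<lambda>k. y k + y' k"] exI[of _ "\<lambda>k. \<eta> k + \<eta>' k"]) (auto simp: subspace_add)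
  qed
  have rcs: "rel (cs c f) (c *s t)" if "rel f t" for c f t
  proof -
    obtain y \<eta> where y: "\<forall>k. y k \<in> Y" "\<eta> \<longlonglongrightarrow> 0" "\<forall>k. \<forall>z\<in>Y. \<bar>q (f - y k) z\<bar> \<le> \<eta> k * sqrt (q z z)"
        "(\<lambda>k. L (y k)) \<longlonglongrightarrow> t" using \<open>rel f t\<close> unfolding rel_def by blast
    have qcc: "q (cs (cnj c) z) (cs (cnj c) z) = (cmod c)\<^sup>2 * q z z" for z
    proof -
      have "q (cs (cnj c) z) (cs (cnj c) z) = q z (cs (complex_of_real ((cmod c)\<^sup>2)) z)"
        by (simp add: qc cs_cs complex_norm_square del: of_real_power)
      also have "cs (complex_of_real ((cmod c)\<^sup>2)) z = (cmod c)\<^sup>2 *\<^sub>R z"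
        unfolding cs_def mm_def scaleR_L2_def by (simp add: mat_mult_vec scaleR_as_smult)
      finally show ?thesis by (simp add: qrr)
    qed
    have "\<bar>q (cs c f - cs c (y k)) z\<bar> \<le> (\<eta> k * cmod c) * sqrt (q z z)" if "z \<in> Y" for k z
    proof -
      have "q (cs c f - cs c (y k)) z = q (f - y k) (cs (cnj c) z)"
        by (simp add: qc flip: cs_diff)
      also have "\<bar>\<dots>\<bar> \<le> \<eta> k * sqrt (q (cs (cnj c) z) (cs (cnj c) z))" using y(3) Y(2) that by blast
      also have "\<dots> = (\<eta> k * cmod c) * sqrt (q z z)"
        by (simp add: qcc real_sqrt_mult)
      finally show ?thesis .
    qed
    moreover have "(\<lambda>k. \<eta> k * cmod c) \<longlonglongrightarrow> 0" using tendsto_mult_left_zero[OF y(2)] by simp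
    moreover have "(\<lambda>k. L (cs c (y k))) \<longlonglongrightarrow> c *s t"
      unfolding L(2) by (rule bounded_linear.tendsto[OF bounded_bilinear.bounded_linear_right[OF bounded_bilinear_smult] y(4)])
    ultimately show ?thesis unfolding rel_def
      using y(1) Y(2) by (intro exI[of _ "\<lambda>k. cs c (y k)"] exI[of _ "\<lambda>k. \<eta> k * cmod c"]) auto
  qed
  have rL: "rel y (L y)" if "y \<in> Y" for y
    unfolding rel_def using that qm[of y y] by (intro exI[of _ "\<lambda>_. y"] exI[of _ "\<lambda>_. 0"]) auto
  have rb: "(norm t)\<^sup>2 \<le> q f f" if "rel f t" "f \<in> V" for f t
  proof -
    obtain y \<eta> where y: "\<forall>k. y k \<in> Y" "\<eta> \<longlonglongrightarrow> 0" "\<forall>k. \<forall>z\<in>Y. \<bar>q (f - y k) z\<bar> \<le> \<eta> k * sqrt (q z z)"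
        "(\<lambda>k. L (y k)) \<longlonglongrightarrow> t" using \<open>rel f t\<close> unfolding rel_def by blast
    \<comment> \<open>With \<open>w\<close> the seminorm of \<open>y k\<close>, expanding
      \<open>q f f\<close> around \<open>y k\<close> gives
      \<open>w\<^sup>2 \<le> q f f + 2 * (\<bar>\<eta> k\<bar> * w)\<close>. Completing the square
      bounds \<open>w\<close>, and with it \<open>L (y k)\<close>.\<close>
    have "norm (L (y k)) \<le> sqrt (q f f) + 2 * \<bar>\<eta> k\<bar>" for k
    proof -
      define w where "w = sqrt (q (y k) (y k))"
      have w: "w \<ge> 0" "w\<^sup>2 = q (y k) (y k)" using pos[OF YV] y(1) by (auto simp: w_def)
      have p: "0 \<le> q (f - y k) (f - y k)" using YV y(1) that(2) by (intro pos subspace_diff[OF V(1)]) auto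
      have "q f f = q ((f - y k) + y k) ((f - y k) + y k)" by simp
      also have "\<dots> = q (f - y k) (f - y k) + 2 * q (f - y k) (y k) + q (y k) (y k)"
        unfolding qa qar using qs[of "y k" "f - y k"] by simp
      finally have "w\<^sup>2 \<le> q f f - 2 * q (f - y k) (y k)" using p w(2) by simp
      moreover have "\<bar>q (f - y k) (y k)\<bar> \<le> \<bar>\<eta> k\<bar> * w"
        using y(1,3) w(1) by (smt (verit) mult_right_mono w_def)
      ultimately have "w\<^sup>2 \<le> q f f + 2 * (\<bar>\<eta> k\<bar> * w)" by linarith
      then have "(w - \<bar>\<eta> k\<bar>)\<^sup>2 \<le> q f f + \<bar>\<eta> k\<bar>\<^sup>2" by (simp add: power2_eq_square algebra_simps)
      also have "\<dots> \<le> (sqrt (q f f) + \<bar>\<eta> k\<bar>)\<^sup>2"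
        using pos[OF that(2)] by (simp add: power2_sum)
      finally have "w - \<bar>\<eta> k\<bar> \<le> sqrt (q f f) + \<bar>\<eta> k\<bar>"
        using pos[OF that(2)] by (intro power2_le_imp_le[of "w - \<bar>\<eta> k\<bar>"]) auto
      then show ?thesis using Lb[of "y k"] y(1) by (simp add: w_def)
    qed
    moreover have "(\<lambda>k. sqrt (q f f) + 2 * \<bar>\<eta> k\<bar>) \<longlonglongrightarrow> sqrt (q f f) + 2 * \<bar>0\<bar>"
      by (intro tendsto_intros y(2))
    ultimately have "norm t \<le> sqrt (q f f) + 2 * \<bar>0\<bar>"
      by (intro LIMSEQ_le[OF tendsto_norm[OF y(4)]]) auto
    then have "norm t \<le> sqrt (q f f)" by simp
    then have "(norm t)\<^sup>2 \<le> (sqrt (q f f))\<^sup>2" by (intro power_mono) auto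
    then show ?thesis using pos[OF that(2)] by simp
  qed
  define T where "T f = (SOME t. rel f t)" for f
  have T: "rel f (T f)" if "f \<in> V" for f unfolding T_def using ex[OF that] by (rule someI_ex)
  show thesis
  proof (rule that[of T])
    show "T (f + g) = T f + T g" if "f \<in> V" "g \<in> V" for f g
      using radd[OF T T] T[of "f + g"] uniq that V(1) by (meson subspace_add)
    show "T (cs c f) = c *s T f" if "f \<in> V" for c f
      using rcs[OF T] T[of "cs c f"] uniq that V(2) by meson
    show "T y = L y" if "y \<in> Y" for y
      using rL[OF that] T[OF YV[OF that]] uniq by blast
    show "(norm (T f))\<^sup>2 \<le> q f f" if "f \<in> V" for f
      using rb[OF T] that by blast
  qed
qed

lemma cf_mm_const: "cf (mm (\<lambda>_. A) a) k = A *v cf a k"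
proof (rule cf_eqI)
  fix v
  have "cf (mm (\<lambda>_. A) a) k \<bullet> v = a \<bullet> sh k (cst (adjoint_mat A *v v))"
    by (simp add: cf_inner inner_mm Linf_const mm_const_cst flip: sh_mm)
  then show "cf (mm (\<lambda>_. A) a) k \<bullet> v = (A *v cf a k) \<bullet> v"
    by (simp add: inner_matrix_adjoint flip: cf_inner)
qed

text \<open>The symbol of the Hankel matrix extended by one block row; up to a constant, \<open>c\<close> is the new entry.\<close>

definition stepS :: "(real \<Rightarrow> complex^'n^'n) \<Rightarrow> complex^'n^'n \<Rightarrow> real \<Rightarrow> complex^'n^'n" where
  "stepS \<Phi> c = (\<lambda>\<theta>. mat (cis (of_int (-1) * \<theta>)) ** (\<Phi> \<theta> + c))"

lemma Linf_stepS: "Linf \<Phi> \<Longrightarrow> Linf (stepS \<Phi> c)"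
  unfolding stepS_def by (intro Linf_mult Linf_cis Linf_add Linf_const)

lemma mm_stepS: "Linf \<Phi> \<Longrightarrow> mm (stepS \<Phi> c) a = sh (-1) (mm \<Phi> a + mm (\<lambda>_. c) a)"
  unfolding stepS_def sh_def
  by (subst mm_add_left[symmetric]; (subst mm_mult)?) (simp_all only: Linf_cis Linf_add Linf_const)

lemma cf_stepS: "Linf \<Phi> \<Longrightarrow> cf (mm (stepS \<Phi> c) a) k = cf (mm \<Phi> a) (k + 1) + c *v cf a (k + 1)"
  by (simp add: mm_stepS cf_sh cf_add cf_mm_const)

text \<open>\<open>norm_Pm_split\<close> separates the new block row, where \<open>c\<close> acts on
  the value at 0, from the remaining rows. The latter are those of \<open>Hk \<Phi>\<close>, as
  multiplication by a constant matrix keeps \<open>a\<close> analytic.\<close>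

lemma Hk_stepS:
  assumes "Linf \<Phi>" "a \<in> H2X"
  shows "(norm (Hk (stepS \<Phi> c) a))\<^sup>2 = (norm (cf (mm \<Phi> a) 0 + c *v cf a 0))\<^sup>2 + (norm (Hk \<Phi> a))\<^sup>2"
proof -
  have "Pm (mm (\<lambda>_. c) a) = 0"
    using assms(2) by (simp add: Pm_eq_0_iff H2X_def cf_mm_const)
  then have "Pm (sh 1 (mm (stepS \<Phi> c) a)) = Hk \<Phi> a"
    by (simp add: mm_stepS assms sh_sh Pm_add Hk_def)
  then show ?thesis
    unfolding Hk_def[of "stepS \<Phi> c"] by (subst norm_Pm_split) (simp add: cf_stepS assms)
qed

text \<open>On functions vanishing at 0 the new row is already prescribed, and it is bounded there
  because a backward shift turns it into a row of \<open>Hk \<Phi>\<close>.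
  \<open>contractive_extension\<close> continues it to \<open>H2X\<close> within the defect of
  \<open>Hk \<Phi>\<close> relative to the weight; the freedom on constants is
  \<open>c\<close>.\<close>

lemma parrott_step:
  assumes \<Phi>: "Linf \<Phi>" and R: "Linf R"
    and le: "\<And>a. a \<in> H2X \<Longrightarrow> norm (Hk \<Phi> a) \<le> norm (mm R a)"
  obtains c where "\<And>a. a \<in> H2X \<Longrightarrow> norm (Hk (stepS \<Phi> c) a) \<le> norm (mm R a)"
proof -
  \<comment> \<open>The defect form: \<open>q f f\<close> is the room that the desired bound leaves
    for the new row applied to \<open>f\<close>.\<close>
  define q where "q f g = mm R f \<bullet> mm R g - Hk \<Phi> f \<bullet> Hk \<Phi> g" for f g
  define L where "L f = cf (mm \<Phi> f) 0" for f
  have lH: "linear (Hk \<Phi>)" by (rule bounded_linear.linear[OF bounded_linear_Hk[OF \<Phi>]])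
  have lR: "linear (mm R)" by (rule linear_mm[OF R])
  obtain T where T: "\<And>f g. f \<in> H2X \<Longrightarrow> g \<in> H2X \<Longrightarrow> T (f + g) = T f + T g"
    "\<And>c f. f \<in> H2X \<Longrightarrow> T (cs c f) = c *s T f"
    "\<And>y. y \<in> {a \<in> H2X. cf a 0 = 0} \<Longrightarrow> T y = L y"
    "\<And>f. f \<in> H2X \<Longrightarrow> (norm (T f))\<^sup>2 \<le> q f f"
  proof (rule contractive_extension[of q H2X "{a \<in> H2X. cf a 0 = 0}" L])
    show "q f g = q g f" for f g by (simp add: q_def inner_commute)
    show "q (f + g) h = q f h + q g h" for f g h
      by (simp add: q_def linear_add[OF lH] linear_add[OF lR] inner_add_left)
    show "q (r *\<^sub>R f) g = r * q f g" for r f g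
      by (simp add: q_def linear_scale[OF lH] linear_scale[OF lR] algebra_simps)
    show "q (cs c f) g = q f (cs (cnj c) g)" for c f g
      by (simp add: q_def Hk_cs \<Phi> inner_cs flip: cs_mm[OF R])
    show "subspace {a \<in> H2X. cf a 0 = (0::complex^'a)}"
      by (auto simp: subspace_def H2X_zero cf_zero H2X_add cf_add H2X_scaleR cf_scaleR)
    show "0 \<le> q f f" if "f \<in> H2X" for f
      using power_mono[OF le[OF that], of 2] by (simp add: q_def flip: power2_norm_eq_inner)
    show "linear L" unfolding L_def
      by (rule linearI) (simp_all add: mm_add mm_scaleR \<Phi> cf_add cf_scaleR)
    show "L (cs c f) = c *s L f" for c f by (simp add: L_def cf_cs flip: cs_mm[OF \<Phi>])
    show "(norm (L y))\<^sup>2 \<le> q y y" if "y \<in> {a \<in> H2X. cf a 0 = 0}" for y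
    proof -
      \<comment> \<open>As \<open>y\<close> vanishes at 0, it is \<zeta> times an analytic
        \<open>g\<close>, and \<open>L y\<close> is the leading row of \<open>Hk \<Phi>\<close> at
        \<open>g\<close>. The hypothesis for \<open>g\<close> therefore bounds \<open>L y\<close>;
        the weight does not notice the shift.\<close>
      define g where "g = sh (-1) y"
      have g: "g \<in> H2X" using that by (simp add: g_def H2X_sh_back)
      have y: "y = sh 1 g" by (simp add: g_def sh_sh)
      have "(norm (Hk \<Phi> g))\<^sup>2 = (norm (L y))\<^sup>2 + (norm (Hk \<Phi> y))\<^sup>2"
        unfolding Hk_def L_def y by (subst norm_Pm_split) (simp add: sh_mm[OF \<Phi>, symmetric] cf_sh)
      moreover have "norm (mm R y) = norm (mm R g)" by (simp add: y sh_mm[OF R, symmetric])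
      ultimately show ?thesis
        using power_mono[OF le[OF g], of 2] by (simp add: q_def flip: power2_norm_eq_inner)
    qed
  qed (auto simp: subspace_H2X H2X_cs cf_cs)
  \<comment> \<open>\<open>T\<close> and \<open>L\<close> agree on functions vanishing at 0, so
    their difference depends on the value at 0 only; complex linearity makes it a matrix.\<close>
  define C where "C x = T (cst x) - L (cst x)" for x
  have Lcs: "L (cs c f) = c *s L f" for c f by (simp add: L_def cf_cs flip: cs_mm[OF \<Phi>])
  have cst_add: "cst (x + y) = cst x + cst y" for x y :: "complex^'a"
    by (simp add: cst_def flip: mk_add[OF sq_int_const sq_int_const])
  have "Vector_Spaces.linear (*s) (*s) C"
  proof (unfold_locales)
    show "C (x + y) = C x + C y" for x y
      by (simp add: C_def cst_add T H2X_cst L_def mm_add \<Phi> cf_add)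
    show "C (r *s x) = r *s C x" for r x
      using T(2)[OF H2X_cst, of r x] Lcs[of r "cst x"] by (simp add: C_def cs_cst vec.scale_right_diff_distrib)
  qed
  then have mC: "matrix C *v x = C x" for x by (rule matrix_works)
  have "norm (Hk (stepS \<Phi> (matrix C)) a) \<le> norm (mm R a)" if a: "a \<in> H2X" for a
  proof -
    define y where "y = a - cst (cf a 0)"
    have y: "y \<in> {a \<in> H2X. cf a 0 = 0}"
      using a by (simp add: y_def H2X_diff H2X_cst cf_diff cf_cst)
    have "T a = T (y + cst (cf a 0))" by (simp add: y_def)
    also have "\<dots> = L y + T (cst (cf a 0))" using y by (simp add: T H2X_cst)
    also have "\<dots> = L a + C (cf a 0)"
      by (simp add: C_def y_def L_def mm_diff \<Phi> cf_diff)
    finally have "T a = cf (mm \<Phi> a) 0 + matrix C *v cf a 0" by (simp add: mC L_def)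
    then have "(norm (Hk (stepS \<Phi> (matrix C)) a))\<^sup>2 \<le> (norm (mm R a))\<^sup>2"
      using T(4)[OF a] by (simp add: Hk_stepS \<Phi> a q_def flip: power2_norm_eq_inner)
    then show ?thesis by (rule power2_le_imp_le) simp
  qed
  then show thesis by (rule that)
qed

text \<open>The exceptional null set may depend on \<open>x\<close>. A countable dense set of
  vectors has a common one, and for fixed \<open>\<theta>\<close> the vectors violating the
  inequality form an open set that would meet it.\<close>

lemma AE_all_vectors:
  fixes A B :: "real \<Rightarrow> complex^'n^'n"
  assumes "\<And>x. AE \<theta> in circ. norm (A \<theta> *v x) \<le> norm (B \<theta> *v x)"
  shows "AE \<theta> in circ. \<forall>x. norm (A \<theta> *v x) \<le> norm (B \<theta> *v x)"
proof -
  obtain D :: "(complex^'n) set" where D: "countable D" "\<And>X. open X \<Longrightarrow> X \<noteq> {} \<Longrightarrow> \<exists>d\<in>D. d \<in> X"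
    using countable_dense_setE by blast
  have "AE \<theta> in circ. \<forall>x\<in>D. norm (A \<theta> *v x) \<le> norm (B \<theta> *v x)"
    using D(1) assms by (subst AE_ball_countable) auto
  then show ?thesis
  proof eventually_elim
    case (elim \<theta>)
    let ?U = "{x. norm (B \<theta> *v x) < norm (A \<theta> *v x)}"
    have "open ?U"
      by (intro open_Collect_less continuous_intros linear_continuous_on bounded_linear_matrix_vector)
    then have "?U = {}" using D(2)[of ?U] elim by fastforce
    then show ?case by (auto simp: not_less)
  qed
qed

lemma Linf_trigpoly: "trigpoly \<phi> \<Longrightarrow> Linf (\<lambda>\<theta>. mat (\<phi> \<theta>) :: complex^'n^'n)"
  using trigpoly_bounded[of \<phi>] by (auto intro: Linf_mat trigpoly_measurable)

lemma norm_mm_trigpoly: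
  assumes "trigpoly \<phi>"
  shows "(norm (mm (\<lambda>\<theta>. mat (\<phi> \<theta>)) a))\<^sup>2 = (\<integral>\<theta>. (cmod (\<phi> \<theta>))\<^sup>2 * (norm (rep a \<theta>))\<^sup>2 \<partial>circ) / (2*pi)"
  unfolding mm_def norm_mk[OF sq_int_matrix[OF Linf_trigpoly[OF assms] sq_int_rep]]
  by (simp add: mat_mult_vec norm_smult_vec power_mult_distrib)

lemma integrable_trigpoly_norm:
  assumes "trigpoly \<phi>"
  shows "integrable circ (\<lambda>\<theta>. (cmod (\<phi> \<theta>))\<^sup>2 * (norm (rep a \<theta>))\<^sup>2)"
  using sq_int_matrix[OF Linf_trigpoly[OF assms] sq_int_rep[of a]]
  by (simp add: sq_int_def mat_mult_vec norm_smult_vec power_mult_distrib)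

lemma mm_trigpoly_monom: "mm (\<lambda>\<theta>. mat (c * cis (of_int k * \<theta>))) a = cs c (sh k a)"
  by (simp add: cs_def sh_def mm_mult Linf_const Linf_cis mat_mat_mult)

lemma mat_add: "mat (c + d) = mat c + (mat d :: complex^'n^'n)"
  by (simp add: mat_def vec_eq_iff)

text \<open>Commutation with the shift extends the norm inequality from constants to trigonometric
  polynomials times constants, and \<open>AE_nonneg_of_trigpoly\<close> makes it pointwise. The
  images of the basis constants then form a bounded matrix function.\<close>

lemma shift_intertwiner_symbol:
  fixes G :: "'n::finite L2 \<Rightarrow> 'n L2"
  assumes R: "Linf R"
    and add: "\<And>f g. f \<in> H2X \<Longrightarrow> g \<in> H2X \<Longrightarrow> G (f + g) = G f + G g"
    and cs: "\<And>c f. f \<in> H2X \<Longrightarrow> G (cs c f) = cs c (G f)"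
    and sh: "\<And>f. f \<in> H2X \<Longrightarrow> G (sh 1 f) = sh 1 (G f)"
    and le: "\<And>f. f \<in> H2X \<Longrightarrow> norm (G f) \<le> norm (mm R f)"
  obtains M where "Linf M" "AE \<theta> in circ. \<forall>x. norm (M \<theta> *v x) \<le> norm (R \<theta> *v x)"
    "\<And>x. mm M (cst x) = G (cst x)"
proof -
  have shn: "G (sh (int n) f) = sh (int n) (G f)" if "f \<in> H2X" for n f
  proof (induction n)
    case (Suc n)
    have "G (sh (int (Suc n)) f) = G (sh 1 (sh (int n) f))" by (simp add: sh_sh)
    also have "\<dots> = sh 1 (sh (int n) (G f))" using that by (simp add: sh H2X_sh Suc)
    finally show ?case by (simp add: sh_sh)
  qed simp
  \<comment> \<open>A trigonometric polynomial times a constant is not analytic, but becomes so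
    after multiplication by a high power of \<zeta>, where \<open>G\<close> is controlled; the power
    does not change norms. All large \<open>N\<close> are kept so that two summands can share
    one.\<close>
  have tp: "\<exists>N0. \<forall>N\<ge>N0. sh (int N) (mm (\<lambda>\<theta>. mat (\<phi> \<theta>)) (cst x)) \<in> H2X \<and>
      G (sh (int N) (mm (\<lambda>\<theta>. mat (\<phi> \<theta>)) (cst x))) = sh (int N) (mm (\<lambda>\<theta>. mat (\<phi> \<theta>)) (G (cst x)))"
    if "trigpoly \<phi>" for \<phi> x
    using that
  proof (induction rule: trigpoly.induct)
    case (monom c k)
    show ?case
    proof (intro exI[of _ "nat \<bar>k\<bar>"] allI impI)
      fix N assume "N \<ge> nat \<bar>k\<bar>"
      then have "int N + k \<ge> 0" by linarith
      then obtain m where m: "int N + k = int m" by (rule nonneg_int_cases)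
      have e: "sh (int N) (mm (\<lambda>\<theta>. mat (c * cis (of_int k * \<theta>))) a) = cs c (sh (int m) a)" for a :: "'n L2"
        by (simp add: mm_trigpoly_monom sh_sh m flip: cs_sh)
      show "sh (int N) (mm (\<lambda>\<theta>. mat (c * cis (real_of_int k * \<theta>))) (cst x)) \<in> H2X \<and>
        G (sh (int N) (mm (\<lambda>\<theta>. mat (c * cis (real_of_int k * \<theta>))) (cst x))) =
        sh (int N) (mm (\<lambda>\<theta>. mat (c * cis (real_of_int k * \<theta>))) (G (cst x)))"
        unfolding e by (simp add: cs shn H2X_sh H2X_cs H2X_cst)
    qed
  next
    case (add \<phi> \<psi>)
    then obtain N1 N2 where
      N1: "\<And>N. N \<ge> N1 \<Longrightarrow> sh (int N) (mm (\<lambda>\<theta>. mat (\<phi> \<theta>)) (cst x)) \<in> H2X \<and>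
      G (sh (int N) (mm (\<lambda>\<theta>. mat (\<phi> \<theta>)) (cst x))) = sh (int N) (mm (\<lambda>\<theta>. mat (\<phi> \<theta>)) (G (cst x)))" and
      N2: "\<And>N. N \<ge> N2 \<Longrightarrow> sh (int N) (mm (\<lambda>\<theta>. mat (\<psi> \<theta>)) (cst x)) \<in> H2X \<and>
      G (sh (int N) (mm (\<lambda>\<theta>. mat (\<psi> \<theta>)) (cst x))) = sh (int N) (mm (\<lambda>\<theta>. mat (\<psi> \<theta>)) (G (cst x)))"
      by blast
    have e: "mm (\<lambda>\<theta>. mat (\<phi> \<theta> + \<psi> \<theta>)) a = mm (\<lambda>\<theta>. mat (\<phi> \<theta>)) a + mm (\<lambda>\<theta>. mat (\<psi> \<theta>)) a" for a :: "'n L2"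
      unfolding mat_add by (intro mm_add_left Linf_trigpoly add.hyps)
    show ?case
      using N1 N2 by (intro exI[of _ "max N1 N2"]) (simp add: e sh_add H2X_add assms(2))
  qed
  have norm_le: "norm (mm (\<lambda>\<theta>. mat (\<phi> \<theta>)) (G (cst x))) \<le> norm (mm (\<lambda>\<theta>. mat (\<phi> \<theta>)) (mm R (cst x)))"
    if t: "trigpoly \<phi>" for \<phi> x
  proof -
    obtain N where N: "sh (int N) (mm (\<lambda>\<theta>. mat (\<phi> \<theta>)) (cst x)) \<in> H2X"
      "G (sh (int N) (mm (\<lambda>\<theta>. mat (\<phi> \<theta>)) (cst x))) = sh (int N) (mm (\<lambda>\<theta>. mat (\<phi> \<theta>)) (G (cst x)))"
      using tp[OF t, of x] by blast
    have "norm (mm (\<lambda>\<theta>. mat (\<phi> \<theta>)) (G (cst x))) \<le> norm (mm R (sh (int N) (mm (\<lambda>\<theta>. mat (\<phi> \<theta>)) (cst x))))"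
      using le[OF N(1)] by (simp add: N(2))
    also have "mm R (sh (int N) (mm (\<lambda>\<theta>. mat (\<phi> \<theta>)) (cst x))) = sh (int N) (mm (\<lambda>\<theta>. mat (\<phi> \<theta>)) (mm R (cst x)))"
      by (simp add: mm_mult R Linf_trigpoly t mat_mult_commute flip: sh_mm[OF R])
    finally show ?thesis by simp
  qed
  have pw: "AE \<theta> in circ. norm (rep (G (cst x)) \<theta>) \<le> norm (R \<theta> *v x)" for x
  proof -
    let ?u = "rep (mm R (cst x))" and ?v = "rep (G (cst x))"
    have "AE \<theta> in circ. 0 \<le> (norm (?u \<theta>))\<^sup>2 - (norm (?v \<theta>))\<^sup>2"
    proof (rule AE_nonneg_of_trigpoly)
      show "integrable circ (\<lambda>\<theta>. (norm (?u \<theta>))\<^sup>2 - (norm (?v \<theta>))\<^sup>2)"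
        using sq_int_rep unfolding sq_int_def by (intro Bochner_Integration.integrable_diff) blast+
      fix \<phi> assume t: "trigpoly \<phi>"
      have "(\<integral>\<theta>. (cmod (\<phi> \<theta>))\<^sup>2 * ((norm (?u \<theta>))\<^sup>2 - (norm (?v \<theta>))\<^sup>2) \<partial>circ)
        = (\<integral>\<theta>. (cmod (\<phi> \<theta>))\<^sup>2 * (norm (?u \<theta>))\<^sup>2 \<partial>circ) - (\<integral>\<theta>. (cmod (\<phi> \<theta>))\<^sup>2 * (norm (?v \<theta>))\<^sup>2 \<partial>circ)"
        by (simp add: right_diff_distrib integrable_trigpoly_norm[OF t])
      also have "\<dots> = 2 * pi * ((norm (mm (\<lambda>\<theta>. mat (\<phi> \<theta>)) (mm R (cst x))))\<^sup>2 - (norm (mm (\<lambda>\<theta>. mat (\<phi> \<theta>)) (G (cst x))))\<^sup>2)"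
        by (simp add: norm_mm_trigpoly[OF t] right_diff_distrib)
      also have "\<dots> \<ge> 0" using norm_le[OF t, of x] by (simp add: power_mono)
      finally show "0 \<le> (\<integral>\<theta>. (cmod (\<phi> \<theta>))\<^sup>2 * ((norm (?u \<theta>))\<^sup>2 - (norm (?v \<theta>))\<^sup>2) \<partial>circ)" .
    qed
    moreover have "AE \<theta> in circ. ?u \<theta> = R \<theta> *v x"
      using rep_mk[OF sq_int_matrix[OF R sq_int_const], of x] by (simp add: cst_def mm_mk sq_int_const)
    ultimately show ?thesis
      by eventually_elim (auto intro: power2_le_imp_le)
  qed
  \<comment> \<open>Column \<open>j\<close> is the image under \<open>G\<close> of the constant
    basis vector \<open>axis j 1\<close>.\<close>
  define M where "M \<theta> = (\<chi> i j. rep (G (cst (axis j 1))) \<theta> $ i)" for \<theta>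
  have Mm: "M \<in> borel_measurable circ"
    unfolding M_def using sq_int_rep by (intro measurable_vec_lambda measurable_vec_nth) (auto simp: sq_int_def)
  have Mx: "AE \<theta> in circ. rep (G (cst x)) \<theta> = M \<theta> *v x" for x
  proof -
    have cst_add: "cst (x + y) = cst x + cst y" for x y :: "complex^'n"
      by (simp add: cst_def flip: mk_add[OF sq_int_const sq_int_const])
    have "cst (\<Sum>j\<in>S. x $ j *s axis j 1) \<in> H2X \<and>
        (AE \<theta> in circ. rep (G (cst (\<Sum>j\<in>S. x $ j *s axis j 1))) \<theta> = (\<Sum>j\<in>S. x $ j *s rep (G (cst (axis j 1))) \<theta>))"
      if "finite S" for S :: "'n set"
      using that
    proof (induction S rule: finite_induct)
      case empty
      have "cst 0 = (0 :: 'n L2)" by (simp add: cst_def zero_L2_def)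
      moreover have "G 0 = 0" using add[of 0 0] by (simp add: H2X_zero)
      ultimately show ?case using rep_zero by (simp add: H2X_zero)
    next
      case (insert j S)
      let ?w = "\<Sum>j\<in>S. x $ j *s axis j 1"
      have e: "cst (\<Sum>j\<in>insert j S. x $ j *s axis j 1) = cs (x $ j) (cst (axis j 1)) + cst ?w"
        using insert by (simp add: cst_add cs_cst)
      have Ge: "G (cst (\<Sum>j\<in>insert j S. x $ j *s axis j 1)) = cs (x $ j) (G (cst (axis j 1))) + G (cst ?w)"
        unfolding e using insert by (simp add: add cs H2X_cs H2X_cst)
      have "AE \<theta> in circ. rep (cs (x $ j) (G (cst (axis j 1)))) \<theta> = x $ j *s rep (G (cst (axis j 1))) \<theta>"
        using rep_mm[OF Linf_const[of "mat (x $ j)"], of "G (cst (axis j 1))"] by (simp add: cs_def mat_mult_vec)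
      moreover have "AE \<theta> in circ. rep (G (cst ?w)) \<theta> = (\<Sum>j\<in>S. x $ j *s rep (G (cst (axis j 1))) \<theta>)"
        using insert.IH by blast
      ultimately have "AE \<theta> in circ. rep (G (cst (\<Sum>j\<in>insert j S. x $ j *s axis j 1))) \<theta>
          = (\<Sum>j\<in>insert j S. x $ j *s rep (G (cst (axis j 1))) \<theta>)"
        unfolding Ge using rep_add[of "cs (x $ j) (G (cst (axis j 1)))" "G (cst ?w)"]
        by eventually_elim (use insert.hyps in simp)
      then show ?case by (simp add: H2X_cst)
    qed
    from this[of UNIV] have "AE \<theta> in circ. rep (G (cst x)) \<theta> = (\<Sum>j\<in>UNIV. x $ j *s rep (G (cst (axis j 1))) \<theta>)"
      by (simp add: basis_expansion)
    then show ?thesis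
      by eventually_elim (simp add: M_def matrix_vector_mult_def vec_eq_iff mult.commute)
  qed
  have "AE \<theta> in circ. norm (M \<theta> *v x) \<le> norm (R \<theta> *v x)" for x
    using pw[of x] Mx[of x] by eventually_elim simp
  then have le': "AE \<theta> in circ. \<forall>x. norm (M \<theta> *v x) \<le> norm (R \<theta> *v x)" by (rule AE_all_vectors)
  obtain B where B: "B \<ge> 0" "AE \<theta> in circ. \<forall>x. norm (R \<theta> *v x) \<le> B * norm x"
    using R by (rule LinfE)
  have LM: "Linf M"
    by (rule LinfI[OF Mm, of B], use le' B(2) in eventually_elim) (meson order_trans)
  have "mm M (cst x) = G (cst x)" for x
    by (rule L2_eqI, use Mx[of x] rep_mk[OF sq_int_matrix[OF LM sq_int_const], of x] in eventually_elim)
      (simp add: cst_def mm_mk sq_int_const)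
  then show thesis using that[OF LM le'] by blast
qed

text \<open>Each \<open>parrott_step\<close> fixes one more Taylor coefficient of the analytic
  correction without losing the bound. Once fixed, a coefficient is never touched again, so the
  products with any \<open>f\<close> stabilise coefficientwise. The limit operator commutes with the
  shift and is a multiplication.\<close>

theorem weighted_nehari:
  fixes \<Phi> R :: "real \<Rightarrow> complex^'n^'n"
  assumes \<Phi>: "Linf \<Phi>" and R: "Linf R"
    and le: "\<And>a. a \<in> H2X \<Longrightarrow> norm (Hk \<Phi> a) \<le> norm (mm R a)"
  obtains G where "Linf G" "Hinf (\<lambda>\<theta>. \<Phi> \<theta> - G \<theta>)"
    "AE \<theta> in circ. \<forall>x. norm (G \<theta> *v x) \<le> norm (R \<theta> *v x)"
proof -
  \<comment> \<open>The clause for \<open>n = 0\<close> pins the start of the sequence, which the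
    choice principle would otherwise leave open.\<close>
  have "\<exists>F. \<forall>n. (Linf (F n) \<and> (\<forall>a\<in>H2X. norm (Hk (F n) a) \<le> norm (mm R a)) \<and> (n = 0 \<longrightarrow> F n = \<Phi>)) \<and>
      (\<exists>c. F (Suc n) = stepS (F n) c)"
  proof (rule dependent_nat_choice)
    show "\<exists>F. Linf F \<and> (\<forall>a\<in>H2X. norm (Hk F a) \<le> norm (mm R a)) \<and> (0 = (0::nat) \<longrightarrow> F = \<Phi>)"
      using \<Phi> le by blast
    fix F :: "real \<Rightarrow> complex^'n^'n" and n :: nat
    assume F: "Linf F \<and> (\<forall>a\<in>H2X. norm (Hk F a) \<le> norm (mm R a)) \<and> (n = 0 \<longrightarrow> F = \<Phi>)"
    then obtain c where "\<And>a. a \<in> H2X \<Longrightarrow> norm (Hk (stepS F c) a) \<le> norm (mm R a)"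
      using parrott_step[OF _ R, of F] by blast
    then show "\<exists>F'. (Linf F' \<and> (\<forall>a\<in>H2X. norm (Hk F' a) \<le> norm (mm R a)) \<and> (Suc n = 0 \<longrightarrow> F' = \<Phi>)) \<and> (\<exists>c. F' = stepS F c)"
      using F Linf_stepS by blast
  qed
  then obtain F c where F: "\<And>n. Linf (F n)" "\<And>n a. a \<in> H2X \<Longrightarrow> norm (Hk (F n) a) \<le> norm (mm R a)"
    "F 0 = \<Phi>" "\<And>n. F (Suc n) = stepS (F n) (c n)" by metis
  \<comment> \<open>Unwinding \<open>stepS\<close>, \<open>A m\<close> is multiplication by
    \<open>\<Phi>\<close> plus the matrix polynomial in \<zeta> with coefficients
    \<open>c 0\<close>, ..., \<open>c (m - 1)\<close>.\<close>
  define A where "A m f = sh (int m) (mm (F m) f)" for m f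
  have AS: "cf (A (Suc m) f) k = cf (A m f) k" if "k < int m" "f \<in> H2X" for m f k
  proof -
    have "A (Suc m) f = A m f + sh (int m) (mm (\<lambda>_. c m) f)"
      by (simp add: A_def F mm_stepS sh_add sh_sh)
    then show ?thesis using that by (simp add: cf_add cf_sh cf_mm_const H2X_def)
  qed
  \<comment> \<open>\<open>nat (k + 1)\<close> is the first \<open>m\<close> with
    \<open>k < int m\<close>, the stage from which the coefficient of index \<open>k\<close> no
    longer changes.\<close>
  define al where "al f k = cf (A (nat (k + 1)) f) k" for f k
  have al: "cf (A m f) k = al f k" if "k < int m" "f \<in> H2X" for m f k
  proof -
    have "nat (k + 1) \<le> m" using that by simp
    then show ?thesis unfolding al_def
    proof (induction m rule: dec_induct)
      case (step n)
      have "k < int n" using step.hyps by linarith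
      then show ?case using AS[of k n f] step.IH that by simp
    qed simp
  qed
  \<comment> \<open>Up to index \<open>N\<close> these are coefficients of the shifted Hankel image
    at stage \<open>N + 1\<close>, so Bessel's inequality and the preserved bound control them
    uniformly in \<open>N\<close>.\<close>
  have bd: "(\<Sum>k\<in>{- int N..int N}. (norm (al f k))\<^sup>2) \<le> (norm (mm R f))\<^sup>2" if f: "f \<in> H2X" for f N
  proof -
    let ?h = "sh (int (Suc N)) (Hk (F (Suc N)) f)"
    have "(\<Sum>k\<in>{- int N..int N}. (norm (al f k))\<^sup>2) = (\<Sum>k\<in>{- int N..int N}. (norm (cf ?h k))\<^sup>2)"
    proof (rule sum.cong)
      fix k assume "k \<in> {- int N..int N}"
      then have k: "k < int (Suc N)" by simp
      have "al f k = cf ?h k"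
        using k by (simp add: al[OF k f, symmetric] A_def Hk_def cf_sh cf_Pm)
      then show "(norm (al f k))\<^sup>2 = (norm (cf ?h k))\<^sup>2" by simp
    qed simp
    also have "\<dots> \<le> (norm ?h)\<^sup>2" by (rule bessel)
    also have "\<dots> \<le> (norm (mm R f))\<^sup>2" using F(2)[OF f] by (simp add: power_mono)
    finally show ?thesis .
  qed
  have "\<exists>g. \<forall>k. cf g k = al f k" if f: "f \<in> H2X" for f
  proof -
    obtain g where "psum (al f) \<longlonglongrightarrow> g" "\<And>k. cf g k = al f k"
      by (rule riesz_fischer[OF bd[OF f]]; rule that; assumption)
    then show ?thesis by blast
  qed
  then obtain G where G: "\<And>f k. f \<in> H2X \<Longrightarrow> cf (G f) k = al f k" by metis
  note alm = al[symmetric]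
  have Gadd: "G (f + g) = G f + G g" if "f \<in> H2X" "g \<in> H2X" for f g
  proof (rule L2_coef_eqI)
    fix k
    have "k < int (nat (k + 1))" by simp
    note a = alm[OF this]
    show "cf (G (f + g)) k = cf (G f + G g) k"
      using that by (simp add: G H2X_add cf_add a) (simp add: A_def mm_add F sh_add cf_add)
  qed
  have Gcs: "G (cs d f) = cs d (G f)" if "f \<in> H2X" for f d
  proof (rule L2_coef_eqI)
    fix k
    have "k < int (nat (k + 1))" by simp
    note a = alm[OF this]
    show "cf (G (cs d f)) k = cf (cs d (G f)) k"
      using that by (simp add: G H2X_cs cf_cs a) (simp add: A_def F cf_cs flip: cs_mm cs_sh)
  qed
  have Gsh: "G (sh 1 f) = sh 1 (G f)" if "f \<in> H2X" for f
  proof (rule L2_coef_eqI)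
    fix k
    have a: "k < int (nat (k + 1))" "k - 1 < int (nat (k + 1))" by simp_all
    have "sh (int m) (sh 1 b) = sh 1 (sh (int m) b)" for m and b :: "'n L2" by (simp add: sh_sh add.commute)
    then show "cf (G (sh 1 f)) k = cf (sh 1 (G f)) k"
      using that by (simp add: G H2X_sh alm[OF a(1)] cf_sh alm[OF a(2)]) (simp add: A_def F cf_sh flip: sh_mm)
  qed
  have Gle: "norm (G f) \<le> norm (mm R f)" if "f \<in> H2X" for f
    using norm_le_coefs[of "G f" "(norm (mm R f))\<^sup>2"] bd[OF that] that by (intro power2_le_imp_le[of "norm (G f)"]) (auto simp: G)
  obtain M where M: "Linf M" "AE \<theta> in circ. \<forall>x. norm (M \<theta> *v x) \<le> norm (R \<theta> *v x)"
    "\<And>x. mm M (cst x) = G (cst x)"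
    using shift_intertwiner_symbol[OF R Gadd Gcs Gsh Gle] by blast
  have "Hinf (\<lambda>\<theta>. \<Phi> \<theta> - M \<theta>)"
    unfolding Hinf_iff
  proof (intro conjI allI Linf_diff \<Phi> M(1))
    fix x
    have "cf (G (cst x)) k = cf (mm \<Phi> (cst x)) k" if "k < 0" for k
      using that alm[of k 0 "cst x"] by (simp add: G H2X_cst A_def F)
    then show "mm (\<lambda>\<theta>. \<Phi> \<theta> - M \<theta>) (cst x) \<in> H2X"
      by (simp add: mm_diff_left \<Phi> M H2X_def cf_diff)
  qed
  with M show thesis by (intro that[of M]) auto
qed

section \<open>Contractive interpolants and extremal functions\<close>

text \<open>Near-minimisers of the distance are nearly orthogonal to the subspace, which makes them
  a Cauchy sequence. Used for closed subspaces of \<open>L2\<close> as well as in finite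
  dimension.\<close>

lemma closed_subspace_projection:
  fixes S :: "'a::{real_inner,complete_space} set"
  assumes S: "subspace S" "closed S"
  obtains p where "p \<in> S" "\<And>s. s \<in> S \<Longrightarrow> (x - p) \<bullet> s = 0"
proof -
  define \<iota> where "\<iota> = (INF y\<in>S. (norm (x - y))\<^sup>2)"
  have bdd: "bdd_below ((\<lambda>y. (norm (x - y))\<^sup>2) ` S)" by (rule bdd_belowI[of _ 0]) auto
  have ne: "(\<lambda>y. (norm (x - y))\<^sup>2) ` S \<noteq> {}" using subspace_0[OF S(1)] by blast
  have "\<exists>y\<in>S. (norm (x - y))\<^sup>2 < \<iota> + (1 / real (Suc k))\<^sup>2" for k
    using cInf_lessD[OF ne, of "\<iota> + (1 / real (Suc k))\<^sup>2"] unfolding \<iota>_def by auto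
  then obtain y where y: "\<And>k. y k \<in> S" "\<And>k. (norm (x - y k))\<^sup>2 < \<iota> + (1 / real (Suc k))\<^sup>2" by metis
  have or: "\<bar>(x - y k) \<bullet> z\<bar> \<le> 1 / real (Suc k) * norm z" if z: "z \<in> S" for k z
  proof -
    have "0 \<le> (1 / real (Suc k))\<^sup>2 + 2 * s * ((x - y k) \<bullet> z) + s\<^sup>2 * (z \<bullet> z)" for s
    proof -
      have "y k - s *\<^sub>R z \<in> S" using y z S(1) by (simp add: subspace_diff subspace_mul)
      then have "\<iota> \<le> (norm (x - (y k - s *\<^sub>R z)))\<^sup>2"
        unfolding \<iota>_def by (intro cINF_lower bdd)
      also have "x - (y k - s *\<^sub>R z) = (x - y k) + s *\<^sub>R z" by simp
      also have "(norm ((x - y k) + s *\<^sub>R z))\<^sup>2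
        = (norm (x - y k))\<^sup>2 + 2 * s * ((x - y k) \<bullet> z) + s\<^sup>2 * (z \<bullet> z)"
        unfolding power2_norm_eq_inner
        by (simp only: inner_add inner_scaleR_left inner_scaleR_right inner_commute[of z "x - y k"])
          (simp add: power2_eq_square distrib_left)
      finally show ?thesis using y(2)[of k] by simp
    qed
    from semi_inner_cauchy[OF this] show ?thesis by (simp del: of_nat_Suc flip: norm_eq_sqrt_inner)
  qed
  have "Cauchy y"
  proof (rule metric_CauchyI)
    fix e :: real assume e: "e > 0"
    then obtain N where N: "1 / real (Suc N) < e / 2" using nat_approx_posE[of "e/2"] by auto
    have "dist (y m) (y n) < e" if "m \<ge> N" "n \<ge> N" for m n
    proof -
      let ?d = "y m - y n"
      have d: "?d \<in> S" using y S(1) by (simp add: subspace_diff)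
      have "norm ?d * norm ?d = (x - y n) \<bullet> ?d - (x - y m) \<bullet> ?d"
        by (simp flip: power2_eq_square add: power2_norm_eq_inner inner_diff_left)
      also have "\<dots> \<le> 1 / real (Suc n) * norm ?d + 1 / real (Suc m) * norm ?d"
        using or[OF d, of n] or[OF d, of m] by linarith
      also have "\<dots> \<le> 1 / real (Suc N) * norm ?d + 1 / real (Suc N) * norm ?d"
        using that by (intro add_mono mult_right_mono divide_left_mono) auto
      finally have "norm ?d * norm ?d \<le> (2 / real (Suc N)) * norm ?d" by simp
      then have "norm ?d \<le> 2 / real (Suc N)"
        by (cases "?d = 0") (simp del: of_nat_Suc, metis mult_right_le_imp_le zero_less_norm_iff)
      then show ?thesis using N by (simp add: dist_norm)
    qed
    then show "\<exists>M. \<forall>m\<ge>M. \<forall>n\<ge>M. dist (y m) (y n) < e" by blast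
  qed
  then obtain p where p: "y \<longlonglongrightarrow> p" using Cauchy_convergent convergent_def by blast
  show thesis
  proof (rule that)
    show "p \<in> S" by (rule closed_sequentially[OF S(2) y(1) p])
    fix z assume z: "z \<in> S"
    have l: "(\<lambda>k. 1 / real (Suc k) * norm z) \<longlonglongrightarrow> 0"
      by (rule tendsto_mult_left_zero[OF LIMSEQ_Suc[OF lim_1_over_n]])
    have "(\<lambda>k. (x - y k) \<bullet> z) \<longlonglongrightarrow> 0"
      by (rule Lim_null_comparison[OF _ l]) (use or[OF z] in \<open>simp del: of_nat_Suc\<close>)
    moreover have "(\<lambda>k. (x - y k) \<bullet> z) \<longlonglongrightarrow> (x - p) \<bullet> z" by (intro tendsto_intros p)
    ultimately show "(x - p) \<bullet> z = 0" by (rule LIMSEQ_unique[symmetric])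
  qed
qed

section \<open>Hermitian products and matrix functions that annihilate many analytic
  functions\<close>

definition cip :: "complex^'n \<Rightarrow> complex^'n \<Rightarrow> complex" where
  "cip x y = (\<Sum>i\<in>UNIV. x $ i * cnj (y $ i))"

lemma cip_add_left: "cip (x + y) z = cip x z + cip y z"
  by (simp add: cip_def distrib_right sum.distrib)

lemma cip_smult_left: "cip (c *s x) z = c * cip x z"
  by (simp add: cip_def sum_distrib_left mult_ac)

lemma cip_smult_right: "cip x (c *s z) = cnj c * cip x z"
  by (simp add: cip_def sum_distrib_left mult_ac)

lemma cip_cnj: "cnj (cip x y) = cip y x"
  by (simp add: cip_def mult.commute)

lemma Re_cip: "Re (cip x y) = x \<bullet> y"
  by (simp add: cip_def inner_vec_complex)

lemma cip_sum_left: "cip (sum f A) z = (\<Sum>a\<in>A. cip (f a) z)"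
  by (induction A rule: infinite_finite_induct) (simp_all add: cip_add_left, simp_all add: cip_def)

lemma cip_sum_right: "cip z (sum f A) = (\<Sum>a\<in>A. cip z (f a))"
  using arg_cong[OF cip_sum_left[of f A z], of cnj] by (simp add: cip_cnj)

lemma integrable_cip:
  assumes "sq_int f" "sq_int g" shows "integrable circ (\<lambda>\<theta>. cip (f \<theta>) (g \<theta>))"
proof -
  have e: "cip x y = complex_of_real (x \<bullet> y) + \<i> * complex_of_real (((-\<i>) *s x) \<bullet> y)" for x y :: "complex^'n"
    unfolding Re_cip[symmetric] cip_smult_left by (simp add: complex_eq_iff)
  have sq: "sq_int (\<lambda>\<theta>. (-\<i>) *s f \<theta>)"
    using sq_int_matrix[OF Linf_const[of "mat (-\<i>)"] assms(1)] by (simp add: mat_mult_vec)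
  show ?thesis
    unfolding e by (intro Bochner_Integration.integrable_add integrable_mult_right integrable_of_real integrable_inner assms sq)
qed

lemma integrable_cis_mult:
  assumes "integrable circ (f :: real \<Rightarrow> complex)" shows "integrable circ (\<lambda>\<theta>. f \<theta> * cis (of_int k * \<theta>))"
proof (rule Bochner_Integration.integrable_bound[OF assms])
  have [measurable]: "f \<in> borel_measurable circ" "(\<lambda>\<theta>. cis (of_int k * \<theta>)) \<in> borel_measurable circ"
    using assms by (auto intro!: borel_measurable_circ borel_measurable_continuous_onI continuous_intros)
  show "(\<lambda>\<theta>. f \<theta> * cis (of_int k * \<theta>)) \<in> borel_measurable circ" by measurable
qed (simp add: norm_mult)

text \<open>Letting \<open>c\<close> be 1 and -\<i> recovers a complex Fourier coefficient of the
  pointwise Hermitian product from the real inner product of \<open>L2\<close>.\<close>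

lemma inner_sh_cs:
  "sh k (cs c a) \<bullet> b = Re (c * (\<integral>\<theta>. cip (rep a \<theta>) (rep b \<theta>) * cis (of_int k * \<theta>) \<partial>circ)) / (2*pi)"
proof -
  have L: "Linf (\<lambda>\<theta>. mat (cis (of_int k * \<theta>) * c) :: complex^'n^'n)"
    using Linf_mult[OF Linf_cis Linf_const, of k "mat c"] by (simp add: mat_mat_mult)
  have e: "sh k (cs c a) = mk (\<lambda>\<theta>. (cis (of_int k * \<theta>) * c) *s rep a \<theta>)"
    unfolding sh_def cs_def mm_mult[OF Linf_cis Linf_const] by (simp only: mat_mat_mult mm_def mat_mult_vec)
  have sq: "sq_int (\<lambda>\<theta>. (cis (of_int k * \<theta>) * c) *s rep a \<theta>)"
    using sq_int_matrix[OF L sq_int_rep[of a]] by (simp add: mat_mult_vec)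
  have i: "integrable circ (\<lambda>\<theta>. cip (rep a \<theta>) (rep b \<theta>) * cis (of_int k * \<theta>))"
    by (intro integrable_cis_mult integrable_cip sq_int_rep)
  have "sh k (cs c a) \<bullet> b = (\<integral>\<theta>. ((cis (of_int k * \<theta>) * c) *s rep a \<theta>) \<bullet> rep b \<theta> \<partial>circ) / (2*pi)"
    using inner_mk[OF sq sq_int_rep[of b]] by (simp add: e mk_rep)
  also have "(\<integral>\<theta>. ((cis (of_int k * \<theta>) * c) *s rep a \<theta>) \<bullet> rep b \<theta> \<partial>circ)
    = (\<integral>\<theta>. Re (c * (cip (rep a \<theta>) (rep b \<theta>) * cis (of_int k * \<theta>))) \<partial>circ)"
    by (intro Bochner_Integration.integral_cong refl) (simp only: Re_cip[symmetric] cip_smult_left mult_ac)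
  also have "\<dots> = Re (\<integral>\<theta>. c * (cip (rep a \<theta>) (rep b \<theta>) * cis (of_int k * \<theta>)) \<partial>circ)"
    by (intro integral_Re integrable_mult_right i)
  finally show ?thesis by simp
qed

text \<open>The projections \<open>k i\<close> of the constants onto the shift-invariant space \<open>ker D\<close> are orthogonal to
  all shifts of that space, so their pointwise Gram matrix has a single Fourier coefficient and is constant.\<close>

lemma analytic_kernel_zero:
  fixes D :: "real \<Rightarrow> complex^'n^'n"
  assumes D: "Linf D" and ex: "\<And>x. \<exists>f\<in>H2X. cf f 0 = x \<and> mm D f = 0"
  shows "AE \<theta> in circ. D \<theta> = 0"
proof -
  define M where "M = {f \<in> H2X. mm D f = 0}"
  have sM: "subspace M"
    by (auto simp: M_def subspace_def H2X_zero H2X_add H2X_scaleR mm_zero mm_add mm_scaleR D)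
  have cM: "closed M"
  proof -
    have "M = H2X \<inter> mm D -` {0}" by (auto simp: M_def)
    then show ?thesis
      by (simp add: closed_Int closed_H2X closed_vimage linear_continuous_on bounded_linear_mm D)
  qed
  have Mcs: "cs c f \<in> M" if "f \<in> M" for c f
    using that linear_0[OF linear_cs] by (simp add: M_def H2X_cs flip: cs_mm[OF D])
  have Msh: "sh l f \<in> M" if "f \<in> M" "l \<ge> 0" for l f
    using that by (simp add: M_def H2X_sh sh_zero flip: sh_mm[OF D])
  have "\<exists>k. k \<in> M \<and> (\<forall>f\<in>M. (cst (axis i 1) - k) \<bullet> f = 0)" for i
    using closed_subspace_projection[OF sM cM, of "cst (axis i 1)"] by metis
  then obtain k where kM: "\<And>i. k i \<in> M" and kp: "\<And>i f. f \<in> M \<Longrightarrow> (cst (axis i 1) - k i) \<bullet> f = 0" by metis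
  \<comment> \<open>\<open>k i\<close> is a reproducing kernel of the subspace at the origin:
    pairing with it evaluates the real part of component \<open>i\<close> at 0.\<close>
  have rp: "f \<bullet> k i = cf f 0 \<bullet> axis i 1" if "f \<in> M" for f i
    using kp[OF that, of i] by (simp add: cf_inner inner_diff_left inner_commute[of f])
  define g where "g i j \<theta> = cip (rep (k i) \<theta>) (rep (k j) \<theta>)" for i j \<theta>
  have gi: "integrable circ (g i j)" for i j unfolding g_def by (intro integrable_cip sq_int_rep)
  \<comment> \<open>A proper shift of \<open>k i\<close> stays in the subspace and vanishes at 0, so
    it is orthogonal to every kernel. Negative indices follow by conjugate symmetry of
    \<open>g\<close>.\<close>
  have g1: "(\<integral>\<theta>. g i j \<theta> * cis (of_int l * \<theta>) \<partial>circ) = 0" if "l > 0" for i j l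
  proof -
    have "Re (c * (\<integral>\<theta>. g i j \<theta> * cis (of_int l * \<theta>) \<partial>circ)) = 0" for c
    proof -
      have "sh l (cs c (k i)) \<bullet> k j = 0"
        using kM[of i] that by (subst rp) (simp_all add: Msh Mcs cf_sh cf_cs, simp add: M_def H2X_def)
      then show ?thesis unfolding inner_sh_cs g_def by simp
    qed
    from this[of 1] this[of "-\<i>"] show ?thesis by (simp add: complex_eq_iff)
  qed
  have g0: "(\<integral>\<theta>. g i j \<theta> * cis (of_int l * \<theta>) \<partial>circ) = 0" if "l \<noteq> 0" for i j l
  proof (cases "l > 0")
    case False
    have "(\<integral>\<theta>. g i j \<theta> * cis (of_int l * \<theta>) \<partial>circ) = (\<integral>\<theta>. cnj (g j i \<theta> * cis (of_int (- l) * \<theta>)) \<partial>circ)"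
      by (intro Bochner_Integration.integral_cong refl) (simp add: g_def cip_cnj cis_cnj)
    also have "\<dots> = 0" unfolding Bochner_Integration.integral_cnj using g1[of "- l" j i] False that by simp
    finally show ?thesis .
  qed (rule g1)
  define \<kappa> where "\<kappa> i j = (\<integral>\<theta>. g i j \<theta> \<partial>circ) / complex_of_real (2*pi)" for i j
  have "AE \<theta> in circ. g i j \<theta> - \<kappa> i j = 0" for i j
  proof (rule fourier_uniqueness)
    show "integrable circ (\<lambda>\<theta>. g i j \<theta> - \<kappa> i j)" using gi by simp
    fix l :: int
    have "(\<integral>\<theta>. (g i j \<theta> - \<kappa> i j) * cis (of_int l * \<theta>) \<partial>circ)
      = (\<integral>\<theta>. g i j \<theta> * cis (of_int l * \<theta>) \<partial>circ) - (\<integral>\<theta>. \<kappa> i j * cis (of_int l * \<theta>) \<partial>circ)"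
      unfolding left_diff_distrib by (intro Bochner_Integration.integral_diff integrable_cis_mult gi) simp
    also have "\<dots> = 0"
      using g0[of l i j] integral_cis_nonzero[of l]
      by (cases "l = 0") (simp_all add: \<kappa>_def measure_def emeasure_circ_space scaleR_conv_of_real)
    finally show "(\<integral>\<theta>. (g i j \<theta> - \<kappa> i j) * cis (of_int l * \<theta>) \<partial>circ) = 0" .
  qed
  then have gk: "AE \<theta> in circ. \<forall>i j. g i j \<theta> = \<kappa> i j" by (simp add: AE_all_countable)
  have dk: "AE \<theta> in circ. \<forall>i. D \<theta> *v rep (k i) \<theta> = 0"
  proof (subst AE_all_countable, rule allI)
    fix i
    have "AE \<theta> in circ. rep (mm D (k i)) \<theta> = 0" using kM[of i] rep_zero by (simp add: M_def)
    with rep_mm[OF D, of "k i"] show "AE \<theta> in circ. D \<theta> *v rep (k i) \<theta> = 0"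
      by eventually_elim simp
  qed
  \<comment> \<open>If the Gram form vanishes at \<open>c\<close>, the combination \<open>s\<close>
    of kernels is 0. Pairing it with an \<open>f\<close> in the subspace whose value at 0 is
    \<open>c\<close> gives the squared length of \<open>c\<close>; here the hypothesis on values is
    used.\<close>
  have inj: "c = 0" if c0: "(\<Sum>i\<in>UNIV. \<Sum>j\<in>UNIV. c $ i * cnj (c $ j) * \<kappa> i j) = 0" for c :: "complex^'n"
  proof -
    define s where "s = (\<Sum>i\<in>UNIV. cs (c $ i) (k i))"
    have "s \<bullet> s = (\<Sum>i\<in>UNIV. \<Sum>j\<in>UNIV. cs (c $ i) (k i) \<bullet> cs (c $ j) (k j))"
      unfolding s_def inner_sum_left inner_sum_right by (rule sum.swap)
    also have "\<dots> = (\<Sum>i\<in>UNIV. \<Sum>j\<in>UNIV. Re (c $ i * cnj (c $ j) * \<kappa> i j))"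
    proof (intro sum.cong refl)
      fix i j
      have "cs (c $ i) (k i) \<bullet> cs (c $ j) (k j) = sh 0 (cs (cnj (c $ j) * c $ i) (k i)) \<bullet> k j"
        using inner_cs[of "cnj (c $ j)" "cs (c $ i) (k i)" "k j"] by (simp add: cs_cs)
      also have "\<dots> = Re (c $ i * cnj (c $ j) * \<kappa> i j)"
        unfolding inner_sh_cs by (simp add: \<kappa>_def g_def mult.commute)
      finally show "cs (c $ i) (k i) \<bullet> cs (c $ j) (k j) = Re (c $ i * cnj (c $ j) * \<kappa> i j)" .
    qed
    also have "\<dots> = Re (\<Sum>i\<in>UNIV. \<Sum>j\<in>UNIV. c $ i * cnj (c $ j) * \<kappa> i j)" by simp
    finally have "s = 0" using c0 by simp
    obtain f where f: "f \<in> M" "cf f 0 = c" using ex[of c] by (auto simp: M_def)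
    have "0 = f \<bullet> s" by (simp add: \<open>s = 0\<close>)
    also have "\<dots> = (\<Sum>i\<in>UNIV. cf (cs (cnj (c $ i)) f) 0 \<bullet> axis i 1)"
      unfolding s_def inner_sum_right
    proof (intro sum.cong refl)
      fix i
      have "f \<bullet> cs (c $ i) (k i) = cs (cnj (c $ i)) f \<bullet> k i" by (simp add: inner_cs)
      then show "f \<bullet> cs (c $ i) (k i) = cf (cs (cnj (c $ i)) f) 0 \<bullet> axis i 1" using f by (simp add: rp Mcs)
    qed
    also have "\<dots> = (\<Sum>i\<in>UNIV. (cmod (c $ i))\<^sup>2)"
      unfolding cmod_power2
      by (intro sum.cong refl) (simp add: cf_cs f inner_axis inner_complex_def power2_eq_square)
    finally have "\<forall>i\<in>UNIV. (cmod (c $ i))\<^sup>2 = 0"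
      by (subst sum_nonneg_eq_0_iff[symmetric]) auto
    then show ?thesis by (simp add: vec_eq_iff)
  qed
  show ?thesis
    using gk dk
  proof eventually_elim
    case (elim \<theta>)
    define K :: "complex^'n^'n" where "K = (\<chi> a i. rep (k i) \<theta> $ a)"
    have Kc: "K *v c = (\<Sum>i\<in>UNIV. c $ i *s rep (k i) \<theta>)" for c
      by (simp add: K_def matrix_vector_mult_def vec_eq_iff mult.commute)
    have "c = 0" if "K *v c = 0" for c
    proof (rule inj)
      have "cip (K *v c) (K *v c) = 0" using that by (simp add: cip_def)
      then show "(\<Sum>i\<in>UNIV. \<Sum>j\<in>UNIV. c $ i * cnj (c $ j) * \<kappa> i j) = 0"
        using elim(1) by (subst sum.swap) (simp add: Kc cip_sum_left cip_sum_right cip_smult_left cip_smult_right g_def mult_ac sum_distrib_left)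
    qed
    then obtain K' where K': "K' ** K = mat 1" using matrix_left_invertible_ker[of K] by blast
    then have KK': "K ** K' = mat 1" by (simp add: matrix_left_right_inverse)
    have "D \<theta> ** K = 0"
    proof -
      have "(D \<theta> ** K) *v c = 0" for c
        using elim(2) by (simp add: matrix_vector_mul_assoc[symmetric] Kc vec.linear_sum[OF matrix_vector_mul_linear_gen] vec.linear_scale[OF matrix_vector_mul_linear_gen])
      then show ?thesis by (simp add: matrix_eq)
    qed
    then have "D \<theta> ** K ** K' = 0" by (simp add: matrix_matrix_mult_def vec_eq_iff)
    then show ?case by (simp add: KK' flip: matrix_mul_assoc)
  qed
qed

text \<open>Entrywise complex conjugation exchanges analytic and antianalytic functions and is
  compatible with matrix multiplication, so \<open>analytic_kernel_zero\<close> applies to the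
  conjugate of \<open>D\<close>.\<close>

lemma antianalytic_kernel_zero:
  fixes D :: "real \<Rightarrow> complex^'n^'n"
  assumes D: "Linf D" and ex: "\<And>x. \<exists>g. (\<forall>k>0. cf g k = 0) \<and> cf g 0 = x \<and> mm D g = 0"
  shows "AE \<theta> in circ. D \<theta> = 0"
proof -
  define cv :: "complex^'n \<Rightarrow> complex^'n" where "cv x = (\<chi> i. cnj (x $ i))" for x
  define D' where "D' \<theta> = (\<chi> i j. cnj (D \<theta> $ i $ j))" for \<theta>
  have ncv: "norm (cv x) = norm x" for x by (simp add: cv_def norm_vec_def)
  have cvcv: "cv (cv x) = x" for x by (simp add: cv_def)
  have D'v: "D' \<theta> *v x = cv (D \<theta> *v cv x)" for \<theta> x
    by (simp add: D'_def cv_def matrix_vector_mult_def vec_eq_iff)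
  have cm: "(\<lambda>z::complex. cnj z) \<in> borel_measurable borel"
    by (intro borel_measurable_continuous_onI continuous_intros)
  obtain B where B: "B \<ge> 0" "AE \<theta> in circ. \<forall>x. norm (D \<theta> *v x) \<le> B * norm x"
    using D by (rule LinfE)
  have LD': "Linf D'"
  proof (rule LinfI)
    show "D' \<in> borel_measurable circ"
      unfolding D'_def
      by (intro measurable_vec_lambda measurable_compose[OF _ cm] measurable_vec_nth Linf_measurable D)
    show "AE \<theta> in circ. \<forall>x. norm (D' \<theta> *v x) \<le> B * norm x"
      using B(2) by eventually_elim (metis D'v ncv)
  qed
  have "\<exists>f\<in>H2X. cf f 0 = x \<and> mm D' f = 0" for x
  proof -
    obtain g where g: "\<And>k. k > 0 \<Longrightarrow> cf g k = 0" "cf g 0 = cv x" "mm D g = 0" using ex[of "cv x"] by blast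
    have sq: "sq_int (\<lambda>\<theta>. cv (rep g \<theta>))"
    proof (rule sq_int_AE_bound[OF sq_int_rep[of g], of _ 1])
      show "(\<lambda>\<theta>. cv (rep g \<theta>)) \<in> borel_measurable circ"
        unfolding cv_def using sq_int_rep[of g]
        by (intro measurable_vec_lambda measurable_compose[OF _ cm] measurable_vec_nth) (simp add: sq_int_def)
    qed (simp add: ncv)
    define f where "f = mk (\<lambda>\<theta>. cv (rep g \<theta>))"
    have "fcoef (\<lambda>\<theta>. cv (rep g \<theta>)) k = cv (fcoef (rep g) (- k))" for k
    proof -
      have "(\<integral>\<theta>. cnj (rep g \<theta> $ i) * cis (- (of_int k * \<theta>)) \<partial>circ) = cnj (\<integral>\<theta>. rep g \<theta> $ i * cis (of_int k * \<theta>) \<partial>circ)" for i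
        unfolding Bochner_Integration.integral_cnj[symmetric]
        by (intro Bochner_Integration.integral_cong refl) (simp add: cis_cnj)
      then show ?thesis by (simp add: fcoef_def cv_def vec_eq_iff)
    qed
    then have cff: "cf f k = cv (cf g (- k))" for k by (simp add: f_def cf_mk sq cf_def[of g])
    have cv0: "cv 0 = 0" by (simp add: cv_def vec_eq_iff)
    have "f \<in> H2X" by (simp add: H2X_def cff g cv0)
    moreover have "cf f 0 = x" by (simp add: cff g cvcv)
    moreover have "mm D' f = 0"
    proof -
      have "AE \<theta> in circ. rep (mm D g) \<theta> = 0" using g(3) rep_zero by simp
      with rep_mm[OF D, of g] have "AE \<theta> in circ. D' \<theta> *v cv (rep g \<theta>) = 0"
        by eventually_elim (simp add: D'v cvcv cv0)
      then show ?thesis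
        unfolding f_def mm_mk[OF sq] zero_L2_def by (rule mk_cong)
    qed
    ultimately show ?thesis by blast
  qed
  then have "AE \<theta> in circ. D' \<theta> = 0" by (rule analytic_kernel_zero[OF LD'])
  then show ?thesis
    by eventually_elim (simp add: D'_def vec_eq_iff)
qed

section \<open>Contractive interpolants and symbols with enough extremal functions\<close>

definition contr_interp :: "(real \<Rightarrow> complex^'n^'n) \<Rightarrow> (real \<Rightarrow> complex^'n^'n) \<Rightarrow> bool" where
  "contr_interp \<Psi> G \<longleftrightarrow> Linf G \<and> Hinf (\<lambda>\<theta>. \<Psi> \<theta> - G \<theta>) \<and> (AE \<theta> in circ. \<forall>x. norm (G \<theta> *v x) \<le> norm x)"

definition extremal :: "(real \<Rightarrow> complex^'n^'n) \<Rightarrow> 'n::finite L2 set" where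
  "extremal \<Psi> = {f \<in> H2X. norm (Hk \<Psi> f) = norm f}"

text \<open>The index -1 picks the leading coefficient of the antianalytic image. The first
  alternative fills the domain side and makes an interpolant isometric, the second fills the range
  side and makes its adjoint isometric; for square matrices either suffices.\<close>

definition full :: "(real \<Rightarrow> complex^'n^'n) \<Rightarrow> bool" where
  "full \<Psi> \<longleftrightarrow> (\<forall>x. \<exists>f\<in>extremal \<Psi>. cf f 0 = x) \<or> (\<forall>x. \<exists>f\<in>extremal \<Psi>. cf (Hk \<Psi> f) (-1) = x)"

lemma contr_interp_exists:
  assumes "Linf \<Psi>" "contr \<Psi>" obtains G where "contr_interp \<Psi> G"
proof -
  obtain G where "Linf G" "Hinf (\<lambda>\<theta>. \<Psi> \<theta> - G \<theta>)"
    "AE \<theta> in circ. \<forall>x. norm (G \<theta> *v x) \<le> norm ((mat 1 :: complex^'a^'a) *v x)"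
    using weighted_nehari[OF assms(1) Linf_const[of "mat 1"]] assms(2) by (auto simp: contr_def)
  then show thesis by (intro that[of G]) (simp add: contr_interp_def)
qed

lemma norm_mm_contr:
  assumes "Linf G" "AE \<theta> in circ. \<forall>x. norm (G \<theta> *v x) \<le> norm x"
  shows "norm (mm G a) \<le> norm a" "norm (mm (\<lambda>\<theta>. adjoint_mat (G \<theta>)) a) \<le> norm a"
proof -
  show "norm (mm G a) \<le> norm a" using mm_bound[OF assms(1), of 1 a] assms(2) by simp
  have "AE \<theta> in circ. \<forall>x. norm (adjoint_mat (G \<theta>) *v x) \<le> 1 * norm x"
    using assms(2) by eventually_elim (auto intro!: norm_adjoint_mult_le[where B=1, simplified])
  then show "norm (mm (\<lambda>\<theta>. adjoint_mat (G \<theta>)) a) \<le> norm a"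
    using mm_bound[OF Linf_adjoint[OF assms(1)], of 1 a] by simp
qed

lemma contr_of_interp:
  assumes "Linf \<Psi>" "contr_interp \<Psi> G" shows "contr \<Psi>"
  unfolding contr_def
proof
  fix a :: "'a L2" assume "a \<in> H2X"
  then have "Hk \<Psi> a = Pm (mm G a)" using assms Hk_cong[of \<Psi> G a] by (simp add: contr_interp_def Hk_def)
  then show "norm (Hk \<Psi> a) \<le> norm a"
    using norm_Pm_le[of "mm G a"] norm_mm_contr(1)[of G a] assms(2) by (simp add: contr_interp_def)
qed

text \<open>Equality must hold throughout in
  \<open>norm (Pm (mm G f)) \<le> norm (mm G f) \<le> norm f\<close>. The first equality says that
  \<open>mm G f\<close> has no analytic part, the second is the equality case for a contraction
  followed by its adjoint.\<close>

lemma interp_on_extremal: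
  assumes \<Psi>: "Linf \<Psi>" and G: "contr_interp \<Psi> G" and f: "f \<in> extremal \<Psi>"
  shows "mm G f = Hk \<Psi> f" "mm (\<lambda>\<theta>. adjoint_mat (G \<theta>)) (mm G f) = f"
proof -
  have L: "Linf G" and c: "AE \<theta> in circ. \<forall>x. norm (G \<theta> *v x) \<le> norm x" using G by (auto simp: contr_interp_def)
  have H: "Hk \<Psi> f = Pm (mm G f)"
    using \<Psi> G f Hk_cong[of \<Psi> G f] by (simp add: contr_interp_def Hk_def extremal_def)
  have n: "norm (Pm (mm G f)) = norm f" using f H by (simp add: extremal_def)
  have n2: "norm (mm G f) = norm f"
    using n norm_Pm_le[of "mm G f"] norm_mm_contr(1)[OF L c, of f] by simp
  then have "mm G f = Pm (mm G f)" using Pm_pythagoras[of "mm G f"] n by simp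
  then show "mm G f = Hk \<Psi> f" by (simp add: H)
  let ?h = "mm (\<lambda>\<theta>. adjoint_mat (G \<theta>)) (mm G f)"
  have nh: "norm ?h \<le> norm f" using norm_mm_contr(2)[OF L c, of "mm G f"] n2 by simp
  have "f \<bullet> ?h = (norm f)\<^sup>2" using inner_mm[OF L, of f "mm G f"] n2 by (simp flip: power2_norm_eq_inner)
  then have "(norm (?h - f))\<^sup>2 = (norm ?h)\<^sup>2 - (norm f)\<^sup>2"
    unfolding power2_norm_eq_inner by (simp add: inner_diff inner_commute)
  also have "\<dots> \<le> 0" using nh by (simp add: power_mono)
  finally show "?h = f" by simp
qed

text \<open>The deviation of \<open>G\<close> from an isometry annihilates the extremal functions,
  and that of its adjoint annihilates their images; the kernel lemmas make one of them
  vanish.\<close>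

lemma full_interp_unitary:
  assumes \<Psi>: "Linf \<Psi>" and full: "full \<Psi>" and G: "contr_interp \<Psi> G"
  shows "AE \<theta> in circ. unitary_mat (G \<theta>)"
  using full unfolding full_def
proof
  let ?A = "\<lambda>\<theta>. adjoint_mat (G \<theta>)"
  have L: "Linf G" using G by (simp add: contr_interp_def)
  note A = Linf_adjoint[OF L]
  have inv: "unitary_mat X" if "X ** adjoint_mat X = mat 1 \<or> adjoint_mat X ** X = mat 1" for X :: "complex^'n^'n"
    using that matrix_left_right_inverse unfolding unitary_mat_def by blast
  {
    assume ex: "\<forall>x. \<exists>f\<in>extremal \<Psi>. cf f 0 = x"
    have "AE \<theta> in circ. mat 1 - ?A \<theta> ** G \<theta> = 0"
    proof (rule analytic_kernel_zero)
      show "Linf (\<lambda>\<theta>. mat 1 - ?A \<theta> ** G \<theta>)" by (intro Linf_diff Linf_const Linf_mult A L)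
      fix x
      obtain f where f: "f \<in> extremal \<Psi>" "cf f 0 = x" using ex by blast
      have "mm (\<lambda>\<theta>. mat 1 - ?A \<theta> ** G \<theta>) f = 0"
        by (subst mm_diff_left) (simp_all add: Linf_const Linf_mult A L interp_on_extremal(2)[OF \<Psi> G f(1)] flip: mm_mult)
      then show "\<exists>f\<in>H2X. cf f 0 = x \<and> mm (\<lambda>\<theta>. mat 1 - ?A \<theta> ** G \<theta>) f = 0"
        using f by (auto simp: extremal_def)
    qed
    then show ?thesis by eventually_elim (simp add: inv)
  next
    assume ex: "\<forall>x. \<exists>f\<in>extremal \<Psi>. cf (Hk \<Psi> f) (-1) = x"
    have "AE \<theta> in circ. mat 1 - G \<theta> ** ?A \<theta> = 0"
    proof (rule antianalytic_kernel_zero)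
      show LD: "Linf (\<lambda>\<theta>. mat 1 - G \<theta> ** ?A \<theta>)" by (intro Linf_diff Linf_const Linf_mult A L)
      fix x
      obtain f where f: "f \<in> extremal \<Psi>" "cf (Hk \<Psi> f) (-1) = x" using ex by blast
      \<comment> \<open>The shift moves the leading coefficient from index -1 to index 0, where
        \<open>antianalytic_kernel_zero\<close> expects it.\<close>
      define g where "g = sh 1 (Hk \<Psi> f)"
      have "mm (\<lambda>\<theta>. mat 1 - G \<theta> ** ?A \<theta>) (mm G f) = 0"
        by (subst mm_diff_left) (simp_all add: Linf_const Linf_mult A L interp_on_extremal(2)[OF \<Psi> G f(1)] flip: mm_mult)
      then have "mm (\<lambda>\<theta>. mat 1 - G \<theta> ** ?A \<theta>) g = 0"
        unfolding g_def by (simp add: sh_zero interp_on_extremal(1)[OF \<Psi> G f(1)] flip: sh_mm[OF LD])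
      moreover have "cf g k = 0" if "k > 0" for k using that by (simp add: g_def cf_sh Hk_def cf_Pm)
      moreover have "cf g 0 = x" using f by (simp add: g_def cf_sh)
      ultimately show "\<exists>g. (\<forall>k>0. cf g k = 0) \<and> cf g 0 = x \<and> mm (\<lambda>\<theta>. mat 1 - G \<theta> ** ?A \<theta>) g = 0" by blast
    qed
    then show ?thesis by eventually_elim (simp add: inv)
  }
qed

lemma adjoint_adjoint: "adjoint_mat (adjoint_mat A) = A"
  by (simp add: adjoint_mat_def vec_eq_iff)

text \<open>All interpolants agree with the Hankel operator on extremal functions, and their
  adjoints all send the image back to the function. So a difference of interpolants, or of their
  adjoints, annihilates enough functions.\<close>

lemma full_interp_unique:
  assumes \<Psi>: "Linf \<Psi>" and full: "full \<Psi>" and G: "contr_interp \<Psi> G" and F: "contr_interp \<Psi> F"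
  shows "AE \<theta> in circ. G \<theta> = F \<theta>"
  using full unfolding full_def
proof
  have L: "Linf G" "Linf F" using G F by (auto simp: contr_interp_def)
  note A = Linf_adjoint[OF L(1)] Linf_adjoint[OF L(2)]
  {
    assume ex: "\<forall>x. \<exists>f\<in>extremal \<Psi>. cf f 0 = x"
    have "AE \<theta> in circ. G \<theta> - F \<theta> = 0"
    proof (rule analytic_kernel_zero)
      show "Linf (\<lambda>\<theta>. G \<theta> - F \<theta>)" by (intro Linf_diff L)
      fix x
      obtain f where f: "f \<in> extremal \<Psi>" "cf f 0 = x" using ex by blast
      have "mm (\<lambda>\<theta>. G \<theta> - F \<theta>) f = 0"
        by (simp add: mm_diff_left L interp_on_extremal(1)[OF \<Psi> G f(1)] interp_on_extremal(1)[OF \<Psi> F f(1)])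
      then show "\<exists>f\<in>H2X. cf f 0 = x \<and> mm (\<lambda>\<theta>. G \<theta> - F \<theta>) f = 0"
        using f by (auto simp: extremal_def)
    qed
    then show ?thesis by simp
  next
    assume ex: "\<forall>x. \<exists>f\<in>extremal \<Psi>. cf (Hk \<Psi> f) (-1) = x"
    have "AE \<theta> in circ. adjoint_mat (G \<theta>) - adjoint_mat (F \<theta>) = 0"
    proof (rule antianalytic_kernel_zero)
      show LD: "Linf (\<lambda>\<theta>. adjoint_mat (G \<theta>) - adjoint_mat (F \<theta>))" by (intro Linf_diff A)
      fix x
      obtain f where f: "f \<in> extremal \<Psi>" "cf (Hk \<Psi> f) (-1) = x" using ex by blast
      define g where "g = sh 1 (Hk \<Psi> f)"
      have "mm (\<lambda>\<theta>. adjoint_mat (G \<theta>) - adjoint_mat (F \<theta>)) (Hk \<Psi> f) = 0"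
        using interp_on_extremal[OF \<Psi> G f(1)] interp_on_extremal[OF \<Psi> F f(1)] by (simp add: mm_diff_left A)
      then have "mm (\<lambda>\<theta>. adjoint_mat (G \<theta>) - adjoint_mat (F \<theta>)) g = 0"
        unfolding g_def by (simp add: sh_zero flip: sh_mm[OF LD])
      moreover have "cf g k = 0" if "k > 0" for k using that by (simp add: g_def cf_sh Hk_def cf_Pm)
      moreover have "cf g 0 = x" using f by (simp add: g_def cf_sh)
      ultimately show "\<exists>g. (\<forall>k>0. cf g k = 0) \<and> cf g 0 = x \<and> mm (\<lambda>\<theta>. adjoint_mat (G \<theta>) - adjoint_mat (F \<theta>)) g = 0" by blast
    qed
    then show ?thesis by eventually_elim (metis adjoint_adjoint eq_iff_diff_eq_0)
  }
qed

text \<open>A null vector of a nonnegative quadratic form lies in the kernel of its bilinear form.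
  Hence \<open>extremal\<close>, defined by a quadratic equation, is a linear subspace.\<close>

lemma extremal_inner:
  assumes \<Psi>: "Linf \<Psi>" "contr \<Psi>" and f: "f \<in> extremal \<Psi>" and g: "g \<in> H2X"
  shows "Hk \<Psi> f \<bullet> Hk \<Psi> g = f \<bullet> g"
proof -
  have lH: "linear (Hk \<Psi>)" by (rule bounded_linear.linear[OF bounded_linear_Hk[OF \<Psi>(1)]])
  have fH: "f \<in> H2X" "Hk \<Psi> f \<bullet> Hk \<Psi> f = f \<bullet> f"
    using f by (auto simp: extremal_def norm_eq_sqrt_inner)
  have pos: "0 \<le> a \<bullet> a - Hk \<Psi> a \<bullet> Hk \<Psi> a" if "a \<in> H2X" for a
    using \<Psi>(2) that by (simp add: contr_def norm_eq_sqrt_inner)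
  have "0 \<le> 0 + 2 * s * (f \<bullet> g - Hk \<Psi> f \<bullet> Hk \<Psi> g) + s\<^sup>2 * (g \<bullet> g - Hk \<Psi> g \<bullet> Hk \<Psi> g)" for s
    using pos[of "f + s *\<^sub>R g"] fH g
    by (simp add: H2X_add H2X_scaleR linear_add[OF lH] linear_scale[OF lH] inner_add inner_commute power2_eq_square algebra_simps)
  from semi_inner_cauchy[OF this pos[OF g]] show ?thesis by simp
qed

lemma extremal_iff:
  assumes \<Psi>: "Linf \<Psi>" "contr \<Psi>"
  shows "f \<in> extremal \<Psi> \<longleftrightarrow> f \<in> H2X \<and> (\<forall>g\<in>H2X. Hk \<Psi> f \<bullet> Hk \<Psi> g = f \<bullet> g)"
  using extremal_inner[OF \<Psi>, of f] by (auto simp: extremal_def norm_eq_sqrt_inner)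

lemma subspace_extremal:
  assumes \<Psi>: "Linf \<Psi>" "contr \<Psi>" shows "subspace (extremal \<Psi>)"
proof -
  have lH: "linear (Hk \<Psi>)" by (rule bounded_linear.linear[OF bounded_linear_Hk[OF \<Psi>(1)]])
  show ?thesis
    by (rule subspaceI) (simp_all add: extremal_iff[OF \<Psi>] H2X_zero H2X_add H2X_scaleR linear_0[OF lH]
        linear_add[OF lH] linear_scale[OF lH] inner_add_left)
qed

lemma extremal_cs:
  assumes "Linf \<Psi>" "f \<in> extremal \<Psi>" shows "cs c f \<in> extremal \<Psi>"
  using assms by (simp add: extremal_def H2X_cs Hk_cs norm_cs)

lemma closed_extremal:
  assumes "Linf \<Psi>" shows "closed (extremal \<Psi>)"
proof -
  have "extremal \<Psi> = H2X \<inter> {f. norm (Hk \<Psi> f) = norm f}" by (auto simp: extremal_def)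
  moreover have "closed {f. norm (Hk \<Psi> f) = norm f}"
    by (intro closed_Collect_eq continuous_intros linear_continuous_on bounded_linear_Hk assms)
  ultimately show ?thesis by (simp add: closed_Int closed_H2X)
qed

text \<open>Extremal functions lie in the kernel of the defect form, so estimates of the defect may
  be made on the component orthogonal to them.\<close>

lemma defect_add_extremal:
  assumes \<Psi>: "Linf \<Psi>" "contr \<Psi>" and f: "f \<in> extremal \<Psi>" and g: "g \<in> H2X"
  shows "(norm (f + g))\<^sup>2 - (norm (Hk \<Psi> (f + g)))\<^sup>2 = (norm g)\<^sup>2 - (norm (Hk \<Psi> g))\<^sup>2"
proof -
  have lH: "linear (Hk \<Psi>)" by (rule bounded_linear.linear[OF bounded_linear_Hk[OF \<Psi>(1)]])
  have "f \<in> H2X" using f by (simp add: extremal_def)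
  then show ?thesis
    using extremal_inner[OF \<Psi> f g] extremal_inner[OF \<Psi> f, of f]
    by (simp add: power2_norm_eq_inner linear_add[OF lH] inner_add inner_commute)
qed

lemma Cauchy_of_square_bound:
  fixes s :: "nat \<Rightarrow> 'a::real_normed_vector"
  assumes "\<delta> > 0" "\<And>e. e > 0 \<Longrightarrow> \<exists>N. \<forall>a\<ge>N. \<forall>b\<ge>N. \<delta> * (norm (s a - s b))\<^sup>2 \<le> e"
  shows "Cauchy s"
proof (rule metric_CauchyI)
  fix e :: real assume e: "e > 0"
  then obtain N where N: "\<And>a b. a \<ge> N \<Longrightarrow> b \<ge> N \<Longrightarrow> \<delta> * (norm (s a - s b))\<^sup>2 \<le> \<delta> * (e/2)\<^sup>2"
    using assms(2)[of "\<delta> * (e/2)\<^sup>2"] assms(1) by auto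
  have "dist (s a) (s b) < e" if "a \<ge> N" "b \<ge> N" for a b
  proof -
    have "(norm (s a - s b))\<^sup>2 \<le> (e/2)\<^sup>2" using N[OF that] assms(1) by simp
    then have "norm (s a - s b) \<le> e/2" using e by (intro power2_le_imp_le[of "norm (s a - s b)"]) auto
    then show ?thesis using e by (simp add: dist_norm)
  qed
  then show "\<exists>M. \<forall>m\<ge>M. \<forall>n\<ge>M. dist (s m) (s n) < e" by blast
qed

text \<open>The defect vanishes on differences of extremal functions, so essential coercivity makes
  a subsequence Cauchy.\<close>

lemma compact_extremal_ball:
  assumes \<Psi>: "Linf \<Psi>" "contr \<Psi>" and ec: "ess_coercive \<Psi> \<delta>" "\<delta> > 0"
  shows "compact (extremal \<Psi> \<inter> cball 0 1)"
  unfolding compact_eq_seq_compact_metric seq_compact_def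
proof (intro allI impI)
  fix s :: "nat \<Rightarrow> 'a L2" assume s: "\<forall>n. s n \<in> extremal \<Psi> \<inter> cball 0 1"
  then have "\<forall>n. s n \<in> H2X \<and> norm (s n) \<le> 1" by (simp add: extremal_def)
  then obtain r :: "nat \<Rightarrow> nat" where r: "strict_mono r" and rc: "\<And>e. e > 0 \<Longrightarrow> \<exists>N. \<forall>a\<ge>N. \<forall>b\<ge>N.
        \<delta> * (norm (s (r a) - s (r b)))\<^sup>2
          \<le> (norm (s (r a) - s (r b)))\<^sup>2 - (norm (Hk \<Psi> (s (r a) - s (r b))))\<^sup>2 + e"
    using ec(1) unfolding ess_coercive_def by blast
  have ex: "s a - s b \<in> extremal \<Psi>" for a b
    using s subspace_extremal[OF \<Psi>] by (simp add: subspace_diff)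
  have "Cauchy (s \<circ> r)"
  proof (rule Cauchy_of_square_bound[OF ec(2)])
    fix e :: real assume "e > 0"
    from rc[OF this] show "\<exists>N. \<forall>a\<ge>N. \<forall>b\<ge>N. \<delta> * (norm ((s \<circ> r) a - (s \<circ> r) b))\<^sup>2 \<le> e"
      using ex by (simp add: extremal_def)
  qed
  then obtain l where l: "(s \<circ> r) \<longlonglongrightarrow> l" using Cauchy_convergent convergent_def by blast
  have "closed (extremal \<Psi> \<inter> cball 0 1)" by (intro closed_Int closed_extremal \<Psi> closed_cball)
  then have "l \<in> extremal \<Psi> \<inter> cball 0 1" using s l by (intro closed_sequentially[OF _ _ l]) auto
  with l r show "\<exists>l\<in>extremal \<Psi> \<inter> cball 0 1. \<exists>r. strict_mono r \<and> (s \<circ> r) \<longlonglongrightarrow> l" by blast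
qed

text \<open>Otherwise unit vectors orthogonal to the extremal space would have defect tending to 0.
  Essential coercivity gives a convergent subsequence, whose limit is a unit vector both extremal
  and orthogonal to all extremal functions.\<close>

lemma coercive_off_extremal:
  fixes \<Psi> :: "real \<Rightarrow> complex^'n^'n"
  assumes \<Psi>: "Linf \<Psi>" "contr \<Psi>" and ec: "ess_coercive \<Psi> \<delta>" "\<delta> > 0"
  shows "\<exists>\<epsilon>>0. \<forall>g\<in>H2X. (\<forall>e\<in>extremal \<Psi>. g \<bullet> e = 0) \<longrightarrow> \<epsilon> * (norm g)\<^sup>2 \<le> (norm g)\<^sup>2 - (norm (Hk \<Psi> g))\<^sup>2"
proof (rule ccontr)
  assume nt: "\<not> ?thesis"
  have neg: "\<exists>g\<in>H2X. (\<forall>e\<in>extremal \<Psi>. g \<bullet> e = 0) \<and> (norm g)\<^sup>2 - (norm (Hk \<Psi> g))\<^sup>2 < \<epsilon> * (norm g)\<^sup>2" if "\<epsilon> > 0" for \<epsilon>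
    using nt that by (auto simp: not_le)
  have bH: "bounded_linear (Hk \<Psi>)" by (rule bounded_linear_Hk[OF \<Psi>(1)])
  note lH = bounded_linear.linear[OF bH]
  define q where "q g = (norm g)\<^sup>2 - (norm (Hk \<Psi> g))\<^sup>2" for g
  have "\<exists>g\<in>H2X. (\<forall>e\<in>extremal \<Psi>. g \<bullet> e = 0) \<and> norm g = 1 \<and> q g < 1 / real (Suc n)" for n
  proof -
    obtain g where g: "g \<in> H2X" "\<And>e. e \<in> extremal \<Psi> \<Longrightarrow> g \<bullet> e = 0" "q g < 1 / real (Suc n) * (norm g)\<^sup>2"
      using neg[of "1 / real (Suc n)"] by (auto simp: q_def simp del: of_nat_Suc)
    have "g \<noteq> 0" using g(3) linear_0[OF lH] by (auto simp: q_def)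
    let ?h = "(1 / norm g) *\<^sub>R g"
    have "q ?h = q g / (norm g)\<^sup>2"
      by (simp add: q_def linear_scale[OF lH] power_divide diff_divide_distrib)
    also have "\<dots> < 1 / real (Suc n)" using g(3) \<open>g \<noteq> 0\<close> by (simp add: pos_divide_less_eq)
    finally have "q ?h < 1 / real (Suc n)" .
    moreover have "norm ?h = 1" using \<open>g \<noteq> 0\<close> by simp
    ultimately show ?thesis using g H2X_scaleR by (intro bexI[of _ ?h]) auto
  qed
  then obtain s where s: "\<And>n. s n \<in> H2X" "\<And>n e. e \<in> extremal \<Psi> \<Longrightarrow> s n \<bullet> e = 0" "\<And>n. norm (s n) = 1"
    "\<And>n. q (s n) < 1 / real (Suc n)" by metis
  have "\<forall>n. s n \<in> H2X \<and> norm (s n) \<le> 1" using s by simp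
  then obtain r :: "nat \<Rightarrow> nat" where r: "strict_mono r" and rc: "\<And>e. e > 0 \<Longrightarrow> \<exists>N. \<forall>a\<ge>N. \<forall>b\<ge>N.
        \<delta> * (norm (s (r a) - s (r b)))\<^sup>2 \<le> q (s (r a) - s (r b)) + e"
    using ec(1) unfolding ess_coercive_def q_def by blast
  \<comment> \<open>Parallelogram identity for the defect form. As \<open>q (x + y)\<close> is
    nonnegative, differences of nearly extremal vectors have small defect.\<close>
  have par: "q (x - y) \<le> 2 * q x + 2 * q y" if "x \<in> H2X" "y \<in> H2X" for x y
  proof -
    have "0 \<le> q (x + y)"
      using \<Psi>(2) that by (simp add: q_def contr_def H2X_add power_mono)
    moreover have "q (x + y) + q (x - y) = 2 * q x + 2 * q y"
      by (simp add: q_def power2_norm_eq_inner linear_add[OF lH] linear_diff[OF lH] inner_add inner_diff)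
    ultimately show ?thesis by simp
  qed
  have "Cauchy (s \<circ> r)"
  proof (rule Cauchy_of_square_bound[OF ec(2)])
    fix e :: real assume e: "e > 0"
    then obtain N1 where N1: "\<And>a b. a \<ge> N1 \<Longrightarrow> b \<ge> N1 \<Longrightarrow> \<delta> * (norm (s (r a) - s (r b)))\<^sup>2 \<le> q (s (r a) - s (r b)) + e/2"
      using rc[of "e/2"] by auto
    obtain N2 where N2: "1 / real (Suc N2) < e / 8" using nat_approx_posE[of "e/8"] e by auto
    have small: "q (s (r a)) < e / 8" if "a \<ge> N2" for a
    proof -
      have "q (s (r a)) < 1 / real (Suc (r a))" by (rule s)
      also have "\<dots> \<le> 1 / real (Suc N2)"
        using that seq_suble[OF r, of a] by (intro divide_left_mono) auto
      finally show ?thesis using N2 by simp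
    qed
    have "\<delta> * (norm (s (r a) - s (r b)))\<^sup>2 \<le> e" if "a \<ge> max N1 N2" "b \<ge> max N1 N2" for a b
      using N1[of a b] par[OF s(1)[of "r a"] s(1)[of "r b"]] small[of a] small[of b] that by simp
    then show "\<exists>N. \<forall>a\<ge>N. \<forall>b\<ge>N. \<delta> * (norm ((s \<circ> r) a - (s \<circ> r) b))\<^sup>2 \<le> e"
      by (intro exI[of _ "max N1 N2"]) auto
  qed
  then obtain l where l: "(s \<circ> r) \<longlonglongrightarrow> l" using Cauchy_convergent convergent_def by blast
  have lH2: "l \<in> H2X" using s by (intro closed_sequentially[OF closed_H2X _ l]) auto
  have "(\<lambda>n. norm ((s \<circ> r) n)) \<longlonglongrightarrow> norm l" by (intro tendsto_intros l)
  then have nl: "norm l = 1" using s(3) by (simp add: LIMSEQ_const_iff)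
  have "(\<lambda>n. q ((s \<circ> r) n)) \<longlonglongrightarrow> q l"
    unfolding q_def by (intro tendsto_intros l bounded_linear.tendsto[OF bH])
  moreover have "q ((s \<circ> r) n) \<le> 1 / real (Suc n)" for n
  proof -
    have "q (s (r n)) < 1 / real (Suc (r n))" by (rule s)
    also have "\<dots> \<le> 1 / real (Suc n)" using seq_suble[OF r, of n] by (intro divide_left_mono) auto
    finally show ?thesis by simp
  qed
  ultimately have "q l \<le> 0" by (intro LIMSEQ_le[OF _ LIMSEQ_Suc[OF lim_1_over_n]]) auto
  moreover have "norm (Hk \<Psi> l) \<le> norm l" using \<Psi>(2) lH2 by (simp add: contr_def)
  ultimately have "norm (Hk \<Psi> l) = norm l"
    by (intro antisym power2_le_imp_le[of "norm l"]) (auto simp: q_def)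
  then have "l \<in> extremal \<Psi>" using lH2 by (simp add: extremal_def)
  have "(\<lambda>n. (s \<circ> r) n \<bullet> l) \<longlonglongrightarrow> l \<bullet> l" by (intro tendsto_intros l)
  then have "l \<bullet> l = 0" using s(2)[OF \<open>l \<in> extremal \<Psi>\<close>] by (simp add: LIMSEQ_const_iff)
  then show False using nl by simp
qed

text \<open>The extension adds one term with values in a finite-dimensional space.
  Bolzano-Weierstrass makes it Cauchy along a further subsequence, so the constant
  \<open>\<delta>\<close> is not diminished.\<close>

lemma ess_coercive_stepS:
  fixes \<Phi> :: "real \<Rightarrow> complex^'n^'n"
  assumes \<Phi>: "Linf \<Phi>" and ec: "ess_coercive \<Phi> \<delta>"
  shows "ess_coercive (stepS \<Phi> c) \<delta>"
  unfolding ess_coercive_def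
proof (intro allI impI)
  fix s :: "nat \<Rightarrow> 'n L2" and B assume s: "\<forall>m. s m \<in> H2X \<and> norm (s m) \<le> B"
  then obtain r :: "nat \<Rightarrow> nat" where r: "strict_mono r" and rc: "\<And>e. e > 0 \<Longrightarrow> \<exists>N. \<forall>a\<ge>N. \<forall>b\<ge>N.
        \<delta> * (norm (s (r a) - s (r b)))\<^sup>2
          \<le> (norm (s (r a) - s (r b)))\<^sup>2 - (norm (Hk \<Phi> (s (r a) - s (r b))))\<^sup>2 + e"
    using ec unfolding ess_coercive_def by blast
  define T where "T f = cf (mm (stepS \<Phi> c) f) (-1)" for f
  have bT: "bounded_linear T"
    unfolding T_def by (intro bounded_linear_compose[OF bounded_linear_cf] bounded_linear_mm Linf_stepS \<Phi>)
  have Te: "T f = cf (mm \<Phi> f) 0 + c *v cf f 0" for f by (simp add: T_def cf_stepS \<Phi>)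
  obtain K where K: "K > 0" "\<And>f. norm (T f) \<le> norm f * K" using bounded_linear.pos_bounded[OF bT] by blast
  have "bounded (range (\<lambda>m. T (s (r m))))"
    unfolding bounded_iff
  proof (intro exI[of _ "B * K"] ballI)
    fix x assume "x \<in> range (\<lambda>m. T (s (r m)))"
    then obtain m where "x = T (s (r m))" by blast
    then have "norm x \<le> norm (s (r m)) * K" using K by simp
    also have "\<dots> \<le> B * K" using s K by (intro mult_right_mono) auto
    finally show "norm x \<le> B * K" .
  qed
  then obtain l and r' :: "nat \<Rightarrow> nat" where r': "strict_mono r'" and l: "((\<lambda>m. T (s (r m))) \<circ> r') \<longlonglongrightarrow> l"
    using bounded_imp_convergent_subsequence by blast
  have C: "Cauchy ((\<lambda>m. T (s (r m))) \<circ> r')" using l by (rule LIMSEQ_imp_Cauchy)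
  show "\<exists>r::nat \<Rightarrow> nat. strict_mono r \<and> (\<forall>e>0. \<exists>N. \<forall>a\<ge>N. \<forall>b\<ge>N.
        \<delta> * (norm (s (r a) - s (r b)))\<^sup>2
          \<le> (norm (s (r a) - s (r b)))\<^sup>2 - (norm (Hk (stepS \<Phi> c) (s (r a) - s (r b))))\<^sup>2 + e)"
  proof (intro exI[of _ "r \<circ> r'"] conjI allI impI)
    show "strict_mono (r \<circ> r')" using r r' by (rule strict_mono_o)
    fix e :: real assume e: "e > 0"
    then obtain N1 where N1: "\<And>a b. a \<ge> N1 \<Longrightarrow> b \<ge> N1 \<Longrightarrow> \<delta> * (norm (s (r a) - s (r b)))\<^sup>2
          \<le> (norm (s (r a) - s (r b)))\<^sup>2 - (norm (Hk \<Phi> (s (r a) - s (r b))))\<^sup>2 + e/2"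
      using rc[of "e/2"] by auto
    have "sqrt (e/2) > 0" using e by simp
    then obtain N2 where N2: "\<And>a b. a \<ge> N2 \<Longrightarrow> b \<ge> N2 \<Longrightarrow> dist (T (s (r (r' a)))) (T (s (r (r' b)))) < sqrt (e/2)"
      using C unfolding Cauchy_def comp_def by blast
    show "\<exists>N. \<forall>a\<ge>N. \<forall>b\<ge>N. \<delta> * (norm (s ((r \<circ> r') a) - s ((r \<circ> r') b)))\<^sup>2
          \<le> (norm (s ((r \<circ> r') a) - s ((r \<circ> r') b)))\<^sup>2 - (norm (Hk (stepS \<Phi> c) (s ((r \<circ> r') a) - s ((r \<circ> r') b))))\<^sup>2 + e"
    proof (intro exI[of _ "max N1 N2"] allI impI)
      fix a b assume ab: "a \<ge> max N1 N2" "b \<ge> max N1 N2"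
      define h where "h = s (r (r' a)) - s (r (r' b))"
      have "norm (T h) \<le> sqrt (e/2)"
        using N2[of a b] ab by (simp add: h_def dist_norm linear_diff[OF bounded_linear.linear[OF bT]])
      then have "(norm (T h))\<^sup>2 \<le> (sqrt (e/2))\<^sup>2" by (intro power_mono) auto
      then have t: "(norm (T h))\<^sup>2 \<le> e/2" using e by simp
      have "r' a \<ge> N1" "r' b \<ge> N1" using ab seq_suble[OF r', of a] seq_suble[OF r', of b] by auto
      note n = N1[OF this]
      have "h \<in> H2X" using s by (simp add: h_def H2X_diff)
      then have "(norm (Hk (stepS \<Phi> c) h))\<^sup>2 = (norm (T h))\<^sup>2 + (norm (Hk \<Phi> h))\<^sup>2"
        by (simp add: Hk_stepS \<Phi> Te)
      then show "\<delta> * (norm (s ((r \<circ> r') a) - s ((r \<circ> r') b)))\<^sup>2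
          \<le> (norm (s ((r \<circ> r') a) - s ((r \<circ> r') b)))\<^sup>2 - (norm (Hk (stepS \<Phi> c) (s ((r \<circ> r') a) - s ((r \<circ> r') b))))\<^sup>2 + e"
        using n t by (simp add: h_def)
    qed
  qed
qed

section \<open>Extreme points of the set of contractive extensions\<close>

lemma proper_subspace_orthogonal:
  fixes A :: "'a::euclidean_space set"
  assumes "subspace A" "x \<notin> A"
  obtains a where "a \<noteq> 0" "\<And>y. y \<in> A \<Longrightarrow> y \<bullet> a = 0"
proof -
  obtain p where p: "p \<in> A" "\<And>s. s \<in> A \<Longrightarrow> (x - p) \<bullet> s = 0"
    using closed_subspace_projection[OF assms(1) closed_subspace[OF assms(1)], of x] by blast
  show thesis
  proof (rule that)
    show "x - p \<noteq> 0" using p assms by auto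
    show "y \<bullet> (x - p) = 0" if "y \<in> A" for y using p(2)[OF that] by (simp add: inner_commute)
  qed
qed

lemma uminus_matrix_vector: "(- A) *v x = - (A *v x)" for A :: "complex^'n^'m"
  by (simp add: vec_eq_iff matrix_vector_mult_def sum_negf)

lemma mm_const_scaleR_left: "mm (\<lambda>_. r *\<^sub>R c) a = r *\<^sub>R mm (\<lambda>_. c) a"
  unfolding mm_def scaleR_matrix_vector_mult scaleR_L2_def
  by (rule mk_cong) (use rep_mm[OF Linf_const[of c], of a] in \<open>eventually_elim, simp add: mm_def\<close>)

text \<open>For fixed \<open>a\<close> the vector \<open>Hk (stepS \<Phi> c) a\<close> is affine in
  \<open>c\<close>.\<close>

lemma convex_contr_stepS:
  assumes \<Phi>: "Linf \<Phi>" shows "convex {c. contr (stepS \<Phi> c)}"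
  unfolding convex_def contr_def
proof (intro ballI allI impI, unfold mem_Collect_eq, intro ballI)
  fix c d :: "complex^'a^'a" and u v :: real and a :: "'a L2"
  assume c: "\<forall>a\<in>H2X. norm (Hk (stepS \<Phi> c) a) \<le> norm a" and d: "\<forall>a\<in>H2X. norm (Hk (stepS \<Phi> d) a) \<le> norm a"
    and uv: "0 \<le> u" "0 \<le> v" "u + v = 1" and a: "a \<in> H2X"
  have e: "Hk (stepS \<Phi> x) a = Pm (sh (-1) (mm \<Phi> a)) + Pm (sh (-1) (mm (\<lambda>_. x) a))" for x
    by (simp add: Hk_def mm_stepS \<Phi> sh_add Pm_add)
  have "mm (\<lambda>_. u *\<^sub>R c + v *\<^sub>R d) a = u *\<^sub>R mm (\<lambda>_. c) a + v *\<^sub>R mm (\<lambda>_. d) a"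
    using mm_add_left[OF Linf_const[of "u *\<^sub>R c"] Linf_const[of "v *\<^sub>R d"], of a]
    by (simp add: mm_const_scaleR_left)
  moreover have "w = u *\<^sub>R w + v *\<^sub>R w" for w :: "'a L2" using uv by (metis scaleR_add_left scaleR_one)
  ultimately have "Hk (stepS \<Phi> (u *\<^sub>R c + v *\<^sub>R d)) a = u *\<^sub>R Hk (stepS \<Phi> c) a + v *\<^sub>R Hk (stepS \<Phi> d) a"
    by (simp add: e sh_add sh_scaleR Pm_add Pm_scaleR scaleR_add_right)
  also have "norm \<dots> \<le> u * norm (Hk (stepS \<Phi> c) a) + v * norm (Hk (stepS \<Phi> d) a)"
    using uv by (intro norm_triangle_le) simp
  also have "\<dots> \<le> u * norm a + v * norm a"
    using uv c d a by (intro add_mono mult_left_mono) auto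
  also have "\<dots> = norm a" using uv by (metis distrib_right mult_1)
  finally show "norm (Hk (stepS \<Phi> (u *\<^sub>R c + v *\<^sub>R d)) a) \<le> norm a" .
qed

lemma norm_matrix_le:
  fixes c :: "complex^'n^'m"
  assumes "\<And>x. norm (c *v x) \<le> B * norm x"
  shows "norm c \<le> real CARD('m) * (real CARD('n) * B)"
proof -
  have "cmod (c $ i $ j) \<le> B" for i j
  proof -
    have "c $ i $ j = (c *v axis j 1) $ i"
      by (simp add: matrix_vector_mult_def axis_def if_distrib[of "(*) _"] cong: if_cong)
    then have "cmod (c $ i $ j) \<le> norm (c *v axis j 1)" by (simp add: Finite_Cartesian_Product.norm_nth_le)
    also have "\<dots> \<le> B" using assms[of "axis j 1"] by (simp add: norm_axis_1)
    finally show ?thesis .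
  qed
  then have "norm (c $ i) \<le> real CARD('n) * B" for i
    unfolding norm_vec_def by (intro order_trans[OF L2_set_le_sum] order_trans[OF sum_bounded_above]) auto
  then show ?thesis
    unfolding norm_vec_def[of c] by (intro order_trans[OF L2_set_le_sum] order_trans[OF sum_bounded_above]) auto
qed

text \<open>Testing on constants bounds \<open>c\<close>: the new row has norm at most 1 there and
  \<open>\<Phi>\<close> contributes at most \<open>K\<close>. For closedness, each \<open>a\<close>
  imposes one closed condition on \<open>c\<close>.\<close>

lemma compact_contr_stepS:
  assumes \<Phi>: "Linf \<Phi>" shows "compact {c. contr (stepS \<Phi> c)}"
proof -
  obtain K where K: "K \<ge> 0" "AE \<theta> in circ. \<forall>x. norm (\<Phi> \<theta> *v x) \<le> K * norm x"
    using \<Phi> by (rule LinfE)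
  have "norm (c *v x) \<le> (1 + K) * norm x" if "contr (stepS \<Phi> c)" for c x
  proof -
    have a: "cst x \<in> H2X" by (rule H2X_cst)
    have "(norm (cf (mm \<Phi> (cst x)) 0 + c *v x))\<^sup>2 \<le> (norm (Hk (stepS \<Phi> c) (cst x)))\<^sup>2"
      unfolding Hk_stepS[OF \<Phi> a] by (simp add: cf_cst)
    then have "norm (cf (mm \<Phi> (cst x)) 0 + c *v x) \<le> norm (Hk (stepS \<Phi> c) (cst x))"
      by (rule power2_le_imp_le) simp
    also have "\<dots> \<le> norm x" using that a by (auto simp: contr_def)
    finally have 1: "norm (cf (mm \<Phi> (cst x)) 0 + c *v x) \<le> norm x" .
    have "norm (cf (mm \<Phi> (cst x)) 0) \<le> K * norm x"
      using norm_cf_le[of "mm \<Phi> (cst x)" 0] mm_bound[OF \<Phi> K(2,1), of "cst x"] by simp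
    then show ?thesis
      using 1 norm_triangle_ineq4[of "cf (mm \<Phi> (cst x)) 0 + c *v x" "cf (mm \<Phi> (cst x)) 0"]
      by (simp add: distrib_right)
  qed
  then have "bounded {c. contr (stepS \<Phi> c)}"
    unfolding bounded_iff using norm_matrix_le[of _ "1 + K"] by blast
  moreover have "{c. contr (stepS \<Phi> c)} = (\<Inter>a\<in>H2X. {c. (norm (cf (mm \<Phi> a) 0 + c *v cf a 0))\<^sup>2 + (norm (Hk \<Phi> a))\<^sup>2 \<le> (norm a)\<^sup>2})"
    by (auto simp: contr_def Hk_stepS[OF \<Phi>, symmetric] power_mono intro: power2_le_imp_le)
  moreover have "closed \<dots>"
    by (intro closed_INT ballI closed_Collect_le continuous_intros
        linear_continuous_on bounded_bilinear.bounded_linear_left[OF bounded_bilinear_matrix_vector])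
  ultimately show ?thesis by (simp add: compact_eq_bounded_closed)
qed

text \<open>If neither alternative of \<^const>\<open>full\<close> held, a rank-one matrix \<open>\<Delta>\<close> killing the values \<open>f(0)\<close> and with
  range orthogonal to the leading coefficients of the extremal functions could be added to
  and subtracted from \<open>c\<close>.\<close>

lemma extreme_imp_full:
  fixes \<Phi> :: "real \<Rightarrow> complex^'n^'n"
  assumes \<Phi>: "Linf \<Phi>" and ec: "ess_coercive \<Phi> \<delta>" "\<delta> > 0"
    and ext: "c extreme_point_of {c. contr (stepS \<Phi> c)}"
  shows "full (stepS \<Phi> c)"
proof (rule ccontr)
  define \<Psi> where "\<Psi> = stepS \<Phi> c"
  define E where "E = extremal \<Psi>"
  have L: "Linf \<Psi>" unfolding \<Psi>_def by (rule Linf_stepS[OF \<Phi>])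
  have con: "contr \<Psi>" using ext by (simp add: extreme_point_of_def \<Psi>_def)
  have bH: "bounded_linear (Hk \<Psi>)" by (rule bounded_linear_Hk[OF L])
  note lH = bounded_linear.linear[OF bH]
  assume "\<not> full (stepS \<Phi> c)"
  then have "\<exists>x. \<forall>f\<in>E. cf f 0 \<noteq> x" "\<exists>y. \<forall>f\<in>E. cf (Hk \<Psi> f) (-1) \<noteq> y"
    unfolding full_def E_def \<Psi>_def by auto
  then obtain x y where "\<forall>f\<in>E. cf f 0 \<noteq> x" "\<forall>f\<in>E. cf (Hk \<Psi> f) (-1) \<noteq> y" by blast
  then have x: "x \<notin> (\<lambda>f. cf f 0) ` E" and y: "y \<notin> (\<lambda>f. cf (Hk \<Psi> f) (-1)) ` E" by auto
  have sE: "subspace E" unfolding E_def by (rule subspace_extremal[OF L con])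
  have EH: "f \<in> H2X" if "f \<in> E" for f using that by (simp add: E_def extremal_def)
  have sA: "subspace ((\<lambda>f. cf f 0) ` E)" by (rule linear_subspace_image[OF linear_cf sE])
  have sB: "subspace ((\<lambda>f. cf (Hk \<Psi> f) (-1)) ` E)"
    using linear_subspace_image[OF linear_compose[OF lH linear_cf] sE] by (simp add: comp_def)
  obtain a where a0: "a \<noteq> 0" "\<And>y. y \<in> (\<lambda>f. cf f 0) ` E \<Longrightarrow> y \<bullet> a = 0"
    by (rule proper_subspace_orthogonal[OF sA x]; rule that; assumption)
  have a: "a \<noteq> 0" "\<And>f. f \<in> E \<Longrightarrow> cf f 0 \<bullet> a = 0" using a0 by auto
  obtain b where b0: "b \<noteq> 0" "\<And>y. y \<in> (\<lambda>f. cf (Hk \<Psi> f) (-1)) ` E \<Longrightarrow> y \<bullet> b = 0"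
    by (rule proper_subspace_orthogonal[OF sB y]; rule that; assumption)
  have b: "b \<noteq> 0" "\<And>f. f \<in> E \<Longrightarrow> cf (Hk \<Psi> f) (-1) \<bullet> b = 0" using b0 by auto
  have csE: "cs z f \<in> E" if "f \<in> E" for z f using that L by (simp add: E_def extremal_cs)
  define \<Delta> :: "complex^'n^'n" where "\<Delta> = (\<chi> p q. b $ p * cnj (a $ q))"
  have \<Delta>: "\<Delta> *v w = cip w a *s b" for w
    by (simp add: \<Delta>_def cip_def matrix_vector_mult_def vec_eq_iff sum_distrib_left sum_distrib_right mult_ac)
  \<comment> \<open>The extremal space is invariant under complex scalars, so orthogonality for the
    real inner product already gives it for the Hermitian one.\<close>
  have \<Delta>E: "\<Delta> *v cf f 0 = 0" if "f \<in> E" for f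
  proof -
    have "cip (cf f 0) a = 0"
      using a(2)[OF that] a(2)[OF csE[OF that, of "-\<i>"]]
      by (simp only: cf_cs Re_cip[symmetric] cip_smult_left) (simp add: complex_eq_iff)
    then show ?thesis by (simp add: \<Delta>)
  qed
  have \<Delta>B: "cf (Hk \<Psi> f) (-1) \<bullet> (\<Delta> *v w) = 0" if "f \<in> E" for f w
  proof -
    have "cf (Hk \<Psi> f) (-1) \<bullet> (\<Delta> *v w) = cf (Hk \<Psi> (cs (cnj (cip w a)) f)) (-1) \<bullet> b"
      by (simp only: \<Delta> Hk_cs[OF L] cf_cs Re_cip[symmetric] cip_smult_left cip_smult_right)
    then show ?thesis using b(2)[OF csE[OF that]] by simp
  qed
  have "\<Delta> \<noteq> 0"
  proof
    assume "\<Delta> = 0"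
    then have "cip a a *s b = 0" by (simp flip: \<Delta>)
    then have "cip a a = 0" using b(1) by (auto simp: vec_eq_iff)
    then have "a \<bullet> a = 0" by (simp flip: Re_cip)
    then show False using a(1) by simp
  qed
  define K where "K = opnorm \<Delta>"
  have K: "K \<ge> 0" "\<And>w. norm (\<Delta> *v w) \<le> K * norm w" by (simp_all add: K_def opnorm_nonneg opnorm_mult_le)
  have "ess_coercive \<Psi> \<delta>" unfolding \<Psi>_def by (rule ess_coercive_stepS[OF \<Phi> ec(1)])
  from coercive_off_extremal[OF L con this ec(2)] obtain \<epsilon> where \<epsilon>: "\<epsilon> > 0"
    and co: "\<forall>g\<in>H2X. (\<forall>e\<in>E. g \<bullet> e = 0) \<longrightarrow> \<epsilon> * (norm g)\<^sup>2 \<le> (norm g)\<^sup>2 - (norm (Hk \<Psi> g))\<^sup>2"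
    unfolding E_def by auto
  \<comment> \<open>Keeps the growth \<open>t * (2 * K + t * K\<^sup>2)\<close> of the squared norm,
    relative to that of \<open>g\<close>, below the coercivity constant. The 1 in the denominator
    keeps it positive whatever \<open>K\<close> is.\<close>
  define t where "t = min 1 (\<epsilon> / (2 * K + K\<^sup>2 + 1))"
  have den: "2 * K + K\<^sup>2 + 1 > 0" using K(1) by (simp add: add_nonneg_pos)
  have t: "t > 0" "t \<le> 1" using \<epsilon> den by (auto simp: t_def)
  have "t \<le> \<epsilon> / (2 * K + K\<^sup>2 + 1)" by (simp add: t_def)
  then have "t * (2 * K + K\<^sup>2 + 1) \<le> \<epsilon>" using den by (simp add: pos_le_divide_eq)
  moreover have "t * (2 * K + t * K\<^sup>2) \<le> t * (2 * K + K\<^sup>2 + 1)"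
    using t K(1) mult_left_le_one_le[of "K\<^sup>2" t] by (intro mult_left_mono) auto
  ultimately have te: "t * (2 * K + t * K\<^sup>2) \<le> \<epsilon>" by linarith
  have inC: "contr (stepS \<Phi> (c + (\<sigma> * t) *\<^sub>R \<Delta>))" if \<sigma>: "\<bar>\<sigma>\<bar> = 1" for \<sigma> :: real
    unfolding contr_def
  proof
    fix f :: "'n L2" assume f: "f \<in> H2X"
    obtain e where e: "e \<in> E" "\<And>s. s \<in> E \<Longrightarrow> (f - e) \<bullet> s = 0"
      by (rule closed_subspace_projection[OF sE closed_extremal[OF L, folded E_def], of f]; rule that; assumption)
    define g where "g = f - e"
    have g: "g \<in> H2X" using f EH[OF e(1)] by (simp add: g_def H2X_diff)
    have fe: "f = e + g" by (simp add: g_def)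
    define w where "w = \<Delta> *v cf g 0"
    have w: "\<Delta> *v cf f 0 = w" by (simp add: fe cf_add matrix_vector_right_distrib \<Delta>E e w_def)
    have nw: "norm w \<le> K * norm g"
      unfolding w_def using K(2)[of "cf g 0"] mult_left_mono[OF norm_cf_le[of g 0] K(1)] by linarith
    define u where "u = cf (Hk \<Psi> g) (-1)"
    have nu: "norm u \<le> norm g"
      unfolding u_def using norm_cf_le[of "Hk \<Psi> g" "-1"] con g by (simp add: contr_def) (meson order_trans)
    \<comment> \<open>The extremal part \<open>e\<close> drops out of both factors:
      \<open>\<Delta>\<close> kills its value at 0, and the range of \<open>\<Delta>\<close> is
      orthogonal to its leading coefficient. The perturbation is felt on \<open>g\<close> alone,
      where the defect is coercive.\<close>
    have uw: "cf (Hk \<Psi> f) (-1) \<bullet> w = u \<bullet> w"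
      using \<Delta>B[OF e(1), of "cf g 0"] by (simp add: fe linear_add[OF lH] cf_add inner_add_left u_def w_def)
    have top: "cf (mm \<Phi> f) 0 + c *v cf f 0 = cf (Hk \<Psi> f) (-1)"
      by (simp add: Hk_def cf_Pm \<Psi>_def cf_stepS \<Phi>)
    have sq: "(norm (p + q))\<^sup>2 = (norm p)\<^sup>2 + 2 * (p \<bullet> q) + (norm q)\<^sup>2" for p q :: "complex^'n"
      unfolding power2_norm_eq_inner by (simp add: inner_add inner_commute)
    have "(norm (Hk (stepS \<Phi> (c + (\<sigma> * t) *\<^sub>R \<Delta>)) f))\<^sup>2
      = (norm (cf (Hk \<Psi> f) (-1) + (\<sigma> * t) *\<^sub>R w))\<^sup>2 + (norm (Hk \<Phi> f))\<^sup>2"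
      by (simp add: Hk_stepS \<Phi> f matrix_vector_mult_add_rdistrib scaleR_matrix_vector_mult w top flip: add.assoc)
    also have "\<dots> = (norm (cf (Hk \<Psi> f) (-1)))\<^sup>2 + (norm (Hk \<Phi> f))\<^sup>2 + 2 * (\<sigma> * t) * (u \<bullet> w) + t\<^sup>2 * (norm w)\<^sup>2"
      using \<sigma> by (simp add: sq uw abs_mult power_mult_distrib)
    also have "(norm (cf (Hk \<Psi> f) (-1)))\<^sup>2 + (norm (Hk \<Phi> f))\<^sup>2 = (norm (Hk \<Psi> f))\<^sup>2"
      unfolding \<Psi>_def using Hk_stepS[OF \<Phi> f, of c] top by (simp add: \<Psi>_def)
    also have "2 * (\<sigma> * t) * (u \<bullet> w) \<le> 2 * t * (K * (norm g)\<^sup>2)"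
    proof -
      have "\<sigma> * (u \<bullet> w) \<le> \<bar>u \<bullet> w\<bar>" using \<sigma> by (metis abs_ge_self abs_mult mult_1)
      also have "\<dots> \<le> norm u * norm w" by (rule Cauchy_Schwarz_ineq2)
      also have "\<dots> \<le> norm g * (K * norm g)" using nu nw by (intro mult_mono) auto
      finally have "\<sigma> * (u \<bullet> w) \<le> K * (norm g)\<^sup>2" by (simp add: power2_eq_square mult_ac)
      then show ?thesis using t(1) by (simp add: mult_ac mult_left_mono)
    qed
    also have "t\<^sup>2 * (norm w)\<^sup>2 \<le> t\<^sup>2 * (K\<^sup>2 * (norm g)\<^sup>2)"
      using nw by (intro mult_left_mono) (auto simp: power_mono simp flip: power_mult_distrib)
    finally have "(norm (Hk (stepS \<Phi> (c + (\<sigma> * t) *\<^sub>R \<Delta>)) f))\<^sup>2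
      \<le> (norm (Hk \<Psi> f))\<^sup>2 + (t * (2 * K + t * K\<^sup>2)) * (norm g)\<^sup>2"
      by (simp add: power2_eq_square algebra_simps)
    also have "\<dots> \<le> (norm (Hk \<Psi> f))\<^sup>2 + \<epsilon> * (norm g)\<^sup>2"
      using te by (intro add_left_mono mult_right_mono) auto
    also have "\<dots> \<le> (norm f)\<^sup>2"
      using co[rule_format, OF g] e(2) defect_add_extremal[OF L con e(1)[unfolded E_def] g] by (simp add: g_def)
    finally show "norm (Hk (stepS \<Phi> (c + (\<sigma> * t) *\<^sub>R \<Delta>)) f) \<le> norm f"
      by (rule power2_le_imp_le) simp
  qed
  have "c - t *\<^sub>R \<Delta> \<in> {c. contr (stepS \<Phi> c)}" "c + t *\<^sub>R \<Delta> \<in> {c. contr (stepS \<Phi> c)}"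
    using inC[of "-1"] inC[of 1] by auto
  moreover have "c \<in> open_segment (c - t *\<^sub>R \<Delta>) (c + t *\<^sub>R \<Delta>)"
  proof -
    have "midpoint (c - t *\<^sub>R \<Delta>) (c + t *\<^sub>R \<Delta>) = c"
      by (simp add: midpoint_def scaleR_add_right[symmetric] flip: scaleR_2)
    moreover have "c - t *\<^sub>R \<Delta> \<noteq> c + t *\<^sub>R \<Delta>"
    proof
      assume "c - t *\<^sub>R \<Delta> = c + t *\<^sub>R \<Delta>"
      then have "(2 * t) *\<^sub>R \<Delta> = 0" by (simp add: algebra_simps flip: scaleR_2 scaleR_scaleR)
      then show False using t \<open>\<Delta> \<noteq> 0\<close> by simp
    qed
    ultimately show ?thesis by (metis midpoint_in_open_segment)
  qed
  ultimately show False using ext unfolding extreme_point_of_def by blast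
qed

text \<open>This \<open>c\<close> cancels the zeroth coefficient of the analytic function
  \<open>\<Phi> - G\<close>, so that division by \<zeta> leaves it analytic.\<close>

lemma contr_interp_stepS:
  assumes \<Phi>: "Linf \<Phi>" and G: "contr_interp \<Phi> G"
  defines "c \<equiv> - mfcoef (\<lambda>\<theta>. \<Phi> \<theta> - G \<theta>) 0"
  shows "contr_interp (stepS \<Phi> c) (\<lambda>\<theta>. mat (cis (of_int (-1) * \<theta>)) ** G \<theta>)"
proof -
  let ?Z = "\<lambda>\<theta>. mat (cis (of_int (-1) * \<theta>)) :: complex^'a^'a"
  have L: "Linf G" and H: "Hinf (\<lambda>\<theta>. \<Phi> \<theta> - G \<theta>)" and n: "AE \<theta> in circ. \<forall>x. norm (G \<theta> *v x) \<le> norm x"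
    using G by (auto simp: contr_interp_def)
  have LD: "Linf (\<lambda>\<theta>. \<Phi> \<theta> - G \<theta>)" by (intro Linf_diff \<Phi> L)
  have e: "(\<lambda>\<theta>. stepS \<Phi> c \<theta> - ?Z \<theta> ** G \<theta>) = stepS (\<lambda>\<theta>. \<Phi> \<theta> - G \<theta>) c"
    by (simp only: stepS_def fun_eq_iff mat_mult_eq_smult) (simp add: vec_eq_iff algebra_simps)
  have "Hinf (stepS (\<lambda>\<theta>. \<Phi> \<theta> - G \<theta>) c)"
    unfolding Hinf_iff
  proof (intro conjI allI Linf_stepS LD)
    fix x
    have H0: "mm (\<lambda>\<theta>. \<Phi> \<theta> - G \<theta>) (cst x) \<in> H2X" using H by (simp add: Hinf_iff)
    have "cf (mm (stepS (\<lambda>\<theta>. \<Phi> \<theta> - G \<theta>) c) (cst x)) k = 0" if "k < 0" for k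
    proof (cases "k = -1")
      case True
      then show ?thesis
        by (simp add: cf_stepS LD cf_cst c_def mfcoef_mult[OF LD, symmetric] uminus_matrix_vector)
    next
      case False
      then show ?thesis using that H0 by (simp add: cf_stepS LD cf_cst H2X_def)
    qed
    then show "mm (stepS (\<lambda>\<theta>. \<Phi> \<theta> - G \<theta>) c) (cst x) \<in> H2X" by (simp add: H2X_def)
  qed
  moreover have "AE \<theta> in circ. \<forall>x. norm ((?Z \<theta> ** G \<theta>) *v x) \<le> norm x"
    using n by eventually_elim (simp add: matrix_vector_mul_assoc[symmetric] mat_mult_vec norm_smult_vec)
  ultimately show ?thesis
    by (simp only: contr_interp_def e Linf_mult Linf_cis L simp_thms)
qed

text \<open>The way back from the extended symbol. The zeroth coefficient remembers
  \<open>c\<close>, so different extensions yield different interpolants.\<close>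

lemma interp_of_stepS:
  assumes \<Phi>: "Linf \<Phi>" and G: "contr_interp (stepS \<Phi> c) G"
  shows "Hinf (\<lambda>\<theta>. \<Phi> \<theta> - mat (cis (of_int 1 * \<theta>)) ** G \<theta>)"
    "mfcoef (\<lambda>\<theta>. \<Phi> \<theta> - mat (cis (of_int 1 * \<theta>)) ** G \<theta>) 0 = - c"
proof -
  let ?F = "\<lambda>\<theta>. stepS \<Phi> c \<theta> - G \<theta>"
  let ?D = "\<lambda>\<theta>. \<Phi> \<theta> - mat (cis (of_int 1 * \<theta>)) ** G \<theta>"
  have LG: "Linf G" and H: "Hinf ?F" using G by (auto simp: contr_interp_def)
  have LD: "Linf ?D" by (intro Linf_diff \<Phi> Linf_mult Linf_cis LG)
  have "mm ?D (cst x) = sh 1 (mm ?F (cst x)) - cst (c *v x)" for x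
  proof -
    have "sh 1 (mm (stepS \<Phi> c) (cst x)) = mm \<Phi> (cst x) + cst (c *v x)"
      by (simp add: mm_stepS \<Phi> sh_sh mm_const_cst)
    moreover have "mm (\<lambda>\<theta>. mat (cis (of_int 1 * \<theta>)) ** G \<theta>) (cst x) = sh 1 (mm G (cst x))"
      unfolding sh_def by (rule mm_mult[OF Linf_cis LG, symmetric])
    ultimately show ?thesis
      by (simp only: mm_diff_left Linf_mult Linf_cis LG \<Phi> Linf_stepS sh_diff) simp
  qed
  note e = this
  have H0: "mm ?F (cst x) \<in> H2X" for x using H by (simp add: Hinf_iff)
  show "Hinf ?D" unfolding Hinf_iff e using LD H0 by (simp add: H2X_diff H2X_sh H2X_cst)
  have "mfcoef ?D 0 *v x = (- c) *v x" for x
    unfolding mfcoef_mult[OF LD] e uminus_matrix_vector using H0[of x] by (simp add: cf_diff cf_sh cf_cst H2X_def)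
  then show "mfcoef ?D 0 = - c" by (simp add: matrix_eq)
qed

lemma unitary_mat_norm: "unitary_mat U \<Longrightarrow> norm (U *v x) = norm x"
proof -
  assume "unitary_mat U"
  then have "(U *v x) \<bullet> (U *v x) = x \<bullet> x"
    by (simp add: inner_matrix_adjoint matrix_vector_mul_assoc unitary_mat_def)
  then show ?thesis by (simp add: norm_eq_sqrt_inner)
qed

lemma unitary_interp_contr: "unitary_interpolant \<Phi> U \<Longrightarrow> contr_interp \<Phi> U"
  unfolding unitary_interpolant_def contr_interp_def
  by (auto simp: unitary_mat_norm elim!: eventually_mono)

lemma unitary_cis_mult: "unitary_mat U \<Longrightarrow> unitary_mat (mat (cis t) ** U)"
proof -
  assume U: "unitary_mat U"
  have "adjoint_mat (mat (cis t) ** U) = mat (cis (-t)) ** adjoint_mat U"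
    by (simp add: mat_mult_eq_smult adjoint_mat_def vec_eq_iff cis_cnj)
  then have "adjoint_mat (mat (cis t) ** U) ** (mat (cis t) ** U) = mat (cis (-t)) ** (adjoint_mat U ** mat (cis t)) ** U"
    by (simp add: matrix_mul_assoc)
  also have "\<dots> = mat (cis (-t)) ** mat (cis t) ** (adjoint_mat U ** U)"
    by (simp only: mat_mult_commute[of "cis t" "adjoint_mat U", symmetric] matrix_mul_assoc)
  also have "\<dots> = mat 1" using U by (simp add: mat_mat_mult cis_mult unitary_mat_def)
  finally show ?thesis by (auto simp: unitary_mat_def matrix_left_right_inverse)
qed

text \<open>An extreme point \<open>c\<close> gives a full extended symbol, hence a unitary
  interpolant \<open>U\<close> for which the zeroth coefficient of \<open>\<Phi> - U\<close> reveals
  \<open>c\<close>. Uniqueness leaves a single extreme point, and Krein-Milman collapses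
  \<open>C\<close> to it.\<close>

lemma unique_unitary_imp_unique_contr:
  fixes \<Phi> :: "real \<Rightarrow> complex^'n^'n"
  assumes \<Phi>: "Linf \<Phi>" and ec: "ess_coercive \<Phi> \<delta>" "\<delta> > 0"
    and uni: "\<And>U V. unitary_interpolant \<Phi> U \<Longrightarrow> unitary_interpolant \<Phi> V \<Longrightarrow> AE \<theta> in circ. U \<theta> = V \<theta>"
    and G: "contr_interp \<Phi> G" and F: "contr_interp \<Phi> F"
  shows "AE \<theta> in circ. G \<theta> = F \<theta>"
proof -
  define C where "C = {c. contr (stepS \<Phi> c)}"
  let ?Z = "\<lambda>\<theta>. mat (cis (of_int 1 * \<theta>)) :: complex^'n^'n"
  let ?cc = "\<lambda>G. - mfcoef (\<lambda>\<theta>. \<Phi> \<theta> - G \<theta>) 0"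
  have inC: "?cc G \<in> C" if "contr_interp \<Phi> G" for G
    unfolding C_def using contr_of_interp[OF Linf_stepS[OF \<Phi>] contr_interp_stepS[OF \<Phi> that]] by simp
  have KM: "C = convex hull {c. c extreme_point_of C}"
    unfolding C_def by (rule Krein_Milman_Minkowski[OF compact_contr_stepS[OF \<Phi>] convex_contr_stepS[OF \<Phi>]])
  have ext_unitary: "\<exists>U. unitary_interpolant \<Phi> U \<and> mfcoef (\<lambda>\<theta>. \<Phi> \<theta> - U \<theta>) 0 = - c" if c: "c extreme_point_of C" for c
  proof -
    have full: "full (stepS \<Phi> c)" using c unfolding C_def by (rule extreme_imp_full[OF \<Phi> ec])
    have "contr (stepS \<Phi> c)" using c by (simp add: extreme_point_of_def C_def)
    then obtain G where G: "contr_interp (stepS \<Phi> c) G" using contr_interp_exists[OF Linf_stepS[OF \<Phi>]] by blast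
    have un: "AE \<theta> in circ. unitary_mat (G \<theta>)" by (rule full_interp_unitary[OF Linf_stepS[OF \<Phi>] full G])
    have LG: "Linf G" using G by (simp add: contr_interp_def)
    have "unitary_interpolant \<Phi> (\<lambda>\<theta>. ?Z \<theta> ** G \<theta>)"
      unfolding unitary_interpolant_def
    proof (intro conjI Linf_mult Linf_cis LG interp_of_stepS(1)[OF \<Phi> G])
      show "AE \<theta> in circ. unitary_mat (?Z \<theta> ** G \<theta>)"
        using un by eventually_elim (rule unitary_cis_mult)
    qed
    then show ?thesis using interp_of_stepS(2)[OF \<Phi> G] by blast
  qed
  have mfc: "mfcoef A 0 = mfcoef B 0" if "AE \<theta> in circ. A \<theta> = B \<theta>" "Linf A" "Linf B" for A B :: "real \<Rightarrow> complex^'n^'n"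
    using mm_cong[OF that(1)] by (simp add: matrix_eq mfcoef_mult that)
  have ext_eq: "c = d" if c: "c extreme_point_of C" and d: "d extreme_point_of C" for c d
  proof -
    obtain U V where U: "unitary_interpolant \<Phi> U" "mfcoef (\<lambda>\<theta>. \<Phi> \<theta> - U \<theta>) 0 = - c"
      and V: "unitary_interpolant \<Phi> V" "mfcoef (\<lambda>\<theta>. \<Phi> \<theta> - V \<theta>) 0 = - d" using ext_unitary[OF c] ext_unitary[OF d] by blast
    have "AE \<theta> in circ. \<Phi> \<theta> - U \<theta> = \<Phi> \<theta> - V \<theta>" using uni[OF U(1) V(1)] by eventually_elim simp
    then have "mfcoef (\<lambda>\<theta>. \<Phi> \<theta> - U \<theta>) 0 = mfcoef (\<lambda>\<theta>. \<Phi> \<theta> - V \<theta>) 0"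
      using U(1) V(1) by (intro mfc Linf_diff \<Phi>) (auto simp: unitary_interpolant_def)
    then show ?thesis using U(2) V(2) by simp
  qed
  have "C \<noteq> {}" using inC[OF G] by blast
  then have "{c. c extreme_point_of C} \<noteq> {}" using KM convex_hull_empty by force
  then obtain c where c: "c extreme_point_of C" by blast
  then have "{c. c extreme_point_of C} = {c}" using ext_eq by blast
  then have "C = {c}" using KM by simp
  then have "?cc G = c" "?cc F = c" using inC[OF G] inC[OF F] by auto
  \<comment> \<open>Both interpolants now belong to the same extended symbol, which is full because
    \<open>c\<close> is extreme; uniqueness there is carried back by multiplication with
    \<zeta>.\<close>
  then have "contr_interp (stepS \<Phi> c) (\<lambda>\<theta>. mat (cis (of_int (-1) * \<theta>)) ** G \<theta>)"
    "contr_interp (stepS \<Phi> c) (\<lambda>\<theta>. mat (cis (of_int (-1) * \<theta>)) ** F \<theta>)"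
    using contr_interp_stepS[OF \<Phi> G] contr_interp_stepS[OF \<Phi> F] by simp_all
  then have "AE \<theta> in circ. mat (cis (of_int (-1) * \<theta>)) ** G \<theta> = mat (cis (of_int (-1) * \<theta>)) ** F \<theta>"
    using c extreme_imp_full[OF \<Phi> ec] unfolding C_def by (intro full_interp_unique[OF Linf_stepS[OF \<Phi>]]) auto
  then show ?thesis
  proof eventually_elim
    case (elim \<theta>)
    then have "?Z \<theta> ** (mat (cis (of_int (-1) * \<theta>)) ** G \<theta>) = ?Z \<theta> ** (mat (cis (of_int (-1) * \<theta>)) ** F \<theta>)" by simp
    then show ?case by (simp add: matrix_mul_assoc mat_mat_mult cis_mult)
  qed
qed

section \<open>Pointwise deficiency of the extremal functions\<close>

definition orth_proj :: "complex^'n^'n \<Rightarrow> bool" where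
  "orth_proj P \<longleftrightarrow> adjoint_mat P = P \<and> P ** P = P"

lemma orth_proj_inner: "orth_proj P \<Longrightarrow> (P *v x) \<bullet> y = (P *v x) \<bullet> (P *v y)"
  using inner_matrix_adjoint[of P "P *v x" y]
  by (simp add: orth_proj_def matrix_vector_mul_assoc)

lemma orth_proj_idem: "orth_proj P \<Longrightarrow> P *v (P *v x) = P *v x"
  by (simp add: orth_proj_def matrix_vector_mul_assoc)

lemma orth_proj_norm_le: "orth_proj P \<Longrightarrow> norm (P *v x) \<le> norm x"
proof -
  assume P: "orth_proj P"
  have "norm (P *v x) * norm (P *v x) = (P *v x) \<bullet> x"
    using orth_proj_inner[OF P, of x x] by (simp flip: power2_eq_square add: power2_norm_eq_inner)
  also have "\<dots> \<le> norm (P *v x) * norm x" by (rule norm_cauchy_schwarz)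
  finally show ?thesis by (cases "P *v x = 0") auto
qed

lemma cip_matrix_adjoint: "cip (A *v x) y = cip x (adjoint_mat A *v y)"
proof -
  have "Re (cip (A *v x) y) = Re (cip x (adjoint_mat A *v y))" for x
    by (simp add: Re_cip inner_matrix_adjoint)
  from this[of x] this[of "(-\<i>) *s x"] show ?thesis
    by (simp only: vector_scalar_commute cip_smult_left) (simp add: complex_eq_iff)
qed

text \<open>One Gram--Schmidt step; for \<open>P f = 0\<close> the junk value \<open>x / 0 = 0\<close> makes it the identity.\<close>

definition gs_step :: "complex^'n^'n \<Rightarrow> complex^'n \<Rightarrow> complex^'n^'n" where
  "gs_step P f = P - (\<chi> i j. (P *v f) $ i * cnj ((P *v f) $ j) / of_real ((norm (P *v f))\<^sup>2))"

lemma gs_step_mult: "gs_step P f *v x = P *v x - (cip x (P *v f) / of_real ((norm (P *v f))\<^sup>2)) *s (P *v f)"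
  for P :: "complex^'n^'n"
proof -
  have "(\<chi> i j. w $ i * cnj (w $ j) / d) *v x = (cip x w / d) *s w" for w :: "complex^'n" and d
    by (simp add: vec_eq_iff matrix_vector_mult_def cip_def sum_divide_distrib sum_distrib_left mult_ac)
  then show ?thesis by (simp add: gs_step_def matrix_vector_mult_diff_rdistrib)
qed

lemma cip_self: "cip x x = of_real ((norm x)\<^sup>2)"
proof -
  have "Im (cip x x) = 0" using arg_cong[OF cip_cnj[of x x], of Im] by simp
  then show ?thesis by (simp add: complex_eq_iff Re_cip power2_norm_eq_inner del: of_real_power)
qed

text \<open>The trace stands in for the rank of a projection: a step lowers it by 1 if
  \<open>P *v f\<close> is nonzero and by 0 otherwise. A positive trace will later certify a nonzero
  projection.\<close>

lemma gs_step:
  fixes P :: "complex^'n^'n"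
  assumes P: "orth_proj P"
  shows "orth_proj (gs_step P f)" "gs_step P f *v f = 0"
    "P *v g = 0 \<Longrightarrow> gs_step P f *v g = 0" "Re (trace (gs_step P f)) \<ge> Re (trace P) - 1"
proof -
  define w where "w = P *v f"
  define d where "d = complex_of_real ((norm w)\<^sup>2)"
  have Pw: "P *v w = w" by (simp add: w_def orth_proj_idem[OF P])
  have adj: "adjoint_mat P = P" using P by (simp add: orth_proj_def)
  have cw: "cip (P *v x) w = cip x w" for x using cip_matrix_adjoint[of P x w] by (simp add: adj Pw)
  have ww: "cip w w = d" by (simp add: d_def cip_self del: of_real_power)
  have m: "gs_step P f *v x = P *v x - (cip x w / d) *s w" for x
    by (simp add: gs_step_mult w_def d_def)
  have wd: "(d / d) *s w = w"
  proof (cases "w = 0")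
    case False
    then have "d \<noteq> 0" by (simp add: d_def)
    then show ?thesis by simp
  qed simp
  have cfw: "cip f w = d" using cw[of f] ww by (simp add: w_def)
  show "gs_step P f *v f = 0" by (simp only: m cfw wd) (simp add: w_def)
  show "gs_step P f *v g = 0" if "P *v g = 0"
  proof -
    have "cip g w = 0" using cw[of g] that by (simp add: cip_def)
    then show ?thesis using that by (simp add: m)
  qed
  have "gs_step P f *v (gs_step P f *v x) = gs_step P f *v x" for x
  proof -
    have "gs_step P f *v w = 0" by (simp only: m Pw ww wd) simp
    then have "gs_step P f *v (gs_step P f *v x) = gs_step P f *v (P *v x)"
      by (subst (2) m) (simp add: matrix_vector_mult_diff_distrib vector_scalar_commute)
    also have "\<dots> = gs_step P f *v x" by (simp add: m orth_proj_idem[OF P] cw)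
    finally show ?thesis .
  qed
  then have "gs_step P f ** gs_step P f = gs_step P f" by (simp add: matrix_eq matrix_vector_mul_assoc)
  moreover have "adjoint_mat (gs_step P f) = gs_step P f"
  proof -
    have "cnj (P $ j $ i) = P $ i $ j" for i j using arg_cong[OF adj, of "\<lambda>A. A $ i $ j"] by (simp add: adjoint_mat_def)
    then show ?thesis by (simp add: adjoint_mat_def gs_step_def vec_eq_iff mult.commute)
  qed
  ultimately show "orth_proj (gs_step P f)" by (simp add: orth_proj_def)
  have "trace (gs_step P f) = trace P - cip w w / d"
    by (simp add: trace_def gs_step_def sum_subtractf cip_def w_def d_def sum_divide_distrib)
  moreover have "Re (cip w w / d) \<le> 1" by (simp add: ww)
  ultimately show "Re (trace (gs_step P f)) \<ge> Re (trace P) - 1" by simp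
qed

text \<open>Gram-Schmidt is an explicit formula in the functions \<open>f s\<close>, valid also
  where they become dependent, so measurability persists without pointwise choices of bases.\<close>

lemma measurable_projection:
  fixes f :: "'b \<Rightarrow> real \<Rightarrow> complex^'n"
  assumes "finite S" "\<And>s. s \<in> S \<Longrightarrow> f s \<in> borel_measurable circ"
  obtains P :: "real \<Rightarrow> complex^'n^'n" where "P \<in> borel_measurable circ" "\<And>\<theta>. orth_proj (P \<theta>)"
    "\<And>\<theta> s. s \<in> S \<Longrightarrow> P \<theta> *v f s \<theta> = 0" "\<And>\<theta>. Re (trace (P \<theta>)) \<ge> real CARD('n) - real (card S)"
proof -
  have "\<exists>P. P \<in> borel_measurable circ \<and> (\<forall>\<theta>. orth_proj (P \<theta>)) \<and> (\<forall>\<theta>. \<forall>s\<in>S. P \<theta> *v f s \<theta> = 0)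
      \<and> (\<forall>\<theta>. Re (trace (P \<theta> :: complex^'n^'n)) \<ge> real CARD('n) - real (card S))"
    using assms
  proof (induction S rule: finite_induct)
    case empty
    have "adjoint_mat (mat 1) = (mat 1 :: complex^'n^'n)" by (simp add: adjoint_mat_mat)
    then show ?case by (intro exI[of _ "\<lambda>_. mat 1"]) (simp add: orth_proj_def trace_I)
  next
    case (insert s S)
    then obtain P where P: "P \<in> borel_measurable circ" "\<And>\<theta>. orth_proj (P \<theta>)" "\<And>\<theta> s. s \<in> S \<Longrightarrow> P \<theta> *v f s \<theta> = 0"
      "\<And>\<theta>. Re (trace (P \<theta> :: complex^'n^'n)) \<ge> real CARD('n) - real (card S)" by auto
    have fm: "f s \<in> borel_measurable circ" using insert by simp
    have wm: "(\<lambda>\<theta>. P \<theta> *v f s \<theta>) \<in> borel_measurable circ" by (rule measurable_matrix_vector[OF P(1) fm])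
    have nm: "(\<lambda>\<theta>. norm (P \<theta> *v f s \<theta>)) \<in> borel_measurable circ"
      by (rule measurable_compose[OF wm]) simp
    have cm: "(\<lambda>z::complex. cnj z) \<in> borel_measurable borel"
      by (intro borel_measurable_continuous_onI continuous_intros)
    have om: "(\<lambda>x. complex_of_real x) \<in> borel_measurable borel"
      by (intro borel_measurable_continuous_onI continuous_intros)
    have "(\<lambda>\<theta>. gs_step (P \<theta>) (f s \<theta>)) \<in> borel_measurable circ"
      unfolding gs_step_def
      by (intro borel_measurable_diff P(1) measurable_vec_lambda borel_measurable_divide borel_measurable_times
          measurable_compose[OF _ cm] measurable_compose[OF _ om] measurable_vec_nth wm borel_measurable_power nm)
    moreover have "Re (trace (gs_step (P \<theta>) (f s \<theta>))) \<ge> real CARD('n) - real (card (insert s S))" for \<theta>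
      using gs_step(4)[OF P(2), of \<theta> "f s \<theta>"] P(4)[of \<theta>] insert.hyps by simp
    ultimately show ?case
      by (intro exI[of _ "\<lambda>\<theta>. gs_step (P \<theta>) (f s \<theta>)"]) (auto intro: gs_step(1,2,3)[OF P(2)] P(3))
  qed
  then show thesis using that by blast
qed

text \<open>By \<open>norm_Pm_split\<close> the Hankel image of the shifted function is that of
  \<open>g\<close> without its leading row. So the image of \<open>g\<close> is at least as long as
  that of \<open>f\<close>, while \<open>g\<close> is as long as \<open>f\<close>.\<close>

lemma extremal_shift_back:
  assumes \<Psi>: "Linf \<Psi>" "contr \<Psi>" and f: "f \<in> extremal \<Psi>" "cf f 0 = 0"
  shows "sh (-1) f \<in> extremal \<Psi>"
proof -
  define g where "g = sh (-1) f"
  have fH: "f \<in> H2X" "norm (Hk \<Psi> f) = norm f" using f by (auto simp: extremal_def)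
  have g: "g \<in> H2X" unfolding g_def using fH f by (intro H2X_sh_back) auto
  have fg: "f = sh 1 g" by (simp add: g_def sh_sh)
  have "(norm (Hk \<Psi> g))\<^sup>2 = (norm (cf (mm \<Psi> g) (-1)))\<^sup>2 + (norm (Hk \<Psi> f))\<^sup>2"
    unfolding Hk_def fg by (subst norm_Pm_split) (simp add: sh_mm[OF \<Psi>(1), symmetric])
  then have "(norm g)\<^sup>2 \<le> (norm (Hk \<Psi> g))\<^sup>2" using fH by (simp add: fg)
  then have "norm g \<le> norm (Hk \<Psi> g)" by (rule power2_le_imp_le) simp
  then have "norm (Hk \<Psi> g) = norm g" using \<Psi>(2) g by (simp add: contr_def antisym)
  then show ?thesis using g by (simp add: extremal_def g_def)
qed

text \<open>If the values \<open>f(0)\<close> of extremal functions do not fill \<open>\<complex>\<^sup>n\<close>, then the extremal functions fail to span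
  at almost every point: the complement \<open>V\<close> of \<open>E \<inter> z H\<^sup>2\<close> in \<open>E\<close> has dimension less than \<open>n\<close>, and a
  maximiser over the unit ball of \<open>E\<close> of the distance to the pointwise span of \<open>V\<close> would be
  divisible by every power of \<open>z\<close>.\<close>

lemma extremal_pointwise_deficient:
  fixes \<Psi> :: "real \<Rightarrow> complex^'n^'n"
  assumes \<Psi>: "Linf \<Psi>" "contr \<Psi>" and ec: "ess_coercive \<Psi> \<delta>" "\<delta> > 0"
    and nf: "\<And>f. f \<in> extremal \<Psi> \<Longrightarrow> cf f 0 \<noteq> x0"
  obtains P where "Linf P" "\<And>\<theta>. orth_proj (P \<theta>)" "\<And>\<theta>. P \<theta> \<noteq> 0" "\<And>f. f \<in> extremal \<Psi> \<Longrightarrow> mm P f = 0"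
proof -
  define E where "E = extremal \<Psi>"
  define E0 where "E0 = {f \<in> E. cf f 0 = 0}"
  define V where "V = {u \<in> E. \<forall>f\<in>E0. u \<bullet> f = 0}"
  define A where "A = (\<lambda>f. cf f 0) ` E"
  have sE: "subspace E" unfolding E_def by (rule subspace_extremal[OF \<Psi>])
  have cE: "closed E" unfolding E_def by (rule closed_extremal[OF \<Psi>(1)])
  have EH: "f \<in> H2X" if "f \<in> E" for f using that by (simp add: E_def extremal_def)
  have Ecs: "cs c f \<in> E" if "f \<in> E" for c f using that unfolding E_def by (rule extremal_cs[OF \<Psi>(1)])
  have sE0: "subspace E0"
    using sE by (auto simp: E0_def subspace_def cf_zero cf_add cf_scaleR)
  have cE0: "closed E0"
  proof -
    have "E0 = E \<inter> (\<lambda>f. cf f 0) -` {0}" by (auto simp: E0_def)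
    moreover have "closed ((\<lambda>f::'n L2. cf f 0) -` {0})"
      by (intro closed_vimage closed_singleton linear_continuous_on bounded_linear_cf)
    ultimately show ?thesis by (simp add: closed_Int cE)
  qed
  have E0cs: "cs c f \<in> E0" if "f \<in> E0" for c f using that Ecs by (simp add: E0_def cf_cs)
  have split: "\<exists>u\<in>V. \<exists>p\<in>E0. f = u + p \<and> (norm f)\<^sup>2 = (norm u)\<^sup>2 + (norm p)\<^sup>2" if f: "f \<in> E" for f
  proof -
    obtain p where p: "p \<in> E0" "\<And>s. s \<in> E0 \<Longrightarrow> (f - p) \<bullet> s = 0"
      by (rule closed_subspace_projection[OF sE0 cE0, of f]; rule that; assumption)
    have pE: "p \<in> E" using p by (simp add: E0_def)
    have "f - p \<in> V" using p(2) f pE sE by (auto simp: V_def subspace_diff)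
    moreover have "(norm ((f - p) + p))\<^sup>2 = (norm (f - p))\<^sup>2 + (norm p)\<^sup>2"
      using p(2)[OF p(1)] unfolding power2_norm_eq_inner by (simp only: inner_add inner_commute[of p "f - p"])
    ultimately show ?thesis using p(1) by (intro bexI[of _ "f - p"] bexI[of _ p]) auto
  qed
  have sV: "subspace V" using sE by (auto simp: V_def subspace_def inner_add_left)
  have Vcs: "cs c u \<in> V" if "u \<in> V" for c u
    using that Ecs E0cs by (auto simp: V_def inner_cs)
  \<comment> \<open>Evaluation at 0 is injective on \<open>V\<close>, so a basis of the space
    \<open>A\<close> of values lifts to generators of \<open>V\<close>; there are fewer than
    \<open>CARD('n)\<close> of them.\<close>
  have Vinj: "u = 0" if "u \<in> V" "cf u 0 = 0" for u
  proof -
    have "u \<in> E0" using that by (auto simp: V_def E0_def)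
    then have "u \<bullet> u = 0" using that by (auto simp: V_def)
    then show ?thesis by simp
  qed
  have vsA: "vec.subspace A"
  proof (rule vec.subspaceI)
    show "0 \<in> A" using subspace_0[OF sE] cf_zero by (force simp: A_def)
    show "x + y \<in> A" if xy: "x \<in> A" "y \<in> A" for x y
    proof -
      obtain f g where "f \<in> E" "g \<in> E" "x = cf f 0" "y = cf g 0" using xy unfolding A_def by blast
      then show ?thesis using subspace_add[OF sE, of f g] cf_add[of f g 0] unfolding A_def by (metis imageI)
    qed
    show "c *s x \<in> A" if x: "x \<in> A" for c x
    proof -
      obtain f where "f \<in> E" "x = cf f 0" using x unfolding A_def by blast
      then show ?thesis using Ecs[of f c] cf_cs[of c f 0] unfolding A_def by (metis imageI)
    qed
  qed
  obtain B where B: "B \<subseteq> A" "vec.independent B" "A \<subseteq> vec.span B" "card B = vec.dim A"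
    using vec.basis_exists[of A] by blast
  have finB: "finite B" using B(2) by (rule vec.finiteI_independent)
  have "x0 \<notin> A" using nf by (auto simp: A_def E_def)
  then have "vec.span A \<noteq> UNIV" using vsA by (metis UNIV_I vec.span_eq_iff)
  then have "\<not> vec.dim (UNIV :: (complex^'n) set) \<le> vec.dim A" using vec.dim_eq_span[of A UNIV] by auto
  then have cB: "card B < CARD('n)" using B(4) by (simp add: vec_dim_card del: vec.dim_UNIV)
  have "\<exists>u\<in>V. cf u 0 = x" if x: "x \<in> B" for x
  proof -
    obtain f where f: "f \<in> E" "x = cf f 0" using x B(1) unfolding A_def by blast
    obtain u p where "u \<in> V" "p \<in> E0" "f = u + p" using split[OF f(1)] by blast
    then show ?thesis using f(2) by (intro bexI[of _ u]) (auto simp: cf_add E0_def)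
  qed
  then obtain u where u: "\<And>x. x \<in> B \<Longrightarrow> u x \<in> V" "\<And>x. x \<in> B \<Longrightarrow> cf (u x) 0 = x" by metis
  \<comment> \<open>\<open>P \<theta>\<close> annihilates the values of all generators of
    \<open>V\<close>. As there are fewer than \<open>CARD('n)\<close>, its trace is positive at
    every \<open>\<theta>\<close>.\<close>
  obtain P :: "real \<Rightarrow> complex^'n^'n" where P: "P \<in> borel_measurable circ" "\<And>\<theta>. orth_proj (P \<theta>)"
    "\<And>\<theta> s. s \<in> B \<Longrightarrow> P \<theta> *v rep (u s) \<theta> = 0" "\<And>\<theta>. Re (trace (P \<theta>)) \<ge> real CARD('n) - real (card B)"
  proof (rule measurable_projection[OF finB, of "\<lambda>s. rep (u s)"])
    show "rep (u s) \<in> borel_measurable circ" for s using sq_int_rep by (auto simp: sq_int_def)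
  qed (rule that; assumption)
  have LP: "Linf P"
    by (rule LinfI[OF P(1), of 1]) (use orth_proj_norm_le[OF P(2)] in auto)
  have Pne: "P \<theta> \<noteq> 0" for \<theta>
  proof
    assume "P \<theta> = 0"
    then show False using P(4)[of \<theta>] cB by (simp add: trace_def)
  qed
  have Pu: "mm P (u s) = 0" if "s \<in> B" for s
    unfolding mm_def zero_L2_def using P(3)[OF that] by simp
  have PV: "mm P w = 0" if w: "w \<in> V" for w
  proof -
    have "cf w 0 \<in> vec.span B" using w B(3) by (auto simp: V_def A_def)
    then obtain \<alpha> where \<alpha>: "cf w 0 = (\<Sum>s\<in>B. \<alpha> s *s s)" using vec.span_finite[OF finB] by auto
    define v where "v = (\<Sum>s\<in>B. cs (\<alpha> s) (u s))"
    have vV: "v \<in> V" unfolding v_def by (intro subspace_sum[OF sV] Vcs u)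
    have "cf v 0 = cf w 0" unfolding v_def \<alpha> cf_sum by (intro sum.cong) (auto simp: cf_cs u)
    then have "w - v = 0" by (intro Vinj subspace_diff[OF sV] w vV) (simp add: cf_diff)
    then have "w = v" by simp
    also have "mm P v = 0"
      unfolding v_def linear_sum[OF linear_mm[OF LP]]
      by (intro sum.neutral ballI) (simp add: Pu linear_0[OF linear_cs] flip: cs_mm[OF LP])
    finally show ?thesis .
  qed
  define K where "K = E \<inter> cball 0 1"
  have cK: "compact K" unfolding K_def E_def by (rule compact_extremal_ball[OF \<Psi> ec])
  have "continuous_on K (\<lambda>f. norm (mm P f))"
    by (intro continuous_intros linear_continuous_on bounded_linear_mm LP)
  moreover have "K \<noteq> {}" using subspace_0[OF sE] by (auto simp: K_def)
  ultimately obtain m where m: "m \<in> K" "\<And>f. f \<in> K \<Longrightarrow> norm (mm P f) \<le> norm (mm P m)"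
    using continuous_attains_sup[OF cK, of "\<lambda>f. norm (mm P f)"] by auto
  have "mm P m = 0"
  proof (rule ccontr)
    assume "mm P m \<noteq> 0"
    define M where "M = {f \<in> K. norm (mm P f) = norm (mm P m)}"
    \<comment> \<open>A maximiser inside the open ball could be scaled up to a larger value.\<close>
    have n1: "norm f = 1" if "f \<in> M" for f
    proof (rule ccontr)
      assume "norm f \<noteq> 1"
      moreover have "norm f \<le> 1" using that by (simp add: M_def K_def)
      moreover have "f \<noteq> 0" using that \<open>mm P m \<noteq> 0\<close> by (auto simp: M_def mm_zero LP)
      ultimately have nf: "0 < norm f" "norm f < 1" by auto
      have "(1 / norm f) *\<^sub>R f \<in> K" using that sE nf by (auto simp: M_def K_def subspace_mul)
      from m(2)[OF this] have "norm (mm P f) / norm f \<le> norm (mm P m)"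
        by (simp add: mm_scaleR LP)
      then have "norm (mm P m) \<le> norm (mm P m) * norm f" using that nf by (simp add: M_def field_simps)
      then show False using nf \<open>mm P m \<noteq> 0\<close> by simp
    qed
    \<comment> \<open>In \<open>f = w + p\<close> the part \<open>w\<close> in \<open>V\<close> is
      killed by \<open>P\<close>, so the backward shift \<open>g\<close> of \<open>p\<close> is
      again a maximiser. It must have norm 1, which leaves no room for \<open>w\<close>.\<close>
    have step: "\<exists>g\<in>M. f = sh 1 g" if f: "f \<in> M" for f
    proof -
      have fE: "f \<in> E" using f by (simp add: M_def K_def)
      obtain w p where wp: "w \<in> V" "p \<in> E0" "f = w + p" "(norm f)\<^sup>2 = (norm w)\<^sup>2 + (norm p)\<^sup>2" using split[OF fE] by blast
      define g where "g = sh (-1) p"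
      have pg: "p = sh 1 g" by (simp add: g_def sh_sh)
      have gE: "g \<in> E" unfolding g_def E_def using wp(2) by (intro extremal_shift_back[OF \<Psi>]) (auto simp: E0_def E_def)
      have "norm (mm P f) = norm (mm P g)"
        by (simp add: wp(3) mm_add LP PV wp(1)) (simp add: pg flip: sh_mm[OF LP])
      moreover have "norm g \<le> 1"
      proof -
        have "(norm p)\<^sup>2 \<le> (norm f)\<^sup>2" unfolding wp(4) by simp
        then have "(norm p)\<^sup>2 \<le> 1\<^sup>2" by (simp add: n1[OF f])
        then have "norm p \<le> 1" by (rule power2_le_imp_le) simp
        then show ?thesis by (simp add: pg)
      qed
      ultimately have gM: "g \<in> M" using gE f by (simp add: M_def K_def)
      then have "norm p = 1" using n1 by (simp add: pg)
      then have "w = 0" using wp(4) n1[OF f] by simp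
      then show ?thesis using gM wp(3) pg by auto
    qed
    \<comment> \<open>Infinite descent: each element of \<open>M\<close> is \<zeta> times another,
      so every coefficient is traced back to one of negative index.\<close>
    have "cf f (int n) = 0" if "f \<in> M" for f n
      using that
    proof (induction n arbitrary: f)
      case 0
      then obtain g where "g \<in> M" "f = sh 1 g" using step by blast
      then show ?case using EH[of g] by (simp add: M_def K_def cf_sh H2X_def)
    next
      case (Suc n)
      then obtain g where "g \<in> M" "f = sh 1 g" using step by blast
      then show ?case using Suc.IH[of g] by (simp add: cf_sh)
    qed
    moreover have "m \<in> M" using m by (simp add: M_def)
    ultimately have z: "cf m (int n) = 0" for n by blast
    have "cf m k = 0" for k
    proof (cases "k < 0")
      case True
      then show ?thesis using EH[of m] m(1) by (simp add: K_def H2X_def)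
    next
      case False
      then show ?thesis using z[of "nat k"] by simp
    qed
    then have "m = 0" by (rule L2_zeroI)
    then show False using \<open>mm P m \<noteq> 0\<close> by (simp add: mm_zero LP)
  qed
  have "mm P f = 0" if f: "f \<in> E" for f
  proof (cases "f = 0")
    case False
    have "(1 / norm f) *\<^sub>R f \<in> K" using f sE False by (simp add: K_def subspace_mul)
    from m(2)[OF this] have "mm P ((1 / norm f) *\<^sub>R f) = 0" using \<open>mm P m = 0\<close> by simp
    then show ?thesis using False by (simp add: mm_scaleR LP)
  qed (simp add: mm_zero LP)
  then show thesis using that[OF LP P(2) Pne] unfolding E_def by blast
qed

text \<open>The weight \<open>1 - \<epsilon> P\<close> acts as the identity on the extremal
  functions. Its loss on \<open>f\<close> comes only from the component orthogonal to them, where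
  coercivity pays for it.\<close>

lemma strict_interpolant:
  fixes \<Phi> :: "real \<Rightarrow> complex^'n^'n"
  assumes \<Phi>: "Linf \<Phi>" "contr \<Phi>" and ec: "ess_coercive \<Phi> \<delta>" "\<delta> > 0"
    and nf: "\<And>f. f \<in> extremal \<Phi> \<Longrightarrow> cf f 0 \<noteq> x0"
  obtains G \<epsilon> where "contr_interp \<Phi> G" "\<epsilon> > 0"
    "AE \<theta> in circ. \<exists>v. norm v = 1 \<and> norm (G \<theta> *v v) \<le> 1 - \<epsilon>"
proof -
  obtain P where P: "Linf P" "\<And>\<theta>. orth_proj (P \<theta>)" "\<And>\<theta>. P \<theta> \<noteq> 0" "\<And>f. f \<in> extremal \<Phi> \<Longrightarrow> mm P f = 0"
    by (rule extremal_pointwise_deficient[OF \<Phi> ec nf]; (assumption | rule that; assumption))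
  obtain \<eta> where \<eta>: "\<eta> > 0"
    and co: "\<forall>g\<in>H2X. (\<forall>e\<in>extremal \<Phi>. g \<bullet> e = 0) \<longrightarrow> \<eta> * (norm g)\<^sup>2 \<le> (norm g)\<^sup>2 - (norm (Hk \<Phi> g))\<^sup>2"
    using coercive_off_extremal[OF \<Phi> ec] by blast
  \<comment> \<open>The weight costs \<open>2 * \<epsilon> - \<epsilon>\<^sup>2\<close> times the
    squared norm of \<open>mm P g\<close>, which must not exceed \<open>\<eta>\<close> times that of
    \<open>g\<close>; hence half of \<open>\<eta>\<close>. The bound by 1 keeps
    \<open>1 - \<epsilon>\<close> and \<open>2 - \<epsilon>\<close> nonnegative.\<close>
  define \<epsilon> where "\<epsilon> = min (\<eta> / 2) 1"
  have \<epsilon>: "\<epsilon> > 0" "\<epsilon> \<le> 1" "2 * \<epsilon> \<le> \<eta>" using \<eta> by (auto simp: \<epsilon>_def)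
  define R where "R \<theta> = mat 1 - \<epsilon> *\<^sub>R P \<theta>" for \<theta>
  have sc: "\<epsilon> *\<^sub>R A = mat (complex_of_real \<epsilon>) ** A" for A :: "complex^'n^'n"
    by (simp add: mat_mult_eq_smult vec_eq_iff) (simp add: scaleR_conv_of_real)
  have LR: "Linf R" unfolding R_def sc by (intro Linf_diff Linf_const Linf_mult P)
  have mR: "mm R f = f - \<epsilon> *\<^sub>R mm P f" for f
  proof -
    have "mm (\<lambda>\<theta>. mat (complex_of_real \<epsilon>) ** P \<theta>) f = cs (complex_of_real \<epsilon>) (mm P f)"
      unfolding cs_def by (rule mm_mult[OF Linf_const P(1), symmetric])
    also have "\<dots> = \<epsilon> *\<^sub>R mm P f"
      unfolding cs_def mm_def[of "\<lambda>_. mat _"] scaleR_L2_def by (simp add: mat_mult_vec scaleR_as_smult)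
    finally show ?thesis unfolding R_def sc by (subst mm_diff_left) (auto intro!: Linf_const Linf_mult P(1))
  qed
  have iP: "f \<bullet> mm P f = (norm (mm P f))\<^sup>2" for f
  proof -
    have "(\<lambda>\<theta>. adjoint_mat (P \<theta>)) = P" "(\<lambda>\<theta>. P \<theta> ** P \<theta>) = P" using P(2) by (auto simp: orth_proj_def)
    then have "mm P f \<bullet> mm P f = f \<bullet> mm P f"
      using inner_mm[OF P(1), of f "mm P f"] mm_mult[OF P(1) P(1), of f] by simp
    then show ?thesis by (simp add: power2_norm_eq_inner)
  qed
  have nP: "norm (mm P f) \<le> norm f" for f
    using mm_bound[OF P(1), of 1 f] orth_proj_norm_le[OF P(2)] by simp
  have le: "norm (Hk \<Phi> f) \<le> norm (mm R f)" if f: "f \<in> H2X" for f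
  proof -
    obtain e where e: "e \<in> extremal \<Phi>" "\<And>s. s \<in> extremal \<Phi> \<Longrightarrow> (f - e) \<bullet> s = 0"
      by (rule closed_subspace_projection[OF subspace_extremal[OF \<Phi>] closed_extremal[OF \<Phi>(1)], of f]; rule that; assumption)
    define g where "g = f - e"
    have "e \<in> H2X" using e by (simp add: extremal_def)
    then have g: "g \<in> H2X" using f by (simp add: g_def H2X_diff)
    have fe: "f = e + g" by (simp add: g_def)
    have Pf: "mm P f = mm P g" by (simp add: fe mm_add P e)
    have "(norm (mm R f))\<^sup>2 = (norm f)\<^sup>2 - (2 * \<epsilon> - \<epsilon>\<^sup>2) * (norm (mm P g))\<^sup>2"
    proof -
      have "(norm (f - \<epsilon> *\<^sub>R p))\<^sup>2 = (norm f)\<^sup>2 - 2 * \<epsilon> * (f \<bullet> p) + \<epsilon>\<^sup>2 * (norm p)\<^sup>2" for p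
        unfolding power2_norm_eq_inner by (simp add: inner_diff inner_commute power2_eq_square algebra_simps)
      from this[of "mm P f"] show ?thesis using iP[of f] by (simp add: mR Pf algebra_simps)
    qed
    moreover have "(2 * \<epsilon> - \<epsilon>\<^sup>2) * (norm (mm P g))\<^sup>2 \<le> \<eta> * (norm g)\<^sup>2"
    proof (rule mult_mono)
      have "0 \<le> \<epsilon>\<^sup>2" by simp
      then show "2 * \<epsilon> - \<epsilon>\<^sup>2 \<le> \<eta>" using \<epsilon>(3) by linarith
    qed (use nP \<eta> in \<open>auto intro: power_mono\<close>)
    moreover have "\<eta> * (norm g)\<^sup>2 \<le> (norm f)\<^sup>2 - (norm (Hk \<Phi> f))\<^sup>2"
      using co[rule_format, OF g] e(2) defect_add_extremal[OF \<Phi> e(1) g] by (simp add: g_def)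
    ultimately have "(norm (Hk \<Phi> f))\<^sup>2 \<le> (norm (mm R f))\<^sup>2" by linarith
    then show ?thesis by (rule power2_le_imp_le) simp
  qed
  obtain G where G: "Linf G" "Hinf (\<lambda>\<theta>. \<Phi> \<theta> - G \<theta>)" "AE \<theta> in circ. \<forall>x. norm (G \<theta> *v x) \<le> norm (R \<theta> *v x)"
    by (rule weighted_nehari[OF \<Phi>(1) LR le]; (assumption | rule that; assumption))
  have Rx: "R \<theta> *v x = x - \<epsilon> *\<^sub>R (P \<theta> *v x)" for \<theta> x
    by (simp add: R_def matrix_vector_mult_diff_rdistrib scaleR_matrix_vector_mult)
  have nR: "norm (R \<theta> *v x) \<le> norm x" for \<theta> x
  proof -
    let ?p = "P \<theta> *v x"
    have "?p \<bullet> x = ?p \<bullet> ?p" by (rule orth_proj_inner[OF P(2)])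
    then have "(norm (R \<theta> *v x))\<^sup>2 = (norm x)\<^sup>2 - \<epsilon> * (2 - \<epsilon>) * (norm ?p)\<^sup>2"
      unfolding Rx power2_norm_eq_inner by (simp add: inner_diff inner_commute algebra_simps)
    also have "\<dots> \<le> (norm x)\<^sup>2" using \<epsilon> by simp
    finally show ?thesis by (rule power2_le_imp_le) simp
  qed
  show thesis
  proof (rule that[of G \<epsilon>])
    have "AE \<theta> in circ. \<forall>x. norm (G \<theta> *v x) \<le> norm x"
      using G(3) by eventually_elim (meson nR order_trans)
    then show "contr_interp \<Phi> G" using G by (simp add: contr_interp_def)
    show "AE \<theta> in circ. \<exists>v. norm v = 1 \<and> norm (G \<theta> *v v) \<le> 1 - \<epsilon>"
      using G(3)
    proof eventually_elim
      case (elim \<theta>)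
      obtain x where x: "P \<theta> *v x \<noteq> 0" using P(3)[of \<theta>] by (auto simp: matrix_eq)
      \<comment> \<open>A unit vector in the range of \<open>P \<theta>\<close>, on which
        \<open>R \<theta>\<close> acts as multiplication by \<open>1 - \<epsilon>\<close>.\<close>
      define v where "v = (1 / norm (P \<theta> *v x)) *\<^sub>R (P \<theta> *v x)"
      have "norm v = 1" using x by (simp add: v_def)
      moreover have "P \<theta> *v v = v" by (simp add: v_def matrix_vector_mult_scaleR orth_proj_idem[OF P(2)])
      then have "R \<theta> *v v = (1 - \<epsilon>) *\<^sub>R v" by (simp add: Rx scaleR_diff_left)
      then have "norm (G \<theta> *v v) \<le> 1 - \<epsilon>" using elim[rule_format, of v] \<epsilon> \<open>norm v = 1\<close> by simp
      ultimately show ?case by blast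
    qed
  qed (rule \<epsilon>)
qed

section \<open>Singular values and the theorem\<close>

lemma bdd_below_sval: "bdd_below ((\<lambda>R. opnorm (A - R)) ` {R::complex^'n^'m. rank R \<le> j})"
  by (rule bdd_belowI[of _ 0]) (auto simp: opnorm_nonneg)

lemma rank_zero_matrix: "rank (0 :: complex^'n^'m) = 0"
proof -
  have "rows (0 :: complex^'n^'m) = {0}" by (auto simp: rows_def row_def vec_eq_iff)
  then show ?thesis by (simp add: row_rank_def_gen vec.dim_eq_0)
qed

lemma sval_le: "rank R \<le> j \<Longrightarrow> sval j A \<le> opnorm (A - R)"
  unfolding sval_def by (rule cINF_lower[OF bdd_below_sval]) simp

lemma sval_le_opnorm: "sval j A \<le> opnorm A"
  using sval_le[of 0 j A] by (simp add: rank_zero_matrix)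

lemma sval_greatest:
  fixes A :: "complex^'n^'m"
  assumes "\<And>R. rank R \<le> j \<Longrightarrow> c \<le> opnorm (A - R)" shows "c \<le> sval j A"
proof -
  have "0 \<in> {R::complex^'n^'m. rank R \<le> j}" by (simp add: rank_zero_matrix)
  then show ?thesis unfolding sval_def using assms by (intro cINF_greatest) blast+
qed

lemma sval_Lipschitz: "sval j A \<le> sval j B + opnorm (A - B)" for A B :: "complex^'n^'m"
proof -
  have "sval j A - opnorm (A - B) \<le> sval j B"
  proof (rule sval_greatest)
    fix R :: "complex^'n^'m" assume "rank R \<le> j"
    then have "sval j A \<le> opnorm (A - R)" by (rule sval_le)
    also have "\<dots> \<le> opnorm (A - B) + opnorm (B - R)"
    proof (rule opnorm_le)
      fix x
      have "(A - R) *v x = (A - B) *v x + (B - R) *v x" by (simp add: matrix_vector_mult_diff_rdistrib)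
      then have "norm ((A - R) *v x) \<le> norm ((A - B) *v x) + norm ((B - R) *v x)" by (simp add: norm_triangle_ineq)
      also have "\<dots> \<le> opnorm (A - B) * norm x + opnorm (B - R) * norm x" by (intro add_mono opnorm_mult_le)
      finally show "norm ((A - R) *v x) \<le> (opnorm (A - B) + opnorm (B - R)) * norm x" by (simp add: distrib_right)
    qed
    finally show "sval j A - opnorm (A - B) \<le> opnorm (B - R)" by simp
  qed
  then show ?thesis by simp
qed

text \<open>Measurability of the functions in \<open>so_err\<close> rests on this: the infimum over
  matrices of small rank is uncountable, so it is obtained from a Lipschitz bound.\<close>

lemma continuous_sval: "continuous_on UNIV (sval j :: complex^'n^'m \<Rightarrow> real)"
proof -
  obtain K where K: "K > 0" "\<And>(A::complex^'n^'m) x. norm (A *v x) \<le> norm A * norm x * K"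
    using bounded_bilinear.pos_bounded[OF bounded_bilinear_matrix_vector] by blast
  have o: "opnorm A \<le> K * norm A" for A :: "complex^'n^'m"
    by (rule opnorm_le) (use K(2)[of A] in \<open>simp add: mult_ac\<close>)
  have "\<bar>sval j A - sval j B\<bar> \<le> K * norm (A - B)" for A B :: "complex^'n^'m"
    using sval_Lipschitz[of j A B] sval_Lipschitz[of j B A] o[of "A - B"] o[of "B - A"]
    by (simp add: norm_minus_commute)
  then have "K-lipschitz_on UNIV (sval j :: complex^'n^'m \<Rightarrow> real)"
    using K(1) by (intro lipschitz_onI) (auto simp: dist_norm)
  then show ?thesis by (rule lipschitz_on_continuous_on)
qed

lemma rank_less_kernel:
  fixes R :: "complex^'n^'n"
  shows "rank R < CARD('n) \<longleftrightarrow> (\<exists>x. x \<noteq> 0 \<and> R *v x = 0)"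
proof -
  have "(\<forall>x. R *v x = 0 \<longrightarrow> x = 0) \<longleftrightarrow> vec.span (rows R) = UNIV"
    using matrix_left_invertible_ker[of R] matrix_left_invertible_span_rows_gen[of R] by simp
  also have "\<dots> \<longleftrightarrow> \<not> rank R < CARD('n)"
  proof
    assume "vec.span (rows R) = UNIV"
    then have "vec.dim (rows R) = CARD('n)" using vec.dim_span[of "rows R"] by (simp add: vec_dim_card del: vec.dim_span vec.dim_UNIV)
    then show "\<not> rank R < CARD('n)" by (simp add: row_rank_def_gen)
  next
    assume "\<not> rank R < CARD('n)"
    then have "vec.dim (UNIV :: (complex^'n) set) \<le> vec.dim (rows R)"
      by (simp add: row_rank_def_gen vec_dim_card del: vec.dim_UNIV)
    then show "vec.span (rows R) = UNIV" using vec.dim_eq_span[of "rows R" UNIV] by auto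
  qed
  finally show ?thesis by blast
qed

text \<open>A matrix of rank below \<open>CARD('n)\<close> has a kernel vector, and on it
  \<open>U - R\<close> acts as the isometry \<open>U\<close>.\<close>

lemma sval_unitary:
  fixes U :: "complex^'n^'n"
  assumes U: "unitary_mat U" and j: "j < CARD('n)"
  shows "sval j U = 1"
proof (rule antisym)
  have "opnorm U \<le> 1" by (rule opnorm_le) (simp add: unitary_mat_norm[OF U])
  then show "sval j U \<le> 1" using sval_le_opnorm[of j U] by simp
  show "1 \<le> sval j U"
  proof (rule sval_greatest)
    fix R :: "complex^'n^'n" assume "rank R \<le> j"
    then obtain x where x: "x \<noteq> 0" "R *v x = 0" using j rank_less_kernel[of R] by auto
    have "norm x = norm ((U - R) *v x)" using x by (simp add: matrix_vector_mult_diff_rdistrib unitary_mat_norm[OF U])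
    also have "\<dots> \<le> opnorm (U - R) * norm x" by (rule opnorm_mult_le)
    finally show "1 \<le> opnorm (U - R)" using x(1) by simp
  qed
qed

text \<open>The rank-one matrix \<open>W\<close> agrees with \<open>G\<close> on \<open>v\<close>
  and vanishes on its orthogonal complement. So \<open>G - W\<close> has a kernel and is an
  admissible approximant, at distance at most \<open>c\<close>.\<close>

lemma sval_pred_le:
  fixes G :: "complex^'n^'n"
  assumes v: "norm v = 1" "norm (G *v v) \<le> c"
  shows "sval (CARD('n) - 1) G \<le> c"
proof -
  define W :: "complex^'n^'n" where "W = (\<chi> i j. (G *v v) $ i * cnj (v $ j))"
  have W: "W *v x = cip x v *s (G *v v)" for x
    by (simp add: W_def vec_eq_iff matrix_vector_mult_def[of "\<chi> i j. _ i j"] cip_def sum_distrib_left sum_distrib_right mult_ac)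
  have "(G - W) *v v = 0"
    using v(1) by (simp add: matrix_vector_mult_diff_rdistrib W cip_self)
  moreover have "v \<noteq> 0" using v(1) by auto
  ultimately have "rank (G - W) < CARD('n)" using rank_less_kernel by blast
  then have "sval (CARD('n) - 1) G \<le> opnorm (G - (G - W))" by (intro sval_le) simp
  also have "\<dots> = opnorm W" by simp
  also have "\<dots> \<le> c"
  proof (rule opnorm_le)
    fix x
    have "cmod (cip x v) \<le> norm x"
    proof (cases "cip x v = 0")
      case False
      \<comment> \<open>Rotates the phase so that the Hermitian product becomes real and the real
        Cauchy-Schwarz inequality applies.\<close>
      define s where "s = cnj (cip x v) / of_real (cmod (cip x v))"
      have "cmod s = 1" using False by (simp add: s_def norm_divide)
      have "of_real (cmod (cip x v)) = s * cip x v"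
        using False by (simp add: s_def complex_norm_square[symmetric] mult.commute power2_eq_square field_simps)
      then have "cmod (cip x v) = Re (cip (s *s x) v)" by (metis Re_complex_of_real cip_smult_left)
      also have "\<dots> \<le> norm (s *s x) * norm v" unfolding Re_cip by (rule norm_cauchy_schwarz)
      finally show ?thesis by (simp add: norm_smult_vec \<open>cmod s = 1\<close> v)
    qed simp
    then have "cmod (cip x v) * norm (G *v v) \<le> norm x * c" using v(2) by (intro mult_mono) auto
    then show "norm (W *v x) \<le> c * norm x" by (simp add: W norm_smult_vec mult.commute)
  qed
  finally show ?thesis .
qed

section \<open>Superoptimal errors of interpolants\<close>

lemma measurable_so_err:
  assumes "Linf \<Phi>" "Linf F"
  shows "(\<lambda>\<theta>. ereal (sval j (\<Phi> \<theta> - F \<theta>))) \<in> borel_measurable circ"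
proof -
  have "(\<lambda>\<theta>. \<Phi> \<theta> - F \<theta>) \<in> borel_measurable circ" by (intro Linf_measurable Linf_diff assms)
  then have "(\<lambda>\<theta>. sval j (\<Phi> \<theta> - F \<theta>)) \<in> borel_measurable circ"
    by (rule measurable_compose[OF _ borel_measurable_continuous_onI[OF continuous_sval]])
  then show ?thesis by simp
qed

lemma so_err_le:
  assumes "Linf \<Phi>" "Linf F" "AE \<theta> in circ. sval j (\<Phi> \<theta> - F \<theta>) \<le> c"
  shows "so_err \<Phi> j F \<le> ereal c"
  unfolding so_err_def using assms(3) by (intro esssup_I measurable_so_err assms) simp

lemma so_err_unitary:
  fixes \<Phi> F :: "real \<Rightarrow> complex^'n^'n"
  assumes "Linf \<Phi>" "Linf F" "AE \<theta> in circ. unitary_mat (\<Phi> \<theta> - F \<theta>)" "j < CARD('n)"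
  shows "so_err \<Phi> j F = 1"
proof -
  have "so_err \<Phi> j F = esssup circ (\<lambda>_. 1)"
    unfolding so_err_def
  proof (rule esssup_AE_cong[OF measurable_so_err[OF assms(1,2)]])
    show "AE \<theta> in circ. ereal (sval j (\<Phi> \<theta> - F \<theta>)) = 1"
      using assms(3) by eventually_elim (simp add: sval_unitary assms(4) one_ereal_def)
  qed simp
  also have "\<dots> = 1" by (rule esssup_const) (simp add: emeasure_circ_space)
  finally show ?thesis .
qed

lemma sval_0: "sval 0 A = opnorm A" for A :: "complex^'n^'n"
proof (rule antisym[OF sval_le_opnorm sval_greatest])
  fix R :: "complex^'n^'n" assume "rank R \<le> 0"
  then have "rows R \<subseteq> {0}" by (simp add: row_rank_def_gen vec.dim_eq_0)
  then have "row i R = 0" for i by (auto simp: rows_def)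
  then have "R = 0" by (simp add: row_def vec_eq_iff)
  then show "opnorm A \<le> opnorm (A - R)" by simp
qed

lemma contr_interp_of_so_err:
  assumes \<Phi>: "Linf \<Phi>" and F: "Hinf F" and le: "so_err \<Phi> 0 F \<le> 1"
  shows "contr_interp \<Phi> (\<lambda>\<theta>. \<Phi> \<theta> - F \<theta>)"
proof -
  have LF: "Linf F" using F by (simp add: Hinf_def)
  have "AE \<theta> in circ. ereal (sval 0 (\<Phi> \<theta> - F \<theta>)) \<le> so_err \<Phi> 0 F"
    unfolding so_err_def by (rule esssup_AE)
  then have "AE \<theta> in circ. \<forall>x. norm ((\<Phi> \<theta> - F \<theta>) *v x) \<le> norm x"
  proof eventually_elim
    case (elim \<theta>)
    then have "ereal (opnorm (\<Phi> \<theta> - F \<theta>)) \<le> ereal 1" using le by (metis sval_0 one_ereal_def order_trans)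
    then have o: "opnorm (\<Phi> \<theta> - F \<theta>) \<le> 1" by simp
    show ?case
    proof
      fix x
      show "norm ((\<Phi> \<theta> - F \<theta>) *v x) \<le> norm x"
        using opnorm_mult_le[of "\<Phi> \<theta> - F \<theta>" x] mult_right_mono[OF o norm_ge_zero[of x]] by simp
    qed
  qed
  then show ?thesis using \<Phi> F LF by (simp add: contr_interp_def Linf_diff)
qed

lemma so_dom_Hinf: "F \<in> so_dom \<Phi> j \<Longrightarrow> Hinf F"
  by (induction j) auto

lemma so_dom_Suc_omega0: "F \<in> so_dom \<Phi> (Suc j) \<Longrightarrow> F \<in> so_omega \<Phi> 0"
  by (induction j) auto

declare so_dom.simps [simp del] so_omega.simps [simp del]

text \<open>For any \<open>F\<close> with error at most 1 at level 0, the difference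
  \<open>\<Phi> - F\<close> is a contractive interpolant and thus coincides with \<open>U\<close>,
  whose singular values are all 1. Every later minimisation is therefore decided at level 0.\<close>

lemma unique_contr_imp_superopt:
  fixes \<Phi> :: "real \<Rightarrow> complex^'n^'n"
  assumes \<Phi>: "Linf \<Phi>" and U: "unitary_interpolant \<Phi> U"
    and uni: "\<And>G. contr_interp \<Phi> G \<Longrightarrow> AE \<theta> in circ. G \<theta> = U \<theta>"
    and j: "j < CARD('n)"
  shows "superopt_sv \<Phi> j = 1"
proof -
  define FU where "FU \<theta> = \<Phi> \<theta> - U \<theta>" for \<theta>
  have HFU: "Hinf FU" using U by (simp add: unitary_interpolant_def FU_def[abs_def])
  have un: "AE \<theta> in circ. unitary_mat (\<Phi> \<theta> - FU \<theta>)" using U by (simp add: unitary_interpolant_def FU_def)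
  have eU: "so_err \<Phi> i FU = 1" if "i < CARD('n)" for i
    using HFU un that by (intro so_err_unitary \<Phi>) (auto simp: Hinf_def)
  have opt: "so_err \<Phi> i F = 1" if F: "Hinf F" "so_err \<Phi> 0 F \<le> 1" and i: "i < CARD('n)" for F i
  proof -
    have "AE \<theta> in circ. \<Phi> \<theta> - F \<theta> = U \<theta>" using uni[OF contr_interp_of_so_err[OF \<Phi> F]] .
    then have "AE \<theta> in circ. unitary_mat (\<Phi> \<theta> - F \<theta>)"
      using un by eventually_elim (simp add: FU_def)
    then show ?thesis using F i by (intro so_err_unitary \<Phi>) (auto simp: Hinf_def)
  qed
  have c0: "0 < CARD('n)" by simp
  \<comment> \<open>An error below 1 would again make \<open>\<Phi> - F\<close> equal to
    \<open>U\<close>, and then the error is exactly 1.\<close>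
  have min0: "1 \<le> so_err \<Phi> 0 F" if "Hinf F" for F
    using opt[OF that _ c0] by (cases "so_err \<Phi> 0 F \<le> 1") auto
  have main: "FU \<in> so_dom \<Phi> i \<and> (\<forall>F\<in>so_dom \<Phi> i. 1 \<le> so_err \<Phi> i F)" if "i < CARD('n)" for i
    using that
  proof (induction i)
    case 0
    then show ?case using HFU min0 by (simp add: so_dom.simps)
  next
    case (Suc i)
    then have IH: "FU \<in> so_dom \<Phi> i" "\<And>F. F \<in> so_dom \<Phi> i \<Longrightarrow> 1 \<le> so_err \<Phi> i F" and i: "i < CARD('n)" by auto
    have "FU \<in> so_dom \<Phi> (Suc i)" using IH eU[OF i] by (simp add: so_dom.simps so_omega.simps)
    moreover have "so_err \<Phi> (Suc i) F = 1" if F: "F \<in> so_dom \<Phi> (Suc i)" for F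
    proof (rule opt)
      show "Hinf F" by (rule so_dom_Hinf[OF F])
      have "so_err \<Phi> 0 F \<le> so_err \<Phi> 0 FU"
        using so_dom_Suc_omega0[OF F] HFU by (simp add: so_omega.simps so_dom.simps)
      then show "so_err \<Phi> 0 F \<le> 1" by (simp add: eU)
    qed (rule Suc.prems)
    ultimately show ?case by simp
  qed
  show ?thesis
    unfolding superopt_sv_def
  proof (rule antisym)
    show "(INF F\<in>so_dom \<Phi> j. so_err \<Phi> j F) \<le> 1"
      using main[OF j] eU[OF j] by (metis INF_lower)
    show "1 \<le> (INF F\<in>so_dom \<Phi> j. so_err \<Phi> j F)"
      using main[OF j] by (intro INF_greatest) blast
  qed
qed

text \<open>The least error at each level is 1, and a contractive \<open>G\<close> never exceeds it,
  since singular values are bounded by the operator norm. So it survives every minimisation and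
  competes at the last level.\<close>

lemma superopt_contr_interp_dom:
  fixes \<Phi> :: "real \<Rightarrow> complex^'n^'n"
  assumes \<Phi>: "Linf \<Phi>" and so: "\<And>j. j < CARD('n) \<Longrightarrow> superopt_sv \<Phi> j = 1"
    and G: "contr_interp \<Phi> G" and j: "j < CARD('n)"
  shows "(\<lambda>\<theta>. \<Phi> \<theta> - G \<theta>) \<in> so_dom \<Phi> j"
  using j
proof (induction j)
  let ?F = "\<lambda>\<theta>. \<Phi> \<theta> - G \<theta>"
  have HF: "Hinf ?F" and LG: "Linf G" using G by (auto simp: contr_interp_def)
  case 0
  then show ?case using HF by (simp add: so_dom.simps)
next
  let ?F = "\<lambda>\<theta>. \<Phi> \<theta> - G \<theta>"
  have HF: "Hinf ?F" and LG: "Linf G" and n: "AE \<theta> in circ. \<forall>x. norm (G \<theta> *v x) \<le> norm x"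
    using G by (auto simp: contr_interp_def)
  case (Suc j)
  then have IH: "?F \<in> so_dom \<Phi> j" and j: "j < CARD('n)" by auto
  have "so_err \<Phi> j ?F \<le> ereal 1"
  proof (rule so_err_le[OF \<Phi>])
    show "Linf ?F" by (intro Linf_diff \<Phi> LG)
    show "AE \<theta> in circ. sval j (\<Phi> \<theta> - (\<Phi> \<theta> - G \<theta>)) \<le> 1"
      using n
    proof eventually_elim
      case (elim \<theta>)
      then have "opnorm (G \<theta>) \<le> 1" by (intro opnorm_le) simp
      then show ?case using sval_le_opnorm[of j "G \<theta>"] by simp
    qed
  qed
  moreover have "1 \<le> so_err \<Phi> j H" if "H \<in> so_dom \<Phi> j" for H
    using so[OF j] INF_lower[OF that, of "so_err \<Phi> j"] by (simp add: superopt_sv_def)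
  ultimately show ?case
    using IH by (auto simp: so_dom.simps so_omega.simps one_ereal_def intro: order_trans)
qed

theorem theorem3p4:
  fixes \<Phi> :: "real \<Rightarrow> complex^'n^'n"
  assumes "Linf \<Phi>"
    and "hankel_norm_le \<Phi> 1"
    and "hankel_ess_norm_lt \<Phi> 1"
  shows "unique_unitary_interpolant \<Phi> \<longleftrightarrow> (\<forall>j < CARD('n). superopt_sv \<Phi> j = 1)"
proof -
  note \<Phi> = assms(1)
  have con: "contr \<Phi>" by (rule contr_of_hankel[OF assms(1,2)])
  obtain \<delta> where \<delta>: "\<delta> > 0" "ess_coercive \<Phi> \<delta>"
    by (rule ess_coercive_of_hankel[OF assms(1,3)]; rule that; assumption)
  show ?thesis
  proof
    assume "unique_unitary_interpolant \<Phi>"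
    then obtain U where U: "unitary_interpolant \<Phi> U"
      and uni: "\<And>U V. unitary_interpolant \<Phi> U \<Longrightarrow> unitary_interpolant \<Phi> V \<Longrightarrow> AE \<theta> in circ. U \<theta> = V \<theta>"
      unfolding unique_unitary_interpolant_def by blast
    have "AE \<theta> in circ. G \<theta> = U \<theta>" if "contr_interp \<Phi> G" for G
      by (rule unique_unitary_imp_unique_contr[OF \<Phi> \<delta>(2,1) uni that unitary_interp_contr[OF U]])
    then show "\<forall>j < CARD('n). superopt_sv \<Phi> j = 1"
      using unique_contr_imp_superopt[OF \<Phi> U] by blast
  next
    assume so: "\<forall>j < CARD('n). superopt_sv \<Phi> j = 1"
    have "\<forall>x. \<exists>f\<in>extremal \<Phi>. cf f 0 = x"
    proof (rule ccontr)
      assume "\<not> (\<forall>x. \<exists>f\<in>extremal \<Phi>. cf f 0 = x)"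
      then obtain x0 where x0: "\<And>f. f \<in> extremal \<Phi> \<Longrightarrow> cf f 0 \<noteq> x0" by blast
      obtain G \<epsilon> where G: "contr_interp \<Phi> G" "\<epsilon> > 0"
        "AE \<theta> in circ. \<exists>v. norm v = 1 \<and> norm (G \<theta> *v v) \<le> 1 - \<epsilon>"
        by (rule strict_interpolant[OF \<Phi> con \<delta>(2,1) x0]; (assumption | rule that; assumption))
      \<comment> \<open>The last singular value is the one that detects contraction in a single
        direction. The deficit \<open>\<epsilon>\<close> is the same at almost every point, so it
        survives the essential supremum.\<close>
      let ?j = "CARD('n) - 1" and ?F = "\<lambda>\<theta>. \<Phi> \<theta> - G \<theta>"
      have dom: "?F \<in> so_dom \<Phi> ?j" using so by (intro superopt_contr_interp_dom[OF \<Phi> _ G(1)]) auto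
      have "so_err \<Phi> ?j ?F \<le> ereal (1 - \<epsilon>)"
      proof (rule so_err_le[OF \<Phi>])
        show "Linf ?F" using G(1) \<Phi> by (auto simp: contr_interp_def intro: Linf_diff)
        show "AE \<theta> in circ. sval ?j (\<Phi> \<theta> - (\<Phi> \<theta> - G \<theta>)) \<le> 1 - \<epsilon>"
          using G(3) by eventually_elim (auto intro: sval_pred_le[unfolded One_nat_def])
      qed
      moreover have "1 \<le> so_err \<Phi> ?j ?F"
        using so[rule_format, of ?j] INF_lower[OF dom, of "so_err \<Phi> ?j"] by (simp add: superopt_sv_def)
      ultimately have "ereal 1 \<le> ereal (1 - \<epsilon>)" by (metis one_ereal_def order_trans)
      then show False using G(2) by simp
    qed
    then have full: "full \<Phi>" by (simp add: full_def)
    obtain G where G: "contr_interp \<Phi> G" by (rule contr_interp_exists[OF \<Phi> con])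
    have "unitary_interpolant \<Phi> G"
      using G full_interp_unitary[OF \<Phi> full G] by (simp add: unitary_interpolant_def contr_interp_def)
    then show "unique_unitary_interpolant \<Phi>"
      unfolding unique_unitary_interpolant_def
      using full_interp_unique[OF \<Phi> full] unitary_interp_contr by blast
  qed
qed

end
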